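(* There exist a constant positive integer $m$ and a function $\varepsilon \colon \mathbb{N} \to \mathbb{R}$ with $\varepsilon(n) \to 0$ as $n \to \infty$ such that for all $n \ge 2$, $$\mathbf{max\mbox{-}diam}(n, m) \ge 2^n \exp\left((1 + \varepsilon(n))\sqrt{\tfrac{n}{2} \log n}\right),$$ where $\log$ is the natural logarithm.
   Context: A partial DFA is a triple $\mathcal{A} = (Q, \Sigma, \delta)$ with $Q$ a finite set of states, $\Sigma$ a finite alphabet, and $\delta \colon Q \times \Sigma \rightharpoonup Q$ a partial transition function, extended to words in the usual way. Each word $w \in \Sigma^*$ expresses the partial transformation $q \mapsto \delta(q, w)$ of $Q$ (undefined where $\delta(q,w)$ is undefined). The depth of a partial transformation $f$ expressed by some word is the length of a shortest word expressing $f$. The diameter of $\mathcal{A}$ is the maximum depth over all partial transformations of $Q$ expressed by some word in $\mathcal{A}$ (equivalently, the smallest $\ell \ge 0$ such that every transformation expressed by a word is expressed by a word of length at most $\ell$). $\mathbf{max\mbox{-}diam}(n, m)$ denotes the maximum diameter over all partial DFAs with $n$ states and $m$ letters. *)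

theory Defs
  imports "HOL-Analysis.Analysis"
begin

definition is_pdfa :: "nat \<Rightarrow> nat \<Rightarrow> (nat \<Rightarrow> nat \<Rightarrow> nat option) \<Rightarrow> bool" where
  "is_pdfa n m \<delta> \<longleftrightarrow>
     (\<forall>q a. (q \<ge> n \<or> a \<ge> m) \<longrightarrow> \<delta> q a = None) \<and>
     (\<forall>q a p. \<delta> q a = Some p \<longrightarrow> p < n)"

fun delta_word :: "(nat \<Rightarrow> nat \<Rightarrow> nat option) \<Rightarrow> nat \<Rightarrow> nat list \<Rightarrow> nat option" where
  "delta_word \<delta> q [] = Some q"
| "delta_word \<delta> q (a # w) = (case \<delta> q a of None \<Rightarrow> None | Some p \<Rightarrow> delta_word \<delta> p w)"

definition expressed :: "nat \<Rightarrow> (nat \<Rightarrow> nat \<Rightarrow> nat option) \<Rightarrow> nat list \<Rightarrow> (nat \<Rightarrow> nat option)" where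
  "expressed n \<delta> w = (\<lambda>q. if q < n then delta_word \<delta> q w else None)"

definition words :: "nat \<Rightarrow> nat list set" where
  "words m = {w. set w \<subseteq> {0..<m}}"

definition depth :: "nat \<Rightarrow> nat \<Rightarrow> (nat \<Rightarrow> nat \<Rightarrow> nat option) \<Rightarrow> (nat \<Rightarrow> nat option) \<Rightarrow> nat" where
  "depth n m \<delta> f = (LEAST l. \<exists>w \<in> words m. length w = l \<and> expressed n \<delta> w = f)"

definition diameter :: "nat \<Rightarrow> nat \<Rightarrow> (nat \<Rightarrow> nat \<Rightarrow> nat option) \<Rightarrow> nat" where
  "diameter n m \<delta> = Max (depth n m \<delta> ` (expressed n \<delta> ` words m))"

definition max_diam :: "nat \<Rightarrow> nat \<Rightarrow> nat" where
  "max_diam n m = Max (diameter n m ` {\<delta>. is_pdfa n m \<delta>})"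

end

(*
  Landau's function enters through the labels of tokens and 2^n through the sets of positions they occupy.

  Take k = a^2 tokens on a ring of 2k cells. Every word that is defined on all tokens is forced to process
  the ring in sweeps. A sweep turns the occupancy pattern b 1^i 0^j 1 y into 1^i 0^j 1 b y, and b 1^i 0^j
  into 1^i 0^j b (the inverse of the cool-lex successor rule of Ruskey and Williams), and this permutes all
  (2k choose k) patterns in one cycle. A letter of a partial automaton can only test that a cell is empty,
  so the letters guess: a guess "empty" is checked by undefinedness, and the guesses "occupied" and "empty"
  are counted. A sweep can be completed only if each guess was made k times, which makes all of them correct.
  The two counters consist of two hands of size a + 1 each and therefore cost only O(sqrt n) states.

  Exactly once per cycle of patterns an additional permutation of the first k cells is applied. It is chosen
  such that the labels undergo a prescribed permutation c per cycle, and a word of (2k choose k) * ord c - 1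
  sweeps is then as short as possible. With k ~ n/2 and with c of order exp((1 - o(1)) sqrt(k ln k)) this is
  the claim. Such a c needs the prime number theorem in the form psi(x) ~ x: it has one cycle of length
  p^e, the largest power not exceeding x, for every prime p up to x ~ sqrt(k ln k). The prime number theorem
  is proved by Newman's method, applied to the step function psi(x) - floor(x), with rectangles as contours.
*)

theory Submission
  imports Defs
    "HOL-Complex_Analysis.Complex_Analysis"
    "HOL-Number_Theory.Prime_Powers"
    "HOL-Real_Asymp.Real_Asymp"
    "HOL-Combinatorics.Cycles"
begin

section \<open>Newman's Tauberian theorem\<close>

text \<open>The ring has 2k cells and 4^k = 2^(2k), so every state withheld from it costs a factor
  2. A loss of 2^(O(sqrt n)) disappears in the error term of sqrt(n log n), a linear number of
  control states would not. Hence a unary counter up to k is too expensive, and k is a square so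
  that two hands with a + 1 positions each count to a * a. Only one kind of guess can be refuted:
  "empty" at an occupied cell kills a token, a false "occupied" goes unnoticed. In a completed sweep
  every cell is moved once, so k confirmed empty cells are all there are and no false "occupied" is
  left. The lower bound counts sweeps, and a letter completes at most one. It holds for every word
  with the same effect on the tokens, hence for every word that expresses the same transformation.
  After one cycle of patterns the labels return in an order that is never computed; the additional
  permutation undoes it and then applies c. A bound psi(x) >= const * x would give the right order
  of magnitude of the exponent, but not its constant 1. This is why the prime number theorem
  enters.\<close>

lemma contour_integral_rect_split:
  fixes g :: "complex \<Rightarrow> complex" and d R :: real
  defines "J \<equiv> \<lambda>a b. contour_integral (linepath a b) (\<lambda>w. g w / w)"
  assumes g: "g holomorphic_on S" and S: "convex S" "open S"
    and sub: "cbox (Complex (-d) (-R)) (Complex R R) \<subseteq> S" and d: "d > 0" and R: "R > 0"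
  shows "2 * pi * \<i> * g 0 =
    (J (Complex 0 (-R)) (Complex R (-R)) + J (Complex R (-R)) (Complex R R) + J (Complex R R) (Complex 0 R)) +
    (J (Complex 0 R) (Complex (-d) R) + J (Complex (-d) R) (Complex (-d) (-R)) + J (Complex (-d) (-R)) (Complex 0 (-R)))"
proof -
  let ?f = "\<lambda>w. g w / w"
  define a1 where "a1 = Complex (-d) (-R)"
  define a2 where "a2 = Complex R (-R)"
  define a3 where "a3 = Complex R R"
  define a4 where "a4 = Complex (-d) R"
  have box0: "0 \<in> box a1 a3" using d R by (auto simp: a1_def a3_def in_box_complex_iff)
  have pim: "path_image (rectpath a1 a3) = cbox a1 a3 - box a1 a3"
    using d R by (intro path_image_rectpath_cbox_minus_box) (auto simp: a1_def a3_def)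
  have "(?f has_contour_integral (complex_of_real (2 * pi) * \<i> * winding_number (rectpath a1 a3) 0 * g 0)) (rectpath a1 a3)"
  proof -
    have "0 \<in> interior S" using sub box0 box_subset_cbox S(2) unfolding a1_def a3_def
      by (metis interior_open subsetD)
    moreover have "path_image (rectpath a1 a3) \<subseteq> S - {0}" using pim sub box0 unfolding a1_def a3_def by auto
    ultimately show ?thesis
      using Cauchy_integral_formula_convex_simple[OF S(1) g, of 0 "rectpath a1 a3"] by auto
  qed
  hence hc: "(?f has_contour_integral (2 * pi * \<i> * g 0)) (rectpath a1 a3)"
    using winding_number_rectpath[OF box0] by simp
  have seg: "closed_segment a1 a2 \<subseteq> path_image (rectpath a1 a3)" "closed_segment a2 a3 \<subseteq> path_image (rectpath a1 a3)"
    "closed_segment a3 a4 \<subseteq> path_image (rectpath a1 a3)" "closed_segment a4 a1 \<subseteq> path_image (rectpath a1 a3)"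
    by (auto simp: rectpath_def Let_def path_image_join a1_def a2_def a3_def a4_def)
  have contS: "continuous_on (S - {0}) ?f"
    by (intro continuous_intros holomorphic_on_imp_continuous_on holomorphic_on_subset[OF g]) auto
  have cont: "continuous_on (path_image (rectpath a1 a3)) ?f"
    by (rule continuous_on_subset[OF contS]) (use pim sub box0 in \<open>auto simp: a1_def a3_def\<close>)
  have c: "continuous_on (closed_segment a1 a2) ?f" "continuous_on (closed_segment a2 a3) ?f"
       "continuous_on (closed_segment a3 a4) ?f" "continuous_on (closed_segment a4 a1) ?f"
    using seg cont continuous_on_subset by blast+
  have ci: "?f contour_integrable_on linepath a1 a2" "?f contour_integrable_on linepath a2 a3"
    "?f contour_integrable_on linepath a3 a4" "?f contour_integrable_on linepath a4 a1"
    using c by (auto intro: contour_integrable_continuous_linepath)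
  have "rectpath a1 a3 = linepath a1 a2 +++ linepath a2 a3 +++ linepath a3 a4 +++ linepath a4 a1"
    by (simp add: rectpath_def Let_def a1_def a2_def a3_def a4_def)
  hence "2 * pi * \<i> * g 0 = contour_integral (linepath a1 a2 +++ linepath a2 a3 +++ linepath a3 a4 +++ linepath a4 a1) ?f"
    using contour_integral_unique[OF hc] by simp
  also have "\<dots> = J a1 a2 + J a2 a3 + J a3 a4 + J a4 a1"
    using ci unfolding J_def by (simp add: contour_integrable_joinI)
  \<comment> \<open>The horizontal sides are cut at the imaginary axis, where the estimates change.
    The width \<open>d\<close> to the left stays free: the continued limit function allows only a
    thin strip, the entire partial sums take \<open>d = R\<close>.\<close>
  also have "J a1 a2 = J a1 (Complex 0 (-R)) + J (Complex 0 (-R)) a2"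
    unfolding J_def
  proof (rule contour_integral_split_linepath[OF c(1)])
    show "Complex 0 (-R) \<in> closed_segment a1 a2" using d R
      by (auto simp: a1_def a2_def closed_segment_same_Im closed_segment_eq_real_ivl)
  qed
  also have "J a3 a4 = J a3 (Complex 0 R) + J (Complex 0 R) a4"
    unfolding J_def
  proof (rule contour_integral_split_linepath[OF c(3)])
    show "Complex 0 R \<in> closed_segment a3 a4" using d R
      by (auto simp: a3_def a4_def closed_segment_same_Im closed_segment_eq_real_ivl)
  qed
  finally show ?thesis by (simp add: a1_def a2_def a3_def a4_def algebra_simps)
qed

(* The factor 1 + w^2 / R^2 vanishes at the points where the contour crosses the imaginary axis. It cancels
   the factor 1 / Re w in the estimates of the Tauberian theorem. *)
lemma rect_kernel_bound:
  fixes x y R :: real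
  assumes R: "R > 0" and w: "w = Complex x y"
    and *: "(\<bar>y\<bar> = R \<and> \<bar>x\<bar> \<le> R) \<or> (\<bar>x\<bar> = R \<and> \<bar>y\<bar> \<le> R)"
  shows "norm ((1 + w^2 / R^2) / w) \<le> 3 * \<bar>x\<bar> / R^2"
proof -
  have nw: "norm w \<ge> R" using * R complex_Re_le_cmod[of w] abs_Re_le_cmod[of w] abs_Im_le_cmod[of w] w by auto
  have "norm (R^2 + w^2) \<le> 3 * R * \<bar>x\<bar>"
    using *
  proof
    assume h: "\<bar>y\<bar> = R \<and> \<bar>x\<bar> \<le> R"
    hence y2: "y^2 = R^2" by auto
    have "R^2 + w^2 = of_real x * (of_real x + 2 * \<i> * of_real y)"
      using y2 by (auto simp: complex_eq_iff w power2_eq_square algebra_simps)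
    hence eq: "norm (R^2 + w^2) = \<bar>x\<bar> * norm (of_real x + 2 * \<i> * of_real y)" by (simp add: norm_mult)
    have "norm (of_real x + 2 * \<i> * of_real y) \<le> \<bar>x\<bar> + 2 * \<bar>y\<bar>"
      by (rule norm_triangle_le) (simp add: norm_mult)
    also have "\<dots> \<le> 3 * R" using h by auto
    finally show ?thesis unfolding eq using mult_left_mono[of _ "3 * R" "\<bar>x\<bar>"] by (metis abs_ge_zero mult.commute)
  next
    assume h: "\<bar>x\<bar> = R \<and> \<bar>y\<bar> \<le> R"
    have "norm (R^2 + w^2) \<le> R^2 + norm w ^ 2"
      by (rule norm_triangle_le) (simp add: norm_power)
    also have "norm w ^ 2 = x^2 + y^2" by (simp add: w cmod_power2)
    also have "x^2 = R^2" using h by auto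
    also have "y^2 \<le> R^2" using h R by (simp add: abs_le_square_iff[symmetric])
    finally show ?thesis using h by (simp add: power2_eq_square)
  qed
  have "norm ((1 + w^2 / R^2) / w) = norm (R^2 + w^2) / (R^2 * norm w)"
  proof -
    have "1 + w^2 / R^2 = (R^2 + w^2) / R^2" using R by (simp add: field_simps)
    thus ?thesis using R by (simp add: norm_divide norm_power norm_mult)
  qed
  also have "\<dots> \<le> (3 * R * \<bar>x\<bar>) / (R^2 * R)"
    using nw R \<open>norm (R^2 + w^2) \<le> 3 * R * \<bar>x\<bar>\<close> by (intro frac_le mult_mono) auto
  finally show ?thesis using R by (simp add: field_simps power2_eq_square)
qed

text \<open>Newman's contour argument: the kernel \<open>exp (L N * w) * (1 + w^2 / R^2)\<close>,
  which is 1 at 0, is inserted into Cauchy's formula for \<open>F\<close> and for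
  \<open>P N\<close>. On the right the difference \<open>F - P N\<close> is estimated; on the left
  \<open>P N\<close> alone along the full half square, and \<open>F\<close> alone along a thin
  rectangle on whose far side the kernel decays with \<open>N\<close>.\<close>

lemma newman_tauberian:
  fixes F :: "complex \<Rightarrow> complex" and P :: "nat \<Rightarrow> complex \<Rightarrow> complex" and L :: "nat \<Rightarrow> real" and C :: real
  assumes U: "open U" "{w. Re w \<ge> 0} \<subseteq> U" and F: "F holomorphic_on U"
    and P: "\<And>N. P N holomorphic_on UNIV"
    and L: "filterlim L at_top sequentially" and C: "C > 0"
    and right: "\<And>N w. Re w > 0 \<Longrightarrow> norm (F w - P N w) \<le> C * exp (- L N * Re w) / Re w"
    and left: "\<And>N w. Re w < 0 \<Longrightarrow> norm (P N w) \<le> C * exp (- L N * Re w) / (- Re w)"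
  shows "(\<lambda>N. P N 0) \<longlonglongrightarrow> F 0"
proof (rule tendstoI)
  fix e :: real assume e: "e > 0"
  \<comment> \<open>Either half of the square has outer sides of total length 4 R with integrand at
    most 3 C / R^2, so both together cost 24 C / R = e.\<close>
  define R where "R = 24 * C / e"
  have R: "R > 0" using C e by (simp add: R_def)
  \<comment> \<open>Compactness of the segment from -(R+1)i to (R+1)i gives a strip of uniform width
    inside \<open>U\<close>.\<close>
  obtain d0 where d0: "d0 > 0" and S: "{w. Re w > -d0 \<and> \<bar>Im w\<bar> < R + 1} \<subseteq> U"
  proof -
    define A where "A = cbox (Complex 0 (-(R+1))) (Complex 0 (R+1))"
    have "A \<subseteq> U" using U(2) by (auto simp: A_def in_cbox_complex_iff)
    then obtain d where d: "d > 0" "(\<Union>x\<in>A. ball x d) \<subseteq> U"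
      using compact_subset_open_imp_ball_epsilon_subset[of A U] U(1) by (auto simp: A_def compact_cbox)
    show thesis
    proof (rule that[OF d(1)], safe)
      fix w assume w: "Re w > -d" "\<bar>Im w\<bar> < R + 1"
      show "w \<in> U"
      proof (cases "Re w \<ge> 0")
        case False
        have "Complex 0 (Im w) \<in> A" using w by (auto simp: A_def in_cbox_complex_iff)
        moreover have "w \<in> ball (Complex 0 (Im w)) d"
        proof -
          have "Complex 0 (Im w) - w = of_real (- Re w)" by (simp add: complex_eq_iff)
          hence "dist (Complex 0 (Im w)) w = \<bar>Re w\<bar>" by (simp add: dist_norm)
          thus ?thesis using w False by simp
        qed
        ultimately show ?thesis using d(2) by blast
      qed (use U(2) in auto)
    qed
  qed
  define S where "S = {w. Re w > -d0 \<and> \<bar>Im w\<bar> < R + 1}"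
  have SU: "S \<subseteq> U" using S by (simp add: S_def)
  have S_eq: "S = {w. Re w > -d0} \<inter> {w. Im w < R + 1} \<inter> {w. Im w > -(R+1)}"
    by (auto simp: S_def abs_less_iff)
  have S_open: "open S" unfolding S_eq by (intro open_Int open_halfspace_Re_gt open_halfspace_Im_lt open_halfspace_Im_gt)
  have S_convex: "convex S" unfolding S_eq
    by (intro convex_Int convex_halfspace_Re_gt convex_halfspace_Im_lt convex_halfspace_Im_gt)
  have FS: "F holomorphic_on S" using F SU holomorphic_on_subset by blast
  define A where "A = cbox (Complex (- d0/2) (-R)) (Complex 0 R)"
  have AS: "A \<subseteq> S" using d0 R by (auto simp: A_def S_def in_cbox_complex_iff)
  have "bounded (F ` A)"
    by (intro compact_imp_bounded compact_continuous_image continuous_on_subset[OF holomorphic_on_imp_continuous_on[OF FS]])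
       (use AS in \<open>auto simp: A_def compact_cbox\<close>)
  then obtain M where M: "M > 0" "\<And>w. w \<in> A \<Longrightarrow> norm (F w) \<le> M"
    unfolding bounded_pos by auto
  \<comment> \<open>\<open>M\<close> bounds \<open>F\<close> on the rectangle of width d0/2, so
    \<open>d\<close> can still be shrunk without changing \<open>M\<close>. The two short horizontal
    sides then cost 6 M d / R <= e.\<close>
  define d where "d = min (min (d0/2) R) (R * e / (6 * M))"
  have d: "d > 0" "d \<le> d0/2" "d \<le> R"
    using d0 R e M by (auto simp: d_def)
  have "d \<le> R * e / (6 * M)" by (simp add: d_def)
  hence d4: "6 * M * d / R \<le> e" using M R by (simp add: field_simps)
  define K where "K = (\<lambda>N (w::complex). exp (L N * w) * (1 + w^2 / R^2))"
  define J where "J = (\<lambda>N (f :: complex \<Rightarrow> complex) a b. contour_integral (linepath a b) (\<lambda>w. f w * K N w / w))"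
  have Kholo: "K N holomorphic_on X" for N X unfolding K_def using R by (intro holomorphic_intros) auto
  have K0: "K N 0 = 1" for N by (simp add: K_def)
  have Kz: "K N (Complex 0 R) = 0" "K N (Complex 0 (-R)) = 0" for N
    using R by (auto simp: K_def complex_eq_iff power2_eq_square)
  have Kb: "norm (K N w / w) \<le> exp (L N * x) * (3 * \<bar>x\<bar> / R^2)"
    if "w = Complex x y" "(\<bar>y\<bar> = R \<and> \<bar>x\<bar> \<le> R) \<or> (\<bar>x\<bar> = R \<and> \<bar>y\<bar> \<le> R)" for N w x y
  proof -
    have "norm (K N w / w) = norm (exp (L N * w)) * norm ((1 + w^2 / R^2) / w)"
      by (simp add: K_def norm_mult norm_divide)
    also have "norm (exp (L N * w)) = exp (L N * x)" using that(1) by simp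
    finally show ?thesis
      using mult_left_mono[OF rect_kernel_bound[OF R that], of "exp (L N * x)"] by simp
  qed
  define p1 where "p1 = Complex 0 (-R)"
  define p2 where "p2 = Complex R (-R)"
  define p3 where "p3 = Complex R R"
  define p4 where "p4 = Complex 0 R"
  define q3 where "q3 = (\<lambda>r. Complex (-r) R)"
  define q4 where "q4 = (\<lambda>r. Complex (-r) (-R))"
  have seg_h: "closed_segment (Complex a y) (Complex b y) = {w. Im w = y \<and> Re w \<in> closed_segment a b}" for a b y
    by (auto simp: closed_segment_same_Im)
  have seg_v: "closed_segment (Complex x a) (Complex x b) = {w. Re w = x \<and> Im w \<in> closed_segment a b}" for a b x
    by (auto simp: closed_segment_same_Re)
  have splitF: "2 * pi * \<i> * F 0 = (J N F p1 p2 + J N F p2 p3 + J N F p3 p4) +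
     (J N F p4 (q3 d) + J N F (q3 d) (q4 d) + J N F (q4 d) p1)" for N
  proof -
    have "(\<lambda>w. F w * K N w) holomorphic_on S" using FS Kholo by (intro holomorphic_intros)
    moreover have "cbox (Complex (-d) (-R)) (Complex R R) \<subseteq> S"
      using d d0 R by (auto simp: S_def in_cbox_complex_iff)
    ultimately show ?thesis
      using contour_integral_rect_split[of "\<lambda>w. F w * K N w" S d R] S_convex S_open d R K0
      by (simp add: J_def p1_def p2_def p3_def p4_def q3_def q4_def)
  qed
  have splitP: "2 * pi * \<i> * P N 0 = (J N (P N) p1 p2 + J N (P N) p2 p3 + J N (P N) p3 p4) +
     (J N (P N) p4 (q3 R) + J N (P N) (q3 R) (q4 R) + J N (P N) (q4 R) p1)" for N
  proof -
    have "(\<lambda>w. P N w * K N w) holomorphic_on UNIV" using P Kholo by (intro holomorphic_intros)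
    thus ?thesis
      using contour_integral_rect_split[of "\<lambda>w. P N w * K N w" UNIV R R] R K0
      by (simp add: J_def p1_def p2_def p3_def p4_def q3_def q4_def)
  qed
  have int: "(\<lambda>w. f w * K N w / w) contour_integrable_on linepath a b"
    if "continuous_on (closed_segment a b) f" "0 \<notin> closed_segment a b" for f N a b
    using that by (intro contour_integrable_continuous_linepath continuous_intros
        holomorphic_on_imp_continuous_on[OF Kholo]) auto
  have contF: "continuous_on X F" if "X \<subseteq> U" for X
    using F that holomorphic_on_imp_continuous_on continuous_on_subset by blast
  have contP: "continuous_on X (P N)" for X N
    using P holomorphic_on_imp_continuous_on continuous_on_subset by blast
  have bR: "norm (J N F a b - J N (P N) a b) \<le> 3 * C / R^2 * norm (b - a)"
    if ab: "closed_segment a b \<subseteq> {w. Re w \<ge> 0} - {0}"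
       "\<And>w. w \<in> closed_segment a b \<Longrightarrow> (\<bar>Im w\<bar> = R \<and> \<bar>Re w\<bar> \<le> R) \<or> (\<bar>Re w\<bar> = R \<and> \<bar>Im w\<bar> \<le> R)" for N a b
  proof -
    have i1: "(\<lambda>w. F w * K N w / w) contour_integrable_on linepath a b"
      using ab(1) U(2) by (intro int contF) auto
    have i2: "(\<lambda>w. P N w * K N w / w) contour_integrable_on linepath a b"
      using ab(1) by (intro int contP) auto
    have "J N F a b - J N (P N) a b = contour_integral (linepath a b) (\<lambda>w. F w * K N w / w - P N w * K N w / w)"
      unfolding J_def using contour_integral_diff[OF i1 i2] by simp
    also have "norm \<dots> \<le> 3 * C / R^2 * norm (b - a)"
    proof (rule contour_integral_bound_linepath)
      fix w assume w: "w \<in> closed_segment a b"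
      have eq: "F w * K N w / w - P N w * K N w / w = (F w - P N w) * (K N w / w)" by (simp add: algebra_simps diff_divide_distrib)
      show "norm (F w * K N w / w - P N w * K N w / w) \<le> 3 * C / R^2"
      proof (cases "Re w = 0")
        case True
        hence "w = Complex 0 R \<or> w = Complex 0 (-R)" using ab(2)[OF w] R by (auto simp: complex_eq_iff)
        hence "K N w = 0" using Kz by auto
        thus ?thesis using C by simp
      next
        case False
        hence pos: "Re w > 0" using ab(1) w by auto
        have "norm (F w * K N w / w - P N w * K N w / w) = norm (F w - P N w) * norm (K N w / w)"
          unfolding eq by (rule norm_mult)
        also have "\<dots> \<le> (C * exp (- L N * Re w) / Re w) * (exp (L N * Re w) * (3 * \<bar>Re w\<bar> / R^2))"
          using right[OF pos, of N] Kb[of w "Re w" "Im w" N] ab(2)[OF w] C pos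
          by (intro mult_mono) (auto simp: complex_eq_iff)
        also have "\<dots> = 3 * C / R^2" using pos by (simp add: exp_minus field_simps)
        finally show ?thesis .
      qed
    qed (use C i1 i2 in \<open>auto intro: contour_integrable_diff\<close>)
    finally show ?thesis .
  qed
  have bL: "norm (J N (P N) a b) \<le> 3 * C / R^2 * norm (b - a)"
    if ab: "closed_segment a b \<subseteq> {w. Re w \<le> 0} - {0}"
       "\<And>w. w \<in> closed_segment a b \<Longrightarrow> (\<bar>Im w\<bar> = R \<and> \<bar>Re w\<bar> \<le> R) \<or> (\<bar>Re w\<bar> = R \<and> \<bar>Im w\<bar> \<le> R)" for N a b
  proof -
    have i2: "(\<lambda>w. P N w * K N w / w) contour_integrable_on linepath a b"
      using ab(1) by (intro int contP) auto
    show ?thesis unfolding J_def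
    proof (rule contour_integral_bound_linepath)
      fix w assume w: "w \<in> closed_segment a b"
      show "norm (P N w * K N w / w) \<le> 3 * C / R^2"
      proof (cases "Re w = 0")
        case True
        hence "w = Complex 0 R \<or> w = Complex 0 (-R)" using ab(2)[OF w] R by (auto simp: complex_eq_iff)
        hence "K N w = 0" using Kz by auto
        thus ?thesis using C by simp
      next
        case False
        hence neg: "Re w < 0" using ab(1) w by auto
        have "norm (P N w * K N w / w) = norm (P N w) * norm (K N w / w)"
          by (simp add: norm_mult norm_divide)
        also have "\<dots> \<le> (C * exp (- L N * Re w) / (-Re w)) * (exp (L N * Re w) * (3 * \<bar>Re w\<bar> / R^2))"
          using left[OF neg, of N] Kb[of w "Re w" "Im w" N] ab(2)[OF w] C neg
          by (intro mult_mono) (auto simp: complex_eq_iff intro!: divide_nonneg_neg)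
        also have "\<dots> = 3 * C / R^2" using neg by (simp add: exp_minus field_simps)
        finally show ?thesis .
      qed
    qed (use C i2 in auto)
  qed
  have bF: "norm (J N F a b) \<le> B * norm (b - a)"
    if ab: "closed_segment a b \<subseteq> A - {0}" "B \<ge> 0"
       "\<And>w. w \<in> closed_segment a b \<Longrightarrow> M * norm (K N w / w) \<le> B" for N a b B
  proof -
    have i1: "(\<lambda>w. F w * K N w / w) contour_integrable_on linepath a b"
      using ab(1) AS SU by (intro int contF) auto
    show ?thesis unfolding J_def
    proof (rule contour_integral_bound_linepath)
      fix w assume w: "w \<in> closed_segment a b"
      have "norm (F w * K N w / w) = norm (F w) * norm (K N w / w)"
        by (simp add: norm_mult norm_divide)
      also have "\<dots> \<le> M * norm (K N w / w)" using M(2)[of w] ab(1) w by (intro mult_right_mono) auto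
      finally show "norm (F w * K N w / w) \<le> B" using ab(3)[OF w] by simp
    qed (use i1 ab in auto)
  qed
  \<comment> \<open>With \<open>R\<close>, \<open>M\<close> and \<open>d\<close> fixed, the only
    bound that still depends on \<open>N\<close> is that for the vertical side at Re w = -d.\<close>
  have evL: "eventually (\<lambda>N. L N > 0 \<and> 6 * M * R / d * exp (- L N * d) < e) sequentially"
  proof -
    have "((\<lambda>N. 6 * M * R / d * exp (- (d * L N))) \<longlongrightarrow> 6 * M * R / d * 0) sequentially"
      by (intro tendsto_intros filterlim_compose[OF exp_at_bot]
          filterlim_compose[OF filterlim_uminus_at_bot_at_top] filterlim_tendsto_pos_mult_at_top[OF tendsto_const d(1) L])
    hence "eventually (\<lambda>N. 6 * M * R / d * exp (- (d * L N)) < e) sequentially"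
      using e by (intro order_tendstoD) auto
    moreover have "eventually (\<lambda>N. L N > 0) sequentially" using L by (auto simp: filterlim_at_top_dense)
    ultimately show ?thesis by eventually_elim (auto simp: mult.commute)
  qed
  show "eventually (\<lambda>N. dist (P N 0) (F 0) < e) sequentially"
    using evL
  proof eventually_elim
    case (elim N)
    let ?c = "3 * C / R^2"
    have r1: "norm (J N F p1 p2 - J N (P N) p1 p2) \<le> ?c * norm (p2 - p1)"
      by (rule bR) (use R in \<open>auto simp: p1_def p2_def seg_h closed_segment_eq_real_ivl complex_eq_iff\<close>)
    have r2: "norm (J N F p2 p3 - J N (P N) p2 p3) \<le> ?c * norm (p3 - p2)"
      by (rule bR) (use R in \<open>auto simp: p2_def p3_def seg_v closed_segment_eq_real_ivl complex_eq_iff\<close>)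
    have r3: "norm (J N F p3 p4 - J N (P N) p3 p4) \<le> ?c * norm (p4 - p3)"
      by (rule bR) (use R in \<open>auto simp: p3_def p4_def seg_h closed_segment_eq_real_ivl complex_eq_iff\<close>)
    have l1: "norm (J N (P N) p4 (q3 R)) \<le> ?c * norm (q3 R - p4)"
      by (rule bL) (use R in \<open>auto simp: p4_def q3_def seg_h closed_segment_eq_real_ivl complex_eq_iff\<close>)
    have l2: "norm (J N (P N) (q3 R) (q4 R)) \<le> ?c * norm (q4 R - q3 R)"
      by (rule bL) (use R in \<open>auto simp: q4_def q3_def seg_v closed_segment_eq_real_ivl complex_eq_iff\<close>)
    have l3: "norm (J N (P N) (q4 R) p1) \<le> ?c * norm (p1 - q4 R)"
      by (rule bL) (use R in \<open>auto simp: p1_def q4_def seg_h closed_segment_eq_real_ivl complex_eq_iff\<close>)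
    have hb: "M * norm (K N w / w) \<le> 3 * M / R" if w: "\<bar>Im w\<bar> = R" "Re w \<le> 0" "Re w \<ge> - d" for w
    proof -
      have "norm (K N w / w) \<le> exp (L N * Re w) * (3 * \<bar>Re w\<bar> / R^2)"
        using Kb[of w "Re w" "Im w" N] w d by auto
      also have "\<dots> \<le> 1 * (3 * R / R^2)" using w d elim R
        by (intro mult_mono divide_right_mono) (auto simp: mult_nonneg_nonpos intro!: divide_nonpos_nonneg)
      finally show ?thesis using M R by (simp add: power2_eq_square field_simps)
    qed
    have f1: "norm (J N F p4 (q3 d)) \<le> 3 * M / R * norm (q3 d - p4)"
      using R d M d0 by (intro bF hb) (auto simp: p4_def q3_def A_def in_cbox_complex_iff seg_h closed_segment_eq_real_ivl complex_eq_iff)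
    have f3: "norm (J N F (q4 d) p1) \<le> 3 * M / R * norm (p1 - q4 d)"
      using R d M d0 by (intro bF hb) (auto simp: p1_def q4_def A_def in_cbox_complex_iff seg_h closed_segment_eq_real_ivl complex_eq_iff)
    have f2: "norm (J N F (q3 d) (q4 d)) \<le> (3 * M / d * exp (- L N * d)) * norm (q4 d - q3 d)"
    proof (rule bF)
      fix w assume "w \<in> closed_segment (q3 d) (q4 d)"
      hence w: "Re w = -d" "\<bar>Im w\<bar> \<le> R"
        using R by (auto simp: q3_def q4_def seg_v closed_segment_eq_real_ivl split: if_splits)
      have nw: "norm w \<ge> d" using abs_Re_le_cmod[of w] w d by auto
      have "norm (1 + w^2 / R^2) \<le> 1 + norm w ^ 2 / R^2"
        by (rule norm_triangle_le) (simp add: norm_power norm_divide)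
      also have "norm w ^ 2 = d^2 + (Im w)^2" using w by (simp add: cmod_power2)
      also have "d^2 + (Im w)^2 \<le> R^2 + R^2" using d w R by (intro add_mono) (auto simp: abs_le_square_iff[symmetric])
      finally have n1: "norm (1 + w^2 / R^2) \<le> 3" using R by (simp add: field_simps divide_right_mono)
      have "norm (K N w / w) = exp (- L N * d) * norm (1 + w^2 / R^2) / norm w"
        by (simp add: K_def norm_mult norm_divide w)
      also have "\<dots> \<le> exp (- L N * d) * 3 / d" using n1 nw d by (intro frac_le mult_left_mono) auto
      finally have "M * norm (K N w / w) \<le> M * (exp (- L N * d) * 3 / d)" using M(1) by (intro mult_left_mono) auto
      thus "M * norm (K N w / w) \<le> 3 * M / d * exp (- L N * d)" by (simp add: mult_ac)
    qed (use R d M d0 in \<open>auto simp: q3_def q4_def A_def in_cbox_complex_iff seg_v closed_segment_eq_real_ivl complex_eq_iff\<close>)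
    have lens: "norm (p2 - p1) = R" "norm (p3 - p2) = 2 * R" "norm (p4 - p3) = R" "norm (q3 R - p4) = R"
       "norm (q4 R - q3 R) = 2 * R" "norm (p1 - q4 R) = R" "norm (q3 d - p4) = d" "norm (p1 - q4 d) = d" "norm (q4 d - q3 d) = 2 * R"
      using R d by (auto simp: p1_def p2_def p3_def p4_def q3_def q4_def cmod_def real_sqrt_mult)
    have "2 * pi * \<i> * (F 0 - P N 0) =
       (J N F p1 p2 - J N (P N) p1 p2) + (J N F p2 p3 - J N (P N) p2 p3) + (J N F p3 p4 - J N (P N) p3 p4)
       + J N F p4 (q3 d) + J N F (q3 d) (q4 d) + J N F (q4 d) p1
       - J N (P N) p4 (q3 R) - J N (P N) (q3 R) (q4 R) - J N (P N) (q4 R) p1"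
      using splitF[of N] splitP[of N] by (simp add: algebra_simps)
    hence "norm (2 * pi * \<i> * (F 0 - P N 0)) = norm (
       (J N F p1 p2 - J N (P N) p1 p2) + (J N F p2 p3 - J N (P N) p2 p3) + (J N F p3 p4 - J N (P N) p3 p4)
       + J N F p4 (q3 d) + J N F (q3 d) (q4 d) + J N F (q4 d) p1
       - J N (P N) p4 (q3 R) - J N (P N) (q3 R) (q4 R) - J N (P N) (q4 R) p1)" by (rule arg_cong)
    also have "\<dots> \<le> norm (J N F p1 p2 - J N (P N) p1 p2) + norm (J N F p2 p3 - J N (P N) p2 p3) + norm (J N F p3 p4 - J N (P N) p3 p4)
       + norm (J N F p4 (q3 d)) + norm (J N F (q3 d) (q4 d)) + norm (J N F (q4 d) p1)
       + norm (J N (P N) p4 (q3 R)) + norm (J N (P N) (q3 R) (q4 R)) + norm (J N (P N) (q4 R) p1)"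
      by (intro norm_triangle_le norm_triangle_le_diff add_mono order_refl)
    also have "\<dots> \<le> ?c * R + ?c * (2 * R) + ?c * R + 3 * M / R * d + (3 * M / d * exp (- L N * d)) * (2 * R) + 3 * M / R * d
         + ?c * R + ?c * (2 * R) + ?c * R"
      using r1 r2 r3 l1 l2 l3 f1 f2 f3 unfolding lens by (intro add_mono) auto
    also have "\<dots> = 24 * C / R + 6 * M * d / R + 6 * M * R / d * exp (- L N * d)"
      using R d by (simp add: field_simps power2_eq_square)
    also have "\<dots> < e + e + e" using d4 elim C e by (intro add_le_less_mono add_mono) (auto simp: R_def)
    also have "norm (2 * pi * \<i> * (F 0 - P N 0)) = 2 * pi * norm (F 0 - P N 0)" by (simp add: norm_mult)
    finally have "2 * pi * norm (F 0 - P N 0) < 3 * e" by simp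
    \<comment> \<open>Three errors of size \<open>e\<close> are affordable because 2 pi > 3.\<close>
    moreover have "2 * pi * norm (F 0 - P N 0) \<ge> 3 * norm (F 0 - P N 0)"
      using pi_gt3 by (intro mult_right_mono) auto
    ultimately show ?case by (simp add: dist_norm norm_minus_commute)
  qed
qed

section \<open>The zeta function on the line Re s = 1\<close>

(* The n-th term of (s - 1) * zeta s after adding a telescoping series that makes it converge for Re s > 0.
   Since 0 powr _ = 0, the term for n = 0 is 1, the value at the pole. *)
definition zeta_term :: "nat \<Rightarrow> complex \<Rightarrow> complex" where
  "zeta_term n s = (s - 1) * of_nat n powr (-s) + of_nat (n+1) powr (1-s) - of_nat n powr (1-s)"

definition zeta1 :: "complex \<Rightarrow> complex" where
  "zeta1 s = (\<Sum>n. zeta_term n s)"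

lemma norm_nat_powr: "norm (of_nat n powr s :: complex) = real n powr Re s"
  by (simp add: norm_powr_real_powr)

lemma closed_segment_nat_Suc: "closed_segment (of_nat n :: complex) (of_nat (n+1)) = of_real ` {real n..real n + 1}"
  using closed_segment_of_real[of "real n" "real n + 1", where ?'a = complex] by (simp add: closed_segment_eq_real_ivl add.commute)

lemma norm_powr_diff_nat_le:
  assumes n: "n > 0" and s: "Re s \<ge> 0" and z: "z \<in> closed_segment (of_nat n) (of_nat (n+1))"
  shows "norm (z powr (-s) - of_nat n powr (-s)) \<le> norm s * real n powr (- Re s - 1)"
proof -
  let ?S = "closed_segment (of_nat n :: complex) (of_nat (n+1))"
  have S: "\<exists>x. w = of_real x \<and> x \<ge> real n \<and> x \<le> real n + 1" if "w \<in> ?S" for w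
    using that unfolding closed_segment_nat_Suc by auto
  have "norm (z powr (-s) - of_nat n powr (-s)) \<le> (norm s * real n powr (- Re s - 1)) * norm (z - of_nat n)"
  proof (rule field_differentiable_bound[where S = ?S and f' = "\<lambda>z. -s * z powr (-s-1)"])
    fix w assume "w \<in> ?S"
    then obtain x where x: "w = of_real x" "x \<ge> real n" using S by blast
    have "w \<notin> \<real>\<^sub>\<le>\<^sub>0" using x n by (auto simp: complex_nonpos_Reals_iff)
    thus "((\<lambda>z. z powr (-s)) has_field_derivative - s * w powr (- s - 1)) (at w within ?S)"
      by (rule has_field_derivative_at_within[OF has_field_derivative_powr])
    have "norm (w powr (-s-1)) = x powr (- Re s - 1)" using x n by (simp add: norm_powr_real_powr)
    also have "\<dots> \<le> real n powr (- Re s - 1)" using x n s by (intro powr_mono2') auto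
    finally show "norm (- s * w powr (- s - 1)) \<le> norm s * real n powr (- Re s - 1)"
      by (simp add: norm_mult mult_left_mono)
  qed (use z in auto)
  also have "norm (z - of_nat n) \<le> 1"
  proof -
    obtain x where x: "z = of_real x" "x \<ge> real n" "x \<le> real n + 1" using S z by blast
    have "z - of_nat n = of_real (x - real n)" using x by simp
    thus ?thesis using x by (simp only: norm_of_real)
  qed
  finally show ?thesis by (simp add: mult_left_mono)
qed

text \<open>Up to sign conventions the term is the remainder of the linear approximation of
  \<open>z powr (1-s)\<close> at n, evaluated at n + 1. The mean value inequality, applied to
  \<open>g\<close> and inside its derivative, gains one power of n, which makes the terms summable
  for Re s > 0.\<close>

lemma norm_zeta_term_le:
  assumes n: "n > 0" and s: "Re s \<ge> 0"
  shows "norm (zeta_term n s) \<le> norm (s - 1) * norm s * real n powr (- Re s - 1)"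
proof -
  let ?S = "closed_segment (of_nat n :: complex) (of_nat (n+1))"
  define g where "g = (\<lambda>z. z powr (1-s) - (1-s) * of_nat n powr (-s) * z)"
  have S: "\<exists>x. w = of_real x \<and> x \<ge> real n" if "w \<in> ?S" for w
    using that unfolding closed_segment_nat_Suc by auto
  have "zeta_term n s = g (of_nat (n+1)) - g (of_nat n)"
    by (simp add: g_def zeta_term_def algebra_simps)
  also have "norm \<dots> \<le> (norm (s-1) * norm s * real n powr (- Re s - 1)) * norm (of_nat (n+1) - of_nat n :: complex)"
  proof (rule field_differentiable_bound[where S = ?S and f' = "\<lambda>z. (1-s) * (z powr (-s) - of_nat n powr (-s))"])
    fix w assume w: "w \<in> ?S"
    then obtain x where x: "w = of_real x" "x \<ge> real n" using S by blast
    have "w \<notin> \<real>\<^sub>\<le>\<^sub>0" using x n by (auto simp: complex_nonpos_Reals_iff)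
    hence "(g has_field_derivative ((1 - s) * w powr (1 - s - 1) - (1-s) * of_nat n powr (-s))) (at w)"
      unfolding g_def by (auto intro!: derivative_eq_intros has_field_derivative_powr)
    from has_field_derivative_at_within[OF this, of ?S]
    show "(g has_field_derivative (1-s) * (w powr (-s) - of_nat n powr (-s))) (at w within ?S)"
      by (simp add: right_diff_distrib)
    show "norm ((1 - s) * (w powr - s - of_nat n powr - s)) \<le> norm (s-1) * norm s * real n powr (- Re s - 1)"
      using norm_powr_diff_nat_le[OF n s w] by (simp add: norm_mult norm_minus_commute mult.assoc mult_left_mono)
  qed auto
  also have "norm (of_nat (n+1) - of_nat n :: complex) = 1" by simp
  finally show ?thesis by simp
qed

lemma summable_nat_powr: "a < -1 \<Longrightarrow> summable (\<lambda>n. real n powr a)"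
  by (simp add: summable_real_powr_iff)

lemma nat_powr_has_field_derivative:
  "((\<lambda>s. of_nat n powr s) has_field_derivative (of_real (ln (real n)) * of_nat n powr s)) (at s :: complex filter)"
proof (cases "n = 0")
  case False
  have "Ln (of_nat n) = complex_of_real (ln (real n))"
    using False Ln_of_real[of "real n"] by simp
  thus ?thesis using has_field_derivative_powr_right[of "of_nat n" s] False by simp
qed auto

lemma nat_powr_uminus_has_field_derivative:
  "((\<lambda>s. of_nat n powr (-s)) has_field_derivative (- of_real (ln (real n)) * of_nat n powr (-s))) (at s :: complex filter)"
  using DERIV_chain2[OF nat_powr_has_field_derivative DERIV_minus[OF DERIV_ident]] by (simp add: mult.commute)

lemma zeta_term_holomorphic: "zeta_term n holomorphic_on S"
proof -
  have "zeta_term n field_differentiable (at s)" for s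
  proof -
    have 1: "((\<lambda>s. of_nat m powr (1-s)) has_field_derivative (of_real (ln (real m)) * of_nat m powr (1-s) * (0 - 1))) (at s :: complex filter)" for m
      by (rule DERIV_chain2[OF nat_powr_has_field_derivative]) (auto intro!: derivative_eq_intros)
    show ?thesis unfolding zeta_term_def
      using 1 nat_powr_uminus_has_field_derivative
      by (intro derivative_intros) (auto simp: field_differentiable_def simp del: of_nat_Suc of_nat_add)
  qed
  thus ?thesis by (auto simp: holomorphic_on_def intro: field_differentiable_at_within)
qed

lemma
  assumes "Re s > 0" shows zeta_term_sums: "(\<lambda>n. zeta_term n s) sums zeta1 s"
   and zeta1_differentiable: "zeta1 field_differentiable (at s)"
proof -
  have "\<exists>g g'. \<forall>x\<in>{s. Re s > 0}. ((\<lambda>n. zeta_term n x) sums g x) \<and> ((\<lambda>n. deriv (zeta_term n) x) sums g' x) \<and> (g has_field_derivative g' x) (at x)"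
  proof (rule series_and_derivative_comparison_complex)
    show "open {s. Re s > 0}" by (rule open_halfspace_Re_gt)
    show "(zeta_term n has_field_derivative deriv (zeta_term n) x) (at x)" for n x
      using zeta_term_holomorphic[of n UNIV] by (simp add: holomorphic_derivI)
    fix x :: complex assume "x \<in> {s. Re s > 0}"
    hence x: "Re x > 0" by simp
    define d where "d = Re x / 2"
    have d: "d > 0" using x by (simp add: d_def)
    define K where "K = (norm x + d + 1) * (norm x + d)"
    have K: "K \<ge> 0" using d by (simp add: K_def)
    let ?h = "\<lambda>n. of_real (K * real n powr (- d - 1)) :: complex"
    have "eventually (\<lambda>n. \<forall>y\<in>ball x d \<inter> {s. Re s > 0}. norm (zeta_term n y) \<le> norm (?h n)) sequentially"
      using eventually_gt_at_top[of 0]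
    proof eventually_elim
      case (elim n)
      show ?case
      proof safe
        fix y assume y: "y \<in> ball x d" "Re y > 0"
        have "norm (x - y) < d" using y by (simp add: dist_norm)
        hence ny: "norm y \<le> norm x + d" using norm_triangle_ineq3[of x y] by linarith
        have n1: "norm (y - 1) \<le> norm x + d + 1" using norm_triangle_ineq4[of y 1] ny by simp
        have "Re x - Re y < d" using \<open>norm (x - y) < d\<close> abs_Re_le_cmod[of "x - y"] by simp
        hence ry: "Re y > d" by (simp add: d_def)
        have "norm (zeta_term n y) \<le> norm (y - 1) * norm y * real n powr (- Re y - 1)"
          using norm_zeta_term_le[of n y] elim y by simp
        also have "\<dots> \<le> (norm x + d + 1) * (norm x + d) * real n powr (- d - 1)"
          using n1 ny ry elim d by (intro mult_mono powr_mono) auto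
        also have "\<dots> = norm (?h n)" unfolding norm_of_real abs_mult using K by (simp add: K_def)
        finally show "norm (zeta_term n y) \<le> norm (?h n)" .
      qed
    qed
    moreover have "summable ?h" using d by (intro summable_of_real summable_mult summable_nat_powr) simp
    moreover have "range ?h \<subseteq> \<real>\<^sub>\<ge>\<^sub>0" using K by auto
    ultimately show "\<exists>d (h :: nat \<Rightarrow> complex). 0 < d \<and> summable h \<and> range h \<subseteq> \<real>\<^sub>\<ge>\<^sub>0 \<and>
       (\<forall>\<^sub>F n in sequentially. \<forall>y\<in>ball x d \<inter> {s. 0 < Re s}. norm (zeta_term n y) \<le> norm (h n))"
      using d by - (rule exI[of _ d], rule exI[of _ ?h], intro conjI; assumption)
  qed
  then obtain g g' where g: "\<And>x. Re x > 0 \<Longrightarrow> (\<lambda>n. zeta_term n x) sums g x"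
    "\<And>x. Re x > 0 \<Longrightarrow> (g has_field_derivative g' x) (at x)" by blast
  have eq: "g x = zeta1 x" if "Re x > 0" for x using g(1)[OF that] by (simp add: zeta1_def sums_iff)
  show "(\<lambda>n. zeta_term n s) sums zeta1 s" using g(1) eq assms by simp
  have "(zeta1 has_field_derivative g' s) (at s)"
    by (rule has_field_derivative_transform_within_open[OF g(2)[OF assms] open_halfspace_Re_gt[of 0]]) (use assms eq in auto)
  thus "zeta1 field_differentiable (at s)" by (auto simp: field_differentiable_def)
qed

lemma zeta1_holomorphic: "zeta1 holomorphic_on {s. Re s > 0}"
  using zeta1_differentiable by (auto simp: holomorphic_on_def intro: field_differentiable_at_within)

lemma zeta1_1: "zeta1 1 = 1"
proof -
  have *: "of_nat n powr (0::complex) = (if n = 0 then 0 else 1)" for n by simp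
  have "zeta_term n 1 = (if n = 0 then 1 else 0)" for n
    by (simp add: zeta_term_def * del: of_nat_Suc of_nat_add)
  moreover have "(\<lambda>n. if n = 0 then 1 else 0 :: complex) sums 1" using sums_single[of 0 "\<lambda>_. 1 :: complex"] by simp
  ultimately show ?thesis by (simp add: zeta1_def sums_iff)
qed

lemma norm_summable_nat_powr: "Re s > 1 \<Longrightarrow> summable (\<lambda>n. norm (of_nat n powr (-s) :: complex))"
  by (simp add: norm_nat_powr summable_nat_powr)

section \<open>The Dirichlet series of zeta and of the von Mangoldt function\<close>

definition zeta_series :: "complex \<Rightarrow> complex" where "zeta_series s = (\<Sum>n. of_nat n powr (-s))"

lemma zeta_series_sums: "Re s > 1 \<Longrightarrow> (\<lambda>n. of_nat n powr (-s)) sums zeta_series s"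
  unfolding zeta_series_def by (rule summable_sums[OF summable_norm_cancel[OF norm_summable_nat_powr]])

text \<open>The added telescoping series has sum 0 here: \<open>of_nat n powr (1-s)\<close> tends to
  0 and is also 0 at n = 0.\<close>

lemma zeta1_eq_zeta_series:
  assumes s: "Re s > 1" shows "zeta1 s = (s - 1) * zeta_series s"
proof -
  have "(\<lambda>n. of_nat n powr (1-s) :: complex) \<longlonglongrightarrow> 0"
  proof (rule tendsto_norm_zero_cancel)
    have "(\<lambda>n. real n powr (1 - Re s)) \<longlonglongrightarrow> 0" using s by (intro tendsto_neg_powr filterlim_real_sequentially) simp
    thus "(\<lambda>n. norm (of_nat n powr (1-s) :: complex)) \<longlonglongrightarrow> 0" by (simp add: norm_nat_powr)
  qed
  hence "(\<lambda>n. of_nat (Suc n) powr (1-s) - of_nat n powr (1-s) :: complex) sums (0 - of_nat 0 powr (1-s))"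
    by (rule telescope_sums)
  hence "(\<lambda>n. (s-1) * of_nat n powr (-s) + (of_nat (Suc n) powr (1-s) - of_nat n powr (1-s))) sums ((s-1) * zeta_series s + 0)"
    using s by (intro sums_add sums_mult zeta_series_sums) auto
  hence "(\<lambda>n. zeta_term n s) sums ((s-1) * zeta_series s)" by (simp add: zeta_term_def algebra_simps)
  thus ?thesis using zeta_term_sums[of s] s sums_unique2 by fastforce
qed

lemma summable_ln_powr:
  assumes "(a::real) > 1" shows "summable (\<lambda>n. ln (real n) * real n powr (-a))"
proof (rule summable_comparison_test[OF exI[of _ 1]], intro allI impI)
  have "- (1 + a) / 2 < -1" using assms by simp
  thus "summable (\<lambda>n. 2 / (a - 1) * real n powr (-(1+a)/2))" by (intro summable_mult summable_nat_powr)
  fix n :: nat assume n: "n \<ge> 1"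
  have "ln (real n) \<le> real n powr ((a - 1) / 2) / ((a - 1) / 2)" using n assms by (intro ln_powr_bound) auto
  hence "ln (real n) * real n powr (-a) \<le> real n powr ((a - 1) / 2) / ((a - 1) / 2) * real n powr (-a)"
    by (intro mult_right_mono) auto
  also have "\<dots> = 2 / (a - 1) * (real n powr ((a - 1) / 2) * real n powr (-a))" by simp
  also have "real n powr ((a - 1) / 2) * real n powr (-a) = real n powr (-(1+a)/2)"
    by (simp add: powr_add[symmetric] field_simps)
  finally show "norm (ln (real n) * real n powr (-a)) \<le> 2 / (a - 1) * real n powr (-(1+a)/2)"
    using n by (simp add: abs_mult)
qed

lemma zeta_series_deriv:
  assumes "Re s > 1"
  shows "(\<lambda>n. - of_real (ln (real n)) * of_nat n powr (-s)) sums deriv zeta_series s"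
   and "zeta_series field_differentiable (at s)"
proof -
  define f where "f = (\<lambda>n x. of_nat n powr (-x) :: complex)"
  define f' where "f' = (\<lambda>n x. - of_real (ln (real n)) * of_nat n powr (-x) :: complex)"
  have "\<exists>g g'. \<forall>x\<in>{s. Re s > 1}. ((\<lambda>n. f n x) sums g x) \<and> ((\<lambda>n. f' n x) sums g' x) \<and> (g has_field_derivative g' x) (at x)"
  proof (rule series_and_derivative_comparison_complex)
    show "open {s. Re s > 1}" by (rule open_halfspace_Re_gt)
    show "(f n has_field_derivative f' n x) (at x)" for n x
      unfolding f_def f'_def by (rule nat_powr_uminus_has_field_derivative)
    fix x :: complex assume "x \<in> {s. Re s > 1}"
    hence x: "Re x > 1" by simp
    define d where "d = (Re x - 1) / 2"
    have d: "d > 0" using x by (simp add: d_def)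
    let ?h = "\<lambda>n. of_real (real n powr (- d - 1)) :: complex"
    have "eventually (\<lambda>n. \<forall>y\<in>ball x d \<inter> {s. Re s > 1}. norm (f n y) \<le> norm (?h n)) sequentially"
      using eventually_gt_at_top[of 0]
    proof eventually_elim
      case (elim n)
      show ?case
      proof safe
        fix y assume y: "y \<in> ball x d" "Re y > 1"
        have "norm (x - y) < d" using y by (simp add: dist_norm)
        hence "Re x - Re y < d" using abs_Re_le_cmod[of "x - y"] by simp
        hence "Re y > 1 + d" by (simp add: d_def field_simps)
        thus "norm (f n y) \<le> norm (?h n)" using elim by (simp add: f_def norm_nat_powr powr_mono)
      qed
    qed
    moreover have "summable ?h" using d by (intro summable_of_real summable_nat_powr) simp
    moreover have "range ?h \<subseteq> \<real>\<^sub>\<ge>\<^sub>0" by auto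
    ultimately show "\<exists>d (h :: nat \<Rightarrow> complex). 0 < d \<and> summable h \<and> range h \<subseteq> \<real>\<^sub>\<ge>\<^sub>0 \<and>
       (\<forall>\<^sub>F n in sequentially. \<forall>y\<in>ball x d \<inter> {s. 1 < Re s}. norm (f n y) \<le> norm (h n))"
      using d by - (rule exI[of _ d], rule exI[of _ ?h], intro conjI; assumption)
  qed
  then obtain g g' where g: "\<And>x. Re x > 1 \<Longrightarrow> (\<lambda>n. f n x) sums g x" "\<And>x. Re x > 1 \<Longrightarrow> (\<lambda>n. f' n x) sums g' x"
    "\<And>x. Re x > 1 \<Longrightarrow> (g has_field_derivative g' x) (at x)" by blast
  have eq: "g x = zeta_series x" if "Re x > 1" for x using g(1)[OF that] by (simp add: f_def zeta_series_def sums_iff)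
  have D: "(zeta_series has_field_derivative g' s) (at s)"
    by (rule has_field_derivative_transform_within_open[OF g(3)[OF assms] open_halfspace_Re_gt[of 1]]) (use assms eq in auto)
  thus "zeta_series field_differentiable (at s)" by (auto simp: field_differentiable_def)
  have "f' n s = - of_real (ln (real n)) * of_nat n powr (-s)" for n unfolding f'_def ..
  thus "(\<lambda>n. - of_real (ln (real n)) * of_nat n powr (-s)) sums deriv zeta_series s"
    using g(2)[OF assms] unfolding DERIV_imp_deriv[OF D] by presburger
qed

definition mangoldt_series :: "complex \<Rightarrow> complex" where
  "mangoldt_series s = (\<Sum>n. mangoldt n * of_nat n powr (-s))"

lemma norm_summable_mangoldt:
  assumes "Re s > 1" shows "summable (\<lambda>n. norm (mangoldt n * of_nat n powr (-s) :: complex))"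
proof (rule summable_comparison_test[OF _ summable_ln_powr[OF assms]], intro exI[of _ 1] allI impI)
  fix n :: nat assume "n \<ge> 1"
  thus "norm (norm (mangoldt n * of_nat n powr (-s) :: complex)) \<le> ln (real n) * real n powr (- Re s)"
    using mangoldt_le[of n] by (auto simp: norm_mult norm_nat_powr abs_mult intro!: mult_right_mono)
qed

lemma mangoldt_series_sums: "Re s > 1 \<Longrightarrow> (\<lambda>n. mangoldt n * of_nat n powr (-s)) sums mangoldt_series s"
  unfolding mangoldt_series_def by (rule summable_sums[OF summable_norm_cancel[OF norm_summable_mangoldt]])

text \<open>The divisor identity ln n = sum of \<open>mangoldt d\<close> over d dvd n, read as a
  product of Dirichlet series: the double series over (m, d) converges absolutely and is regrouped
  by n = m * d.\<close>

lemma zeta_mangoldt_product: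
  assumes s: "Re s > 1"
  shows "zeta_series s * mangoldt_series s = - deriv zeta_series s"
proof -
  define a where "a = (\<lambda>n. of_nat n powr (-s) :: complex)"
  define b where "b = (\<lambda>n. mangoldt n * of_nat n powr (-s) :: complex)"
  have a: "(a has_sum zeta_series s) UNIV"
    unfolding a_def using norm_summable_nat_powr[OF s] zeta_series_sums[OF s] by (rule norm_summable_imp_has_sum)
  have b: "(b has_sum mangoldt_series s) UNIV"
    unfolding b_def using norm_summable_mangoldt[OF s] mangoldt_series_sums[OF s] by (rule norm_summable_imp_has_sum)
  have na: "(\<lambda>n. norm (a n)) summable_on UNIV" and nb: "(\<lambda>n. norm (b n)) summable_on UNIV"
    using a b summable_on_iff_abs_summable_on_complex has_sum_imp_summable by blast+
  have "(\<lambda>(m,d). norm (a m) * norm (b d)) summable_on UNIV \<times> UNIV"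
  proof (rule summable_on_SigmaI)
    show "((\<lambda>d. case (m, d) of (m, d) \<Rightarrow> norm (a m) * norm (b d)) has_sum (norm (a m) * infsum (\<lambda>d. norm (b d)) UNIV)) UNIV" for m
      using has_sum_cmult_right[OF has_sum_infsum[OF nb]] by simp
    show "(\<lambda>m. norm (a m) * infsum (\<lambda>d. norm (b d)) UNIV) summable_on UNIV"
      using summable_on_cmult_left[OF na] by simp
  qed auto
  hence "(\<lambda>p. norm ((\<lambda>(m,d). a m * b d) p)) summable_on UNIV \<times> UNIV"
    by (simp add: case_prod_unfold norm_mult)
  hence "(\<lambda>(m,d). a m * b d) summable_on UNIV \<times> UNIV"
    using abs_summable_summable by blast
  hence sum1: "((\<lambda>(m,d). a m * b d) has_sum (zeta_series s * mangoldt_series s)) (UNIV \<times> UNIV)"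
    by (intro has_sum_SigmaI[where g = "\<lambda>m. a m * mangoldt_series s"])
       (auto intro!: has_sum_cmult_right has_sum_cmult_left a b)
  \<comment> \<open>Both factors vanish at index 0. Dropping it makes (m, d) to (m * d, d) a
    bijection onto the pairs with d dvd n.\<close>
  have "((\<lambda>(m,d). a m * b d) has_sum (zeta_series s * mangoldt_series s)) ({0<..} \<times> {0<..})"
    using sum1 by (rule has_sum_cong_neutral[THEN iffD1, rotated -1]) (auto simp: a_def b_def)
  moreover have "((\<lambda>(m,d). a m * b d) has_sum (zeta_series s * mangoldt_series s)) ({0<..} \<times> {0<..}) =
    ((\<lambda>(n,d). mangoldt d * of_nat n powr (-s)) has_sum (zeta_series s * mangoldt_series s)) (Sigma {0<..} (\<lambda>n. {d. d dvd n}))"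
  proof (rule has_sum_reindex_bij_witness[where j = "\<lambda>(m,d). (m*d, d)" and i = "\<lambda>(n,d). (n div d, d)"])
    show "(case case p of (m, d) \<Rightarrow> (m * d, d) of (n, d) \<Rightarrow> mangoldt d * of_nat n powr - s) = (case p of (m, d) \<Rightarrow> a m * b d)"
      if "p \<in> {0<..} \<times> {0<..}" for p :: "nat \<times> nat"
      using that powr_times_real[of "of_nat (fst p)" "of_nat (snd p)" "-s"] by (auto simp: a_def b_def)
  qed (auto elim!: dvdE simp: dvd_pos_nat)
  ultimately have "((\<lambda>(n,d). mangoldt d * of_nat n powr (-s)) has_sum (zeta_series s * mangoldt_series s)) (Sigma {0<..} (\<lambda>n. {d. d dvd n}))" by simp
  hence "((\<lambda>n. of_real (ln (real n)) * of_nat n powr (-s)) has_sum (zeta_series s * mangoldt_series s)) {0<..}"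
  proof (rule has_sum_SigmaD)
    fix n :: nat assume n: "n \<in> {0<..}"
    have "(\<Sum>d | d dvd n. mangoldt d * of_nat n powr (-s)) = (\<Sum>d | d dvd n. mangoldt d) * (of_nat n powr (-s) :: complex)"
      by (simp add: sum_distrib_right)
    also have "(\<Sum>d | d dvd n. mangoldt d :: complex) = of_real (ln (real n))"
      using n by (intro mangoldt_sum) auto
    finally show "((\<lambda>d. case (n, d) of (n, d) \<Rightarrow> mangoldt d * of_nat n powr (-s)) has_sum of_real (ln (real n)) * of_nat n powr (-s)) {d. d dvd n}"
      using n by (intro has_sum_finiteI) auto
  qed
  hence "((\<lambda>n. of_real (ln (real n)) * of_nat n powr (-s)) has_sum (zeta_series s * mangoldt_series s)) UNIV"
    by (rule has_sum_cong_neutral[THEN iffD1, rotated -1]) auto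
  hence "(\<lambda>n. of_real (ln (real n)) * of_nat n powr (-s)) sums (zeta_series s * mangoldt_series s)"
    by (rule has_sum_imp_sums)
  from sums_minus[OF this] show ?thesis using zeta_series_deriv(1)[OF s] sums_unique2 by fastforce
qed

text \<open>The logarithmic derivative of zeta1 s = (s - 1) * zeta s. The pole at 1 is split off
  explicitly, so the rest is holomorphic wherever \<open>zeta1\<close> has no zero.\<close>

lemma mangoldt_series_eq:
  assumes s: "Re s > 1" "zeta1 s \<noteq> 0"
  shows "mangoldt_series s = 1 / (s - 1) - deriv zeta1 s / zeta1 s"
proof -
  have s1: "s \<noteq> 1" using s by auto
  have "deriv zeta1 s = deriv (\<lambda>s. (s - 1) * zeta_series s) s"
  proof (rule deriv_cong_ev)
    have "eventually (\<lambda>s. s \<in> {s. Re s > 1}) (nhds s)"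
      using s by (intro eventually_nhds_in_open open_halfspace_Re_gt) auto
    thus "\<forall>\<^sub>F x in nhds s. zeta1 x = (x - 1) * zeta_series x"
      by eventually_elim (use zeta1_eq_zeta_series in auto)
  qed auto
  also have "\<dots> = zeta_series s + (s - 1) * deriv zeta_series s"
    using zeta_series_deriv(2)[OF s(1)]
    by (intro DERIV_imp_deriv) (auto intro!: derivative_eq_intros simp: field_differentiable_derivI)
  also have "deriv zeta_series s = - (zeta_series s * mangoldt_series s)"
    using zeta_mangoldt_product[OF s(1)] by simp
  finally have "deriv zeta1 s = zeta_series s * (1 - (s - 1) * mangoldt_series s)" by (simp add: algebra_simps)
  moreover have "zeta1 s = (s - 1) * zeta_series s" by (rule zeta1_eq_zeta_series[OF s(1)])
  ultimately have "deriv zeta1 s / zeta1 s = (1 - (s - 1) * mangoldt_series s) / (s - 1)" using s(2) by auto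
  also have "\<dots> = 1 / (s - 1) - mangoldt_series s" using s1 by (simp add: diff_divide_distrib)
  finally show ?thesis by simp
qed

text \<open>From f = g * (w - z0)^n follows f'/f = g'/g + n / (w - z0), whose first summand stays
  bounded near z0. The approach is horizontal from the right, because there the Dirichlet series are
  available when Re z0 = 1.\<close>

lemma log_deriv_tendsto_order:
  assumes f: "f holomorphic_on S" and S: "open S" "connected S" "z0 \<in> S" and nz: "\<exists>w\<in>S. f w \<noteq> 0"
  obtains n :: nat where "f z0 = 0 \<longleftrightarrow> n > 0"
    "((\<lambda>x::real. of_real x * (deriv f (z0 + of_real x) / f (z0 + of_real x))) \<longlongrightarrow> of_nat n) (at_right 0)"
    "eventually (\<lambda>x. f (z0 + of_real x) \<noteq> 0) (at_right (0::real))"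
proof -
  define n where "n = nat (zorder f z0)"
  define g where "g = zor_poly f z0"
  from zorder_exist_zero[OF f S nz] obtain r where r: "r > 0" "cball z0 r \<subseteq> S" "g holomorphic_on cball z0 r"
     and fg: "\<And>w. w \<in> cball z0 r \<Longrightarrow> f w = g w * (w - z0) ^ n" "\<And>w. w \<in> cball z0 r \<Longrightarrow> g w \<noteq> 0"
     and iff: "if f z0 = 0 then zorder f z0 > 0 else zorder f z0 = 0"
    unfolding n_def g_def by blast
  have gb: "g holomorphic_on ball z0 r" using r(3) by (rule holomorphic_on_subset) auto
  have eq: "x * (deriv f (z0 + of_real x) / f (z0 + of_real x)) =
      of_real x * (deriv g (z0 + of_real x) / g (z0 + of_real x)) + of_nat n" "f (z0 + of_real x) \<noteq> 0"
    if x: "x > 0" "x < r" for x :: real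
  proof -
    let ?w = "z0 + of_real x"
    have w: "?w \<in> ball z0 r" using x by (simp add: dist_norm)
    have "deriv f ?w = deriv (\<lambda>w. g w * (w - z0) ^ n) ?w"
    proof (rule deriv_cong_ev)
      have "eventually (\<lambda>w. w \<in> ball z0 r) (nhds ?w)" using w by (intro eventually_nhds_in_open) auto
      thus "\<forall>\<^sub>F w in nhds ?w. f w = g w * (w - z0) ^ n" by eventually_elim (use fg in auto)
    qed auto
    also have "\<dots> = deriv g ?w * of_real x ^ n + g ?w * (of_nat n * of_real x ^ (n - 1))"
      using holomorphic_derivI[OF gb _ w] by (intro DERIV_imp_deriv) (auto intro!: derivative_eq_intros)
    finally have d: "deriv f ?w = deriv g ?w * of_real x ^ n + g ?w * (of_nat n * of_real x ^ (n - 1))" .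
    have fw: "f ?w = g ?w * of_real x ^ n" using fg(1)[of ?w] w by simp
    have gw: "g ?w \<noteq> 0" using fg(2)[of ?w] w by simp
    show "f ?w \<noteq> 0" using fw gw x by simp
    have xn: "of_nat n * of_real x ^ (n - 1) * of_real x = (of_nat n * of_real x ^ n :: complex)"
      by (cases n) auto
    have "x * (deriv f ?w / f ?w) = (of_real x * deriv g ?w * of_real x ^ n + g ?w * (of_nat n * of_real x ^ (n - 1) * of_real x)) / (g ?w * of_real x ^ n)"
      unfolding d fw by (simp add: algebra_simps)
    also have "\<dots> = of_real x * (deriv g ?w / g ?w) + of_nat n"
      unfolding xn using gw x by (simp add: field_simps)
    finally show "x * (deriv f ?w / f ?w) = of_real x * (deriv g ?w / g ?w) + of_nat n" .
  qed
  have ev: "eventually (\<lambda>x::real. x > 0 \<and> x < r) (at_right 0)"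
    using eventually_at_right_real[OF r(1)] by eventually_elim auto
  have "isCont (\<lambda>w. deriv g w / g w) z0"
  proof -
    have "deriv g holomorphic_on ball z0 r" using gb by (intro holomorphic_deriv) auto
    hence "(\<lambda>w. deriv g w / g w) holomorphic_on ball z0 r" using gb fg(2) by (intro holomorphic_intros) auto
    thus ?thesis using holomorphic_on_imp_continuous_on r(1) by (fastforce simp: continuous_on_eq_continuous_at)
  qed
  moreover have "((\<lambda>x::real. z0 + of_real x) \<longlongrightarrow> z0) (at_right 0)"
    by (auto intro!: tendsto_eq_intros)
  ultimately have "((\<lambda>x::real. deriv g (z0 + of_real x) / g (z0 + of_real x)) \<longlongrightarrow> deriv g z0 / g z0) (at_right 0)"
    by (rule isCont_tendsto_compose)
  hence "((\<lambda>x::real. of_real x * (deriv g (z0 + of_real x) / g (z0 + of_real x)) + of_nat n) \<longlongrightarrow> of_real 0 * (deriv g z0 / g z0) + of_nat n) (at_right 0)"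
    by (intro tendsto_add[OF tendsto_mult[OF tendsto_of_real[OF tendsto_ident_at]]] tendsto_const)
  hence "((\<lambda>x::real. of_real x * (deriv g (z0 + of_real x) / g (z0 + of_real x)) + of_nat n) \<longlongrightarrow> of_nat n) (at_right 0)"
    by simp
  hence "((\<lambda>x::real. of_real x * (deriv f (z0 + of_real x) / f (z0 + of_real x))) \<longlongrightarrow> of_nat n) (at_right 0)"
    by (rule Lim_transform_eventually) (use ev in \<open>eventually_elim, use eq in \<open>auto\<close>\<close>)
  moreover have "eventually (\<lambda>x::real. f (z0 + of_real x) \<noteq> 0) (at_right 0)"
    using ev by eventually_elim (use eq in auto)
  moreover have "f z0 = 0 \<longleftrightarrow> n > 0" using iff by (auto simp: n_def split: if_splits)
  ultimately show thesis using that by blast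
qed

text \<open>The limit is the residue of -zeta'/zeta: 1 from the pole at 1, minus the order
  \<open>n\<close> of a zero of \<open>zeta1\<close>.\<close>

lemma mangoldt_series_tendsto_order:
  assumes s: "Re s0 \<ge> 1"
  obtains n :: nat where "zeta1 s0 = 0 \<longleftrightarrow> n > 0"
    "((\<lambda>x::real. of_real x * mangoldt_series (s0 + of_real x)) \<longlongrightarrow> (if s0 = 1 then 1 else 0) - of_nat n) (at_right 0)"
proof -
  have "connected {s. Re s > 0}" by (intro convex_connected convex_halfspace_Re_gt)
  moreover have "\<exists>w\<in>{s. Re s > 0}. zeta1 w \<noteq> 0" using zeta1_1 by (intro bexI[of _ 1]) auto
  ultimately obtain n :: nat where n: "zeta1 s0 = 0 \<longleftrightarrow> n > 0"
    "((\<lambda>x::real. of_real x * (deriv zeta1 (s0 + of_real x) / zeta1 (s0 + of_real x))) \<longlongrightarrow> of_nat n) (at_right 0)"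
    "eventually (\<lambda>x. zeta1 (s0 + of_real x) \<noteq> 0) (at_right (0::real))"
    using log_deriv_tendsto_order[OF zeta1_holomorphic open_halfspace_Re_gt, of s0] s by auto
  have "((\<lambda>x::real. of_real x * (1 / (s0 + of_real x - 1)) :: complex) \<longlongrightarrow> (if s0 = 1 then 1 else 0)) (at_right 0)"
  proof (cases "s0 = 1")
    case True
    have "eventually (\<lambda>x::real. x > 0) (at_right 0)" by (simp add: eventually_at_right_less)
    hence "eventually (\<lambda>x::real. 1 = of_real x * (1 / (s0 + of_real x - 1) :: complex)) (at_right 0)"
      by eventually_elim (use True in auto)
    from Lim_transform_eventually[OF tendsto_const this] show ?thesis using True by simp
  next
    case False
    hence "((\<lambda>x::real. of_real x * (1 / (s0 + of_real x - 1)) :: complex) \<longlongrightarrow> of_real 0 * (1 / (s0 + of_real 0 - 1))) (at_right 0)"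
      by (intro tendsto_intros) auto
    thus ?thesis using False by simp
  qed
  from tendsto_diff[OF this n(2)]
  have "((\<lambda>x::real. of_real x * (1 / (s0 + of_real x - 1)) - of_real x * (deriv zeta1 (s0 + of_real x) / zeta1 (s0 + of_real x))) \<longlongrightarrow> (if s0 = 1 then 1 else 0) - of_nat n) (at_right 0)" .
  hence "((\<lambda>x::real. of_real x * mangoldt_series (s0 + of_real x)) \<longlongrightarrow> (if s0 = 1 then 1 else 0) - of_nat n) (at_right 0)"
  proof (rule Lim_transform_eventually)
    have "eventually (\<lambda>x::real. x > 0) (at_right 0)" by (simp add: eventually_at_right_less)
    with n(3) show "\<forall>\<^sub>F x in at_right 0. of_real x * (1 / (s0 + of_real x - 1)) - of_real x * (deriv zeta1 (s0 + of_real x) / zeta1 (s0 + of_real x)) = of_real x * mangoldt_series (s0 + of_real x)"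
    proof eventually_elim
      case (elim x)
      thus ?case using mangoldt_series_eq[of "s0 + of_real x"] s by (simp add: right_diff_distrib)
    qed
  qed
  with n(1) show thesis using that by blast
qed

text \<open>Termwise, 3 + 4 cos x + cos 2x = 2 (1 + cos x)^2 with x = t ln n, multiplied by
  nonnegative coefficients.\<close>

lemma three_four_one:
  assumes a: "a > 1"
  shows "3 * Re (mangoldt_series (of_real a)) + 4 * Re (mangoldt_series (of_real a + \<i> * of_real t))
      + Re (mangoldt_series (of_real a + \<i> * of_real (2 * t))) \<ge> 0"
proof -
  have trm: "Re (mangoldt n * of_nat n powr (-(of_real a + \<i> * of_real u))) = mangoldt n * real n powr (-a) * cos (u * ln (real n))" for n u
  proof (cases "n = 0")
    case False
    have "of_nat n powr (-(of_real a + \<i> * of_real u)) = exp (of_real (- a * ln (real n)) + \<i> * of_real (-(u * ln (real n))))"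
      using False Ln_of_real[of "real n"] by (simp add: powr_def algebra_simps)
    hence "Re (of_nat n powr (-(of_real a + \<i> * of_real u))) = exp (- a * ln (real n)) * cos (u * ln (real n))"
      by (simp add: exp_add Re_exp)
    also have "exp (- a * ln (real n)) = real n powr (-a)" using False by (simp add: powr_def)
    finally show ?thesis by simp
  qed auto
  have S: "(\<lambda>n. mangoldt n * real n powr (-a) * cos (u * ln (real n))) sums Re (mangoldt_series (of_real a + \<i> * of_real u))" for u
    using sums_Re[OF mangoldt_series_sums[of "of_real a + \<i> * of_real u"]] a unfolding trm by simp
  define h where "h = (\<lambda>n. 3 * (mangoldt n * real n powr (-a) * cos (0 * ln (real n))) + 4 * (mangoldt n * real n powr (-a) * cos (t * ln (real n)))
     + mangoldt n * real n powr (-a) * cos ((2 * t) * ln (real n)))"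
  have A: "h sums
     (3 * Re (mangoldt_series (of_real a + \<i> * of_real 0)) + 4 * Re (mangoldt_series (of_real a + \<i> * of_real t))
      + Re (mangoldt_series (of_real a + \<i> * of_real (2 * t))))"
    unfolding h_def by (intro sums_add sums_mult S)
  have B: "3 * (mangoldt n * real n powr (-a) * cos (0 * ln (real n))) + 4 * (mangoldt n * real n powr (-a) * cos (t * ln (real n)))
     + mangoldt n * real n powr (-a) * cos ((2 * t) * ln (real n)) \<ge> 0" for n
  proof -
    define c where "c = cos (t * ln (real n))"
    have "cos ((2 * t) * ln (real n)) = 2 * c^2 - 1" using cos_double_cos[of "t * ln (real n)"] by (simp add: c_def mult.assoc)
    note eq = this
    have "3 * (mangoldt n * real n powr (-a) * cos (0 * ln (real n))) + 4 * (mangoldt n * real n powr (-a) * cos (t * ln (real n)))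
     + mangoldt n * real n powr (-a) * cos ((2 * t) * ln (real n)) = mangoldt n * real n powr (-a) * (2 * (1 + c)^2)"
      unfolding eq c_def[symmetric] by (simp add: algebra_simps power2_eq_square)
    thus ?thesis by (simp add: mangoldt_nonneg)
  qed
  hence "h n \<ge> 0" for n unfolding h_def .
  from sums_le[OF this sums_zero A] show ?thesis by simp
qed

text \<open>If 1 + it and 1 + 2it have orders n and k, multiplying \<open>three_four_one\<close> by
  x and letting x tend to 0 yields 3 - 4 n - k >= 0, so n = 0. For Re s > 1 no Euler product is
  used: absolute convergence bounds \<open>mangoldt_series\<close> near s, so the residue -n is
  0.\<close>

lemma zeta1_nonzero:
  assumes s: "Re s \<ge> 1" shows "zeta1 s \<noteq> 0"
proof (cases "Im s = 0 \<and> Re s = 1")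
  case True
  hence "s = 1" by (simp add: complex_eq_iff)
  thus ?thesis using zeta1_1 by simp
next
  case False
  hence s1: "s \<noteq> 1" by auto
  obtain n :: nat where n: "zeta1 s = 0 \<longleftrightarrow> n > 0" "((\<lambda>x::real. of_real x * mangoldt_series (s + of_real x)) \<longlongrightarrow> - of_nat n) (at_right 0)"
    using mangoldt_series_tendsto_order[OF s] s1 by auto
  have pos: "eventually (\<lambda>x::real. x > 0) (at_right 0)" by (simp add: eventually_at_right_less)
  show ?thesis
  proof (cases "Re s = 1")
    case True
    define t where "t = Im s"
    have s_eq: "s = 1 + \<i> * of_real t" using True by (simp add: t_def complex_eq_iff)
    obtain k :: nat where k: "((\<lambda>x::real. of_real x * mangoldt_series (1 + \<i> * of_real (2 * t) + of_real x)) \<longlongrightarrow> - of_nat k) (at_right 0)"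
      using mangoldt_series_tendsto_order[of "1 + \<i> * of_real (2 * t)"] False True by (auto simp: t_def complex_eq_iff)
    have one: "((\<lambda>x::real. of_real x * mangoldt_series (1 + of_real x)) \<longlongrightarrow> 1) (at_right 0)"
      using mangoldt_series_tendsto_order[of 1] zeta1_1 by (auto simp del: of_nat_0_less_iff)
    have "((\<lambda>x::real. 3 * Re (of_real x * mangoldt_series (1 + of_real x)) + 4 * Re (of_real x * mangoldt_series (s + of_real x))
       + Re (of_real x * mangoldt_series (1 + \<i> * of_real (2 * t) + of_real x))) \<longlongrightarrow> 3 * Re 1 + 4 * Re (- of_nat n) + Re (- of_nat k)) (at_right 0)"
      by (intro tendsto_intros one n k)
    hence "0 \<le> 3 * Re 1 + 4 * Re (- of_nat n) + Re (- of_nat k)"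
    proof (rule tendsto_lowerbound)
      show "\<forall>\<^sub>F x in at_right 0. 0 \<le> 3 * Re (of_real x * mangoldt_series (1 + of_real x)) + 4 * Re (of_real x * mangoldt_series (s + of_real x))
       + Re (of_real x * mangoldt_series (1 + \<i> * of_real (2 * t) + of_real x))"
        using pos
      proof eventually_elim
        case (elim x)
        have "0 \<le> x * (3 * Re (mangoldt_series (of_real (1 + x))) + 4 * Re (mangoldt_series (of_real (1 + x) + \<i> * of_real t))
      + Re (mangoldt_series (of_real (1 + x) + \<i> * of_real (2 * t))))"
          using elim three_four_one[of "1 + x" t] by (intro mult_nonneg_nonneg) auto
        thus ?case by (simp add: s_eq algebra_simps)
      qed
    qed auto
    hence "n = 0" by simp
    thus ?thesis using n(1) by simp
  next
    case False
    hence s': "Re s > 1" using s by simp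
    have "((\<lambda>x::real. of_real x * mangoldt_series (s + of_real x)) \<longlongrightarrow> 0) (at_right 0)"
    proof (rule Lim_null_comparison)
      show "((\<lambda>x::real. x * (\<Sum>n. norm (mangoldt n * of_nat n powr (-s) :: complex))) \<longlongrightarrow> 0) (at_right 0)"
        by (auto intro!: tendsto_eq_intros)
      show "\<forall>\<^sub>F x in at_right 0. norm (of_real x * mangoldt_series (s + of_real x)) \<le> x * (\<Sum>n. norm (mangoldt n * of_nat n powr (-s) :: complex))"
        using pos
      proof eventually_elim
        case (elim x)
        have "norm (mangoldt_series (s + of_real x)) \<le> (\<Sum>n. norm (mangoldt n * of_nat n powr (-(s + of_real x)) :: complex))"
          unfolding mangoldt_series_def using s' elim by (intro summable_norm norm_summable_mangoldt) auto
        also have "\<dots> \<le> (\<Sum>n. norm (mangoldt n * of_nat n powr (-s) :: complex))"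
        proof (intro suminf_le norm_summable_mangoldt)
          fix n show "norm (mangoldt n * of_nat n powr (-(s + of_real x)) :: complex) \<le> norm (mangoldt n * of_nat n powr (-s) :: complex)"
            using elim by (cases "n = 0") (auto simp: norm_mult norm_nat_powr mangoldt_nonneg intro!: mult_left_mono powr_mono)
        qed (use s' elim in auto)
        finally show ?case using elim by (simp add: norm_mult mult_left_mono)
      qed
    qed
    from tendsto_unique[OF _ this n(2)] have "n = 0" by simp
    thus ?thesis using n(1) by simp
  qed
qed

section \<open>The prime number theorem\<close>

definition psi :: "nat \<Rightarrow> real" where "psi n = (\<Sum>m=1..n. mangoldt m)"

lemma psi_0 [simp]: "psi 0 = 0" by (simp add: psi_def)
lemma psi_Suc: "psi (Suc n) = psi n + mangoldt (Suc n)" by (simp add: psi_def)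
lemma psi_mono: "m \<le> n \<Longrightarrow> psi m \<le> psi n"
  by (rule lift_Suc_mono_le[of psi]) (simp_all add: psi_Suc mangoldt_nonneg)
lemma psi_nonneg: "psi n \<ge> 0" unfolding psi_def by (intro sum_nonneg) (auto simp: mangoldt_nonneg)

text \<open>Legendre's formula. The range up to \<open>M\<close> is independent of \<open>N\<close>,
  so that (2n)! and n! can be expanded over the same index set and subtracted termwise.\<close>

lemma ln_fact_eq_sum_mangoldt:
  "N \<le> M \<Longrightarrow> ln (fact N :: real) = (\<Sum>d=1..M. mangoldt d * real (N div d))"
proof (induction N)
  case (Suc N)
  have "(\<Sum>d=1..M. mangoldt d * real (Suc N div d)) =
     (\<Sum>d=1..M. mangoldt d * real (N div d) + (if d dvd Suc N then mangoldt d else 0))"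
    by (rule sum.cong) (simp_all add: div_Suc dvd_eq_mod_eq_0 distrib_left)
  also have "\<dots> = ln (fact N) + (\<Sum>d=1..M. if d dvd Suc N then mangoldt d else 0)"
    using Suc by (simp add: sum.distrib)
  also have "(\<Sum>d=1..M. if d dvd Suc N then mangoldt d else 0) = (\<Sum>d | d dvd Suc N. mangoldt d :: real)"
  proof (rule sum.mono_neutral_cong_right)
    show "{d. d dvd Suc N} \<subseteq> {1..M}" using Suc.prems dvd_imp_le[of _ "Suc N"] dvd_pos_nat[of "Suc N"] by force
  qed auto
  also have "\<dots> = ln (real (Suc N))" using mangoldt_sum[of "Suc N", where ?'a = real] by simp
  also have "ln (fact N) + ln (real (Suc N)) = ln (fact (Suc N) :: real)"
    by (simp add: ln_mult mult.commute del: of_nat_Suc)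
  finally show ?case by simp
qed simp

text \<open>In ln (2n choose n) the weight of \<open>mangoldt d\<close> is 2n div d - 2 (n div d).
  It is never negative and equals 1 for n < d <= 2n, while the binomial coefficient is at most
  4^n.\<close>

lemma psi_double_le: "psi (2 * n) - psi n \<le> 2 * real n * ln 2"
proof -
  have "psi (2 * n) - psi n = (\<Sum>d=n+1..2*n. mangoldt d)"
  proof -
    have "{1..2*n} = {1..n} \<union> {n+1..2*n}" by auto
    hence "psi (2*n) = psi n + (\<Sum>d=n+1..2*n. mangoldt d)"
      unfolding psi_def by (simp only:) (intro sum.union_disjoint, auto)
    thus ?thesis by simp
  qed
  also have "\<dots> \<le> (\<Sum>d=n+1..2*n. mangoldt d * (real (2*n div d) - 2 * real (n div d)))"
  proof (intro sum_mono)
    fix d assume d: "d \<in> {n+1..2*n}"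
    hence "2 * n div d = 1" "n div d = 0" by (auto intro!: div_nat_eqI)
    thus "mangoldt d \<le> mangoldt d * (real (2*n div d) - 2 * real (n div d))" by simp
  qed
  also have "\<dots> \<le> (\<Sum>d=1..2*n. mangoldt d * (real (2*n div d) - 2 * real (n div d)))"
  proof (intro sum_mono2)
    fix d
    have "2 * (n div d) \<le> 2 * n div d"
      by (cases "d = 0") (simp_all add: less_eq_div_iff_mult_less_eq div_times_less_eq_dividend)
    hence "2 * real (n div d) \<le> real (2 * n div d)" by (metis of_nat_le_iff of_nat_mult of_nat_numeral)
    thus "0 \<le> mangoldt d * (real (2*n div d) - 2 * real (n div d))" by (simp add: mangoldt_nonneg)
  qed auto
  also have "\<dots> = ln (fact (2*n)) - 2 * ln (fact n)"
    using ln_fact_eq_sum_mangoldt[of "2*n" "2*n"] ln_fact_eq_sum_mangoldt[of n "2*n"]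
    by (simp add: right_diff_distrib sum_subtractf sum_distrib_left mult_ac)
  also have "\<dots> = ln (real (2*n choose n))"
    by (simp add: binomial_fact ln_div ln_mult)
  also have "\<dots> \<le> ln (2 ^ (2*n))"
  proof (subst ln_le_cancel_iff)
    have "2*n choose n \<le> 2 ^ (2*n)" by (rule binomial_le_pow2)
    thus "real (2*n choose n) \<le> 2 ^ (2*n)" by (metis of_nat_le_iff of_nat_numeral of_nat_power)
  qed auto
  finally show ?thesis by (simp add: ln_realpow)
qed

text \<open>Repeated halving with rounding up. The constant 5 leaves room for the rounding: the step
  yields 10/3 (n + 1), which is at most 5 n from n = 2 on.\<close>

lemma psi_le: "psi n \<le> 5 * real n"
proof (induction n rule: less_induct)
  case (less n)
  show ?case
  proof (cases "n \<le> 1")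
    case True
    hence "n = 0 \<or> n = 1" by auto
    thus ?thesis by (auto simp: psi_def)
  next
    case False
    define m where "m = (n + 1) div 2"
    have m: "m < n" "n \<le> 2 * m" "2 * m \<le> n + 1" using False by (auto simp: m_def)
    have "psi n \<le> psi (2*m)" using m by (intro psi_mono)
    also have "\<dots> \<le> psi m + 2 * real m * ln 2" using psi_double_le[of m] by simp
    also have "\<dots> \<le> 5 * real m + 2 * real m * (5/6)"
    proof -
      have "ln 2 \<le> (5/6 :: real)" using ln2_le_25_over_36 by simp
      thus ?thesis using less.IH[OF m(1)] by (intro add_mono mult_left_mono) auto
    qed
    also have "\<dots> = 10/3 * (2 * real m)" by simp
    also have "\<dots> \<le> 10/3 * (real n + 1)" using m by (intro mult_left_mono) auto
    also have "\<dots> \<le> 5 * real n" using False by simp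
    finally show ?thesis .
  qed
qed

(* An integral instead of its closed form, which is not defined at w = -1. *)
definition powr_slice :: "nat \<Rightarrow> complex \<Rightarrow> complex" where
  "powr_slice n w = integral {0..1} (\<lambda>u. of_real (real n + u) powr (-2-w))"

lemma powr_slice_holomorphic:
  assumes n: "n > 0" shows "powr_slice n holomorphic_on UNIV"
proof -
  have "(\<lambda>w. integral (cbox 0 1) (\<lambda>u. exp ((-2-w) * of_real (ln (real n + u))))) holomorphic_on UNIV"
  proof (rule leibniz_rule_holomorphic)
    show "((\<lambda>x. exp ((- 2 - x) * of_real (ln (real n + t)))) has_field_derivative (- of_real (ln (real n + t)) * exp ((- 2 - w) * of_real (ln (real n + t))))) (at w within UNIV)" for w t
      by (auto intro!: derivative_eq_intros)
    show "(\<lambda>t. exp ((- 2 - w) * complex_of_real (ln (real n + t)))) integrable_on cbox 0 1" for w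
      using n by (intro integrable_continuous continuous_intros) auto
    show "continuous_on (UNIV \<times> cbox 0 1) (\<lambda>(w,t). - of_real (ln (real n + t)) * exp ((- 2 - w) * complex_of_real (ln (real n + t))))"
      using n unfolding case_prod_unfold by (intro continuous_intros) (auto simp: mem_Times_iff)
  qed auto
  moreover have "integral (cbox 0 1) (\<lambda>u. exp ((-2-w) * of_real (ln (real n + u)))) = powr_slice n w" for w
    unfolding powr_slice_def box_real
  proof (intro integral_cong)
    fix u :: real assume "u \<in> {0..1}"
    hence u: "real n + u > 0" using n by auto
    thus "exp ((-2-w) * of_real (ln (real n + u))) = complex_of_real (real n + u) powr (-2-w)"
      by (simp only: powr_def Ln_of_real of_real_eq_0_iff) simp
  qed
  ultimately show ?thesis by (simp add: fun_eq_iff)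
qed

lemma powr_slice_eq:
  assumes n: "n > 0" and w: "w \<noteq> -1"
  shows "powr_slice n w = (of_nat n powr (-1-w) - of_nat (n+1) powr (-1-w)) / (1+w)"
proof -
  have w': "-1-w \<noteq> 0" "1+w \<noteq> 0" using w by (auto simp: add_eq_0_iff algebra_simps)
  define f where "f = (\<lambda>z::complex. (of_nat n + z) powr (-1-w) / (-1-w))"
  have "((\<lambda>u::real. of_real (real n + u) powr (-2-w)) has_integral (f (of_real 1) - f (of_real 0))) {0..1}"
  proof (rule fundamental_theorem_of_calculus)
    fix u :: real assume u: "u \<in> {0..1}"
    have nz: "of_nat n + complex_of_real u \<notin> \<real>\<^sub>\<le>\<^sub>0" using u n by (auto simp: complex_nonpos_Reals_iff)
    have "(f has_field_derivative ((-1-w) * (of_nat n + of_real u) powr (-1-w-1) * 1 / (-1-w))) (at (of_real u))"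
      unfolding f_def
      by (rule DERIV_cdivide, rule DERIV_chain2[where f = "\<lambda>z. z powr (-1-w)" and g = "\<lambda>z. of_nat n + z", OF has_field_derivative_powr[OF nz]])
         (auto intro!: derivative_eq_intros)
    also have "(-1-w) * (of_nat n + of_real u) powr (-1-w-1) * 1 / (-1-w) = of_real (real n + u) powr (-2-w)"
      using w' by simp
    finally show "((\<lambda>u. f (of_real u)) has_vector_derivative of_real (real n + u) powr (-2-w)) (at u within {0..1})"
      by (rule has_vector_derivative_real_field)
  qed auto
  hence "powr_slice n w = f (of_real 1) - f (of_real 0)" unfolding powr_slice_def by (rule integral_unique)
  also have "\<dots> = (of_nat n powr (-1-w) - of_nat (n+1) powr (-1-w)) / (1+w)"
  proof -
    have "a / (-1-w) - b / (-1-w) = (b - a) / (1+w)" for a b :: complex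
      using w' by (simp add: divide_simps) (simp add: algebra_simps)
    thus ?thesis unfolding f_def by (simp add: add.commute)
  qed
  finally show ?thesis .
qed

text \<open>The factor n is bounded by the integration variable and absorbed into the power. The
  result telescopes over n, and it has the right sign on either side of the imaginary axis.\<close>

lemma norm_powr_slice_le:
  assumes n: "n > 0" and w: "Re w \<noteq> 0"
  shows "real n * norm (powr_slice n w) \<le> (real n powr (- Re w) - real (n+1) powr (- Re w)) / Re w"
proof -
  define s where "s = Re w"
  have "((\<lambda>u::real. (real n + u) powr (-s-1)) has_integral ((real n + 1) powr (-s) / (-s) - (real n + 0) powr (-s) / (-s))) {0..1}"
  proof (rule fundamental_theorem_of_calculus)
    fix u :: real assume u: "u \<in> {0..1}"
    have "((\<lambda>u. (real n + u) powr (-s) / (-s)) has_real_derivative (real n + u) powr (-s-1)) (at u)"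
      using u n w by (auto intro!: derivative_eq_intros simp: s_def)
    thus "((\<lambda>u. (real n + u) powr (-s) / (-s)) has_vector_derivative (real n + u) powr (-s-1)) (at u within {0..1})"
      by (rule has_vector_derivative_at_within[OF iffD1[OF has_real_derivative_iff_has_vector_derivative]])
  qed auto
  hence I: "((\<lambda>u::real. (real n + u) powr (-s-1)) has_integral ((real n powr (-s) - (real n + 1) powr (-s)) / s)) {0..1}"
    by (simp add: diff_divide_distrib)
  have "norm (integral {0..1} (\<lambda>u. of_nat n * of_real (real n + u) powr (-2-w))) \<le> integral {0..1} (\<lambda>u. (real n + u) powr (-s-1))"
  proof (rule integral_norm_bound_integral)
    show "(\<lambda>u. of_nat n * complex_of_real (real n + u) powr (-2-w)) integrable_on {0..1}"
      using n by (intro integrable_continuous_interval continuous_intros) (auto simp: complex_eq_iff complex_nonpos_Reals_iff)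
    fix u :: real assume u: "u \<in> {0..1}"
    have "norm (of_nat n * complex_of_real (real n + u) powr (-2-w)) = real n * (real n + u) powr (-2-s)"
      using u by (simp add: norm_mult norm_powr_real_powr s_def del: of_real_add)
    also have "\<dots> \<le> (real n + u) * (real n + u) powr (-2-s)" using u by (intro mult_right_mono) auto
    also have "\<dots> = (real n + u) powr (1 + (-2-s))" using u n by (subst powr_add) auto
    also have "1 + (-2-s) = -s-1" by simp
    finally show "norm (of_nat n * complex_of_real (real n + u) powr (-2-w)) \<le> (real n + u) powr (-s-1)" by simp
  qed (use I in auto)
  also have "integral {0..1} (\<lambda>u. (real n + u) powr (-s-1)) = (real n powr (-s) - (real n + 1) powr (-s)) / s"
    using I by (rule integral_unique)
  also have "integral {0..1} (\<lambda>u. of_nat n * of_real (real n + u) powr (-2-w)) = of_nat n * powr_slice n w"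
    by (simp add: powr_slice_def)
  finally show ?thesis by (simp add: norm_mult s_def add.commute)
qed

text \<open>The integral of (psi x - floor x) * x^(-2-w) over [1, N+1], cut at the integers: between
  two of them the first factor is constant.\<close>

definition cheb_partial :: "nat \<Rightarrow> complex \<Rightarrow> complex" where
  "cheb_partial N w = (\<Sum>n=1..N. of_real (psi n - real n) * powr_slice n w)"

lemma abs_psi_minus_le: "\<bar>psi n - real n\<bar> \<le> 5 * real n"
  using psi_le[of n] psi_nonneg[of n] by auto

text \<open>Serves both hypotheses of the tauberian theorem: M to infinity gives the tail for Re w >
  0, and starting from \<open>cheb_partial 0 w = 0\<close> gives the size of the partial integrals
  for Re w < 0. The 5 comes from \<open>psi_le\<close>.\<close>

lemma norm_cheb_partial_diff_le:
  assumes "N \<le> M" "Re w \<noteq> 0"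
  shows "norm (cheb_partial M w - cheb_partial N w) \<le> 5 * (real (N+1) powr (- Re w) - real (M+1) powr (- Re w)) / Re w"
  using assms(1)
proof (induction M rule: dec_induct)
  case (step M)
  have "cheb_partial (Suc M) w - cheb_partial N w = (cheb_partial M w - cheb_partial N w) + of_real (psi (Suc M) - real (Suc M)) * powr_slice (Suc M) w"
    by (simp add: cheb_partial_def)
  also have "norm \<dots> \<le> 5 * (real (N+1) powr (- Re w) - real (M+1) powr (- Re w)) / Re w
      + 5 * (real (M+1) powr (- Re w) - real (Suc M+1) powr (- Re w)) / Re w"
  proof (rule order.trans[OF norm_triangle_ineq add_mono[OF step.IH]])
    have "norm (of_real (psi (Suc M) - real (Suc M)) * powr_slice (Suc M) w) \<le> (5 * real (Suc M)) * norm (powr_slice (Suc M) w)"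
      unfolding norm_mult norm_of_real by (intro mult_right_mono abs_psi_minus_le) auto
    also have "\<dots> = 5 * (real (Suc M) * norm (powr_slice (Suc M) w))" by simp
    also have "\<dots> \<le> 5 * ((real (Suc M) powr (- Re w) - real (Suc M+1) powr (- Re w)) / Re w)"
      using norm_powr_slice_le[of "Suc M" w] assms(2) by (intro mult_left_mono) auto
    finally show "norm (of_real (psi (Suc M) - real (Suc M)) * powr_slice (Suc M) w) \<le> 5 * (real (M+1) powr (- Re w) - real (Suc M+1) powr (- Re w)) / Re w"
      by simp
  qed
  also have "\<dots> = 5 * (real (N+1) powr (- Re w) - real (Suc M+1) powr (- Re w)) / Re w"
    by (simp add: algebra_simps diff_divide_distrib add_divide_distrib)
  finally show ?case .
qed simp

lemma sum_mangoldt_abel: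
  "(\<Sum>n\<le>N. mangoldt n * of_nat n powr (-s) - of_nat n powr (-s)) =
   (\<Sum>n=1..N. of_real (psi n - real n) * (of_nat n powr (-s) - of_nat (n+1) powr (-s))) + of_real (psi N - real N) * (of_nat (N+1) powr (-s) :: complex)"
proof (induction N)
  case (Suc N)
  show ?case unfolding sum.atMost_Suc Suc.IH by (simp add: psi_Suc algebra_simps)
qed auto

text \<open>For Re w > 0 this is (mangoldt_series s - zeta_series s) / s at s = 1 + w; the poles of
  the two series at s = 1 cancel. The quotient filled in by the derivative continues it across w =
  0, and the unsimplified \<open>1+w = 1\<close> and \<open>1+w-1\<close> keep the shape of
  \<open>pole_lemma\<close> composed with the shift.\<close>

definition cheb_limit :: "complex \<Rightarrow> complex" where
  "cheb_limit w = (- deriv zeta1 (1+w) / zeta1 (1+w) - (if 1+w = 1 then deriv zeta1 1 else (zeta1 (1+w) - zeta1 1) / (1+w-1))) / (1+w)"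

lemma cheb_partial_tendsto:
  assumes w: "Re w > 0" shows "(\<lambda>N. cheb_partial N w) \<longlonglongrightarrow> cheb_limit w"
proof -
  define s where "s = 1 + w"
  have s: "Re s > 1" "s \<noteq> 0" "s \<noteq> 1" "zeta1 s \<noteq> 0" using w zeta1_nonzero[of s] by (auto simp: s_def complex_eq_iff)
  have "(\<lambda>N. \<Sum>n\<le>N. mangoldt n * of_nat n powr (-s) - of_nat n powr (-s)) \<longlonglongrightarrow> mangoldt_series s - zeta_series s"
    unfolding sums_def_le[symmetric] by (intro sums_diff mangoldt_series_sums zeta_series_sums s)
  moreover have "(\<lambda>N. of_real (psi N - real N) * (of_nat (N+1) powr (-s) :: complex)) \<longlonglongrightarrow> 0"
  proof (rule Lim_null_comparison)
    show "\<forall>\<^sub>F N in sequentially. norm (of_real (psi N - real N) * (of_nat (N+1) powr (-s) :: complex)) \<le> 5 * real (N+1) powr (1 - Re s)"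
    proof (intro always_eventually allI)
      fix N
      have "norm (of_real (psi N - real N) * (of_nat (N+1) powr (-s) :: complex)) \<le> (5 * real (N+1)) * real (N+1) powr (- Re s)"
        unfolding norm_mult norm_of_real norm_nat_powr using abs_psi_minus_le[of N] by (intro mult_mono) auto
      also have "\<dots> = 5 * real (N+1) powr (1 + (- Re s))" by (subst powr_add) simp
      finally show "norm (of_real (psi N - real N) * (of_nat (N+1) powr (-s) :: complex)) \<le> 5 * real (N+1) powr (1 - Re s)" by simp
    qed
    have "(\<lambda>N. real (N+1) powr (1 - Re s)) \<longlonglongrightarrow> 0"
      using s by (intro tendsto_neg_powr filterlim_compose[OF filterlim_real_sequentially] filterlim_add_const_nat_at_top) auto
    thus "(\<lambda>N. 5 * real (N+1) powr (1 - Re s)) \<longlonglongrightarrow> 0" using tendsto_mult_right_zero by blast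
  qed
  ultimately have "(\<lambda>N. (\<Sum>n\<le>N. mangoldt n * of_nat n powr (-s) - of_nat n powr (-s)) - of_real (psi N - real N) * (of_nat (N+1) powr (-s) :: complex))
      \<longlonglongrightarrow> mangoldt_series s - zeta_series s - 0" by (rule tendsto_diff)
  hence "(\<lambda>N. (\<Sum>n=1..N. of_real (psi n - real n) * (of_nat n powr (-s) - of_nat (n+1) powr (-s))) / s) \<longlonglongrightarrow> (mangoldt_series s - zeta_series s) / s"
    unfolding sum_mangoldt_abel using s by (intro tendsto_divide tendsto_const) auto
  moreover have "(\<Sum>n=1..N. of_real (psi n - real n) * (of_nat n powr (-s) - of_nat (n+1) powr (-s))) / s = cheb_partial N w" for N
  proof -
    have "powr_slice n w = (of_nat n powr (-s) - of_nat (n+1) powr (-s)) / s" if "n \<in> {1..N}" for n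
      using powr_slice_eq[of n w] that w by (auto simp: s_def complex_eq_iff algebra_simps)
    thus ?thesis by (simp add: cheb_partial_def sum_divide_distrib)
  qed
  moreover have "(mangoldt_series s - zeta_series s) / s = cheb_limit w"
  proof -
    have "zeta_series s = zeta1 s / (s - 1)" using zeta1_eq_zeta_series[OF s(1)] s by simp
    hence "mangoldt_series s - zeta_series s = - deriv zeta1 s / zeta1 s - (zeta1 s - 1) / (s - 1)"
      using mangoldt_series_eq[OF s(1,4)] by (simp add: diff_divide_distrib)
    thus ?thesis using s by (simp add: cheb_limit_def s_def zeta1_1)
  qed
  ultimately show ?thesis by simp
qed

text \<open>The tauberian theorem at w = 0, where the slices are 1 / (n (n+1)). With L N = ln (N+1)
  the powers of N + 1 become its exponentials, and the non-vanishing of \<open>zeta1\<close> for Re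
  s >= 1 places the closed half-plane inside \<open>U\<close>.\<close>

lemma convergent_psi_sum:
  "convergent (\<lambda>N. \<Sum>n=1..N. (psi n - real n) / (real n * (real n + 1)))"
proof -
  define U where "U = {w. Re w > -1 \<and> zeta1 (1+w) \<noteq> 0}"
  have hol1: "(\<lambda>w. zeta1 (1+w)) holomorphic_on {w. Re w > -1}"
    by (rule holomorphic_on_compose_gen[of "\<lambda>w. 1+w", OF _ zeta1_holomorphic, unfolded o_def]) (auto intro!: holomorphic_intros)
  have U_open: "open U"
  proof -
    have "open {w. Re w > -1}" by (rule open_halfspace_Re_gt)
    hence "open ({w. Re w > -1} \<inter> (\<lambda>w. zeta1 (1+w)) -` (-{0}))"
      by (intro continuous_open_preimage holomorphic_on_imp_continuous_on hol1) auto
    thus ?thesis by (simp add: U_def Int_def vimage_def)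
  qed
  have comp: "(\<lambda>w. f (1+w)) holomorphic_on U" if "f holomorphic_on {s. Re s > 0}" for f
    by (rule holomorphic_on_compose_gen[of "\<lambda>w. 1+w", OF _ that, unfolded o_def]) (auto simp: U_def intro!: holomorphic_intros)
  have hol: "cheb_limit holomorphic_on U"
  proof -
    have "deriv zeta1 holomorphic_on {s. Re s > 0}" by (intro holomorphic_deriv zeta1_holomorphic open_halfspace_Re_gt)
    moreover have "(\<lambda>z. if z = 1 then deriv zeta1 1 else (zeta1 z - zeta1 1) / (z - 1)) holomorphic_on {s. Re s > 0}"
      using open_halfspace_Re_gt[of 0] by (intro pole_lemma zeta1_holomorphic) (simp add: interior_open)
    ultimately show ?thesis unfolding cheb_limit_def
      using comp[OF zeta1_holomorphic] comp[of "deriv zeta1"] comp[of "\<lambda>z. if z = 1 then deriv zeta1 1 else (zeta1 z - zeta1 1) / (z - 1)"]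
      by (intro holomorphic_on_divide holomorphic_on_diff holomorphic_on_minus holomorphic_intros) (auto simp: U_def complex_eq_iff)
  qed
  have "(\<lambda>N. cheb_partial N 0) \<longlonglongrightarrow> cheb_limit 0"
  proof (rule newman_tauberian[OF U_open _ hol, of cheb_partial "\<lambda>N. ln (real (N+1))" 5])
    show "{w. Re w \<ge> 0} \<subseteq> U" using zeta1_nonzero by (auto simp: U_def)
    show "cheb_partial N holomorphic_on UNIV" for N
      unfolding cheb_partial_def using powr_slice_holomorphic by (intro holomorphic_intros) auto
    show "filterlim (\<lambda>N. ln (real (N+1))) at_top sequentially" by real_asymp
    have ex: "exp (- ln (real (N+1)) * Re w) = real (N+1) powr (- Re w)" for N and w :: complex
      by (simp add: powr_def mult.commute)
    show "norm (cheb_limit w - cheb_partial N w) \<le> 5 * exp (- ln (real (N+1)) * Re w) / Re w" if w: "Re w > 0" for N w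
    proof (rule tendsto_upperbound)
      show "(\<lambda>M. norm (cheb_partial M w - cheb_partial N w)) \<longlonglongrightarrow> norm (cheb_limit w - cheb_partial N w)"
        by (intro tendsto_intros cheb_partial_tendsto w)
      show "\<forall>\<^sub>F M in sequentially. norm (cheb_partial M w - cheb_partial N w) \<le> 5 * exp (- ln (real (N+1)) * Re w) / Re w"
        using eventually_ge_at_top[of N]
      proof eventually_elim
        case (elim M)
        have "norm (cheb_partial M w - cheb_partial N w) \<le> 5 * (real (N+1) powr (- Re w) - real (M+1) powr (- Re w)) / Re w"
          using norm_cheb_partial_diff_le[OF elim] w by simp
        also have "\<dots> \<le> 5 * real (N+1) powr (- Re w) / Re w" using w by (intro divide_right_mono) auto
        finally show ?case unfolding ex .
      qed
    qed auto
    show "norm (cheb_partial N w) \<le> 5 * exp (- ln (real (N+1)) * Re w) / (- Re w)" if w: "Re w < 0" for N w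
    proof -
      have "norm (cheb_partial N w - cheb_partial 0 w) \<le> 5 * (real (0+1) powr (- Re w) - real (N+1) powr (- Re w)) / Re w"
        using w by (intro norm_cheb_partial_diff_le) auto
      also have "\<dots> = 5 * (real (N+1) powr (- Re w) - 1) / (- Re w)" using w by (simp add: field_simps)
      also have "\<dots> \<le> 5 * real (N+1) powr (- Re w) / (- Re w)" using w by (intro divide_right_mono) auto
      finally show ?thesis unfolding ex by (simp add: cheb_partial_def)
    qed
  qed auto
  hence "(\<lambda>N. Re (cheb_partial N 0)) \<longlonglongrightarrow> Re (cheb_limit 0)" by (rule tendsto_Re)
  moreover have "Re (cheb_partial N 0) = (\<Sum>n=1..N. (psi n - real n) / (real n * (real n + 1)))" for N
  proof -
    have "Re (of_real (psi n - real n) * powr_slice n 0) = (psi n - real n) / (real n * (real n + 1))" if "n \<in> {1..N}" for n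
    proof -
      have "powr_slice n 0 = of_real (1 / real n - 1 / (real n + 1))"
        using powr_slice_eq[of n 0] that by (simp add: powr_minus inverse_eq_divide)
      also have "1 / real n - 1 / (real n + 1) = 1 / (real n * (real n + 1))" using that by (simp add: field_simps)
      finally show ?thesis by simp
    qed
    thus ?thesis by (simp add: cheb_partial_def)
  qed
  ultimately show ?thesis by (auto simp: convergent_def)
qed

text \<open>Since \<open>psi\<close> is monotone, a deviation of e * n at n persists with half its
  size over about e * n / 2 neighbouring indices: to the right if psi n is too large, to the left if
  it is too small. This block of the convergent series would then be at least e^2 / 16, against the
  Cauchy property.\<close>

theorem psi_asymptotics: "(\<lambda>n. psi n / real n) \<longlonglongrightarrow> 1"
proof (rule tendstoI)
  fix e0 :: real assume e0: "e0 > 0"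
  define e where "e = min (e0 / 2) 1"
  have e: "e > 0" "e \<le> 1" "e < e0" using e0 by (auto simp: e_def)
  define c where "c = (\<lambda>n. (psi n - real n) / (real n * (real n + 1)))"
  have "Cauchy (\<lambda>N. \<Sum>n=1..N. c n)" using convergent_psi_sum unfolding c_def by (rule convergent_Cauchy)
  then obtain M where M: "\<And>m n. m \<ge> M \<Longrightarrow> n \<ge> M \<Longrightarrow> dist (\<Sum>n=1..m. c n) (\<Sum>n=1..n. c n) < e^2 / 16"
    unfolding Cauchy_def using e by (metis zero_less_divide_iff zero_less_numeral zero_less_power)
  have block: "\<bar>\<Sum>n=a..b. c n\<bar> < e^2 / 16" if "a > M" "a \<le> b" for a b
  proof -
    have "{1..b} = {1..a-1} \<union> {a..b}" using that by auto
    hence "(\<Sum>n=1..b. c n) = (\<Sum>n=1..a-1. c n) + (\<Sum>n=a..b. c n)"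
      by (simp only:) (intro sum.union_disjoint, auto)
    thus ?thesis using M[of b "a-1"] that by (simp add: dist_real_def)
  qed
  have "eventually (\<lambda>n. n > 2 * M + 2) sequentially" by (rule eventually_gt_at_top)
  thus "\<forall>\<^sub>F n in sequentially. dist (psi n / real n) 1 < e0"
  proof eventually_elim
    case (elim n)
    define K where "K = nat \<lfloor>e * real n / 2\<rfloor>"
    have K: "real K \<le> e * real n / 2" "e * real n / 2 \<le> real K + 1" using e by (auto simp: K_def) linarith
    have "e * real n \<le> 1 * real n" using e by (intro mult_right_mono) auto
    hence Kn: "2 * K \<le> n" using K by linarith
    have n: "n \<ge> 2" "real n > 0" using elim by auto
    have den: "real m * (real m + 1) \<le> 4 * real n ^ 2" if "m \<le> n + K" for m
    proof -
      have "real m \<le> 3/2 * real n" "real m + 1 \<le> 2 * real n" using that Kn n by linarith+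
      hence "real m * (real m + 1) \<le> (2 * real n) * (2 * real n)" using n by (intro mult_mono) auto
      thus ?thesis by (simp add: power2_eq_square)
    qed
    \<comment> \<open>A lower bound for the size of a single term of the block: numerator at least e
      n / 2, denominator at most 4 n^2 because m <= 3 n / 2. This is where e <= 1 enters, through 2
      K <= n.\<close>
    define x where "x = e * real n / 2 / (4 * real n ^ 2)"
    have fin: "(real K + 1) * x \<ge> e^2 / 16"
    proof -
      have "(real K + 1) * x \<ge> (e * real n / 2) * (e * real n / 2 / (4 * real n ^ 2))"
        unfolding x_def using K e n by (intro mult_right_mono) auto
      also have "(e * real n / 2) * (e * real n / 2 / (4 * real n ^ 2)) = e^2 / 16"
        using n by (simp add: power2_eq_square field_simps)
      finally show ?thesis .
    qed
    have up: "psi n \<le> (1 + e) * real n"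
    proof (rule ccontr)
      assume "\<not> ?thesis"
      hence big: "psi n > (1 + e) * real n" by simp
      have "(\<Sum>m=n..n+K. x) \<le> (\<Sum>m=n..n+K. c m)"
      proof (intro sum_mono)
        fix m assume m: "m \<in> {n..n+K}"
        have "psi m - real m \<ge> (1 + e) * real n - (real n + e * real n / 2)"
          using psi_mono[of n m] m big K by auto
        hence "psi m - real m \<ge> e * real n / 2" by (simp add: algebra_simps)
        moreover have "e * real n / 2 \<ge> 0" using e by simp
        ultimately have "psi m - real m \<ge> e * real n / 2" "psi m - real m \<ge> 0" by linarith+
        thus "x \<le> c m"
          unfolding c_def x_def using den[of m] m n e by (intro frac_le) auto
      qed
      hence "(\<Sum>m=n..n+K. c m) \<ge> e^2 / 16" using fin by (simp add: add.commute)
      moreover have "\<bar>\<Sum>m=n..n+K. c m\<bar> < e^2 / 16" using elim by (intro block) auto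
      ultimately show False by linarith
    qed
    have low: "psi n \<ge> (1 - e) * real n"
    proof (rule ccontr)
      assume "\<not> ?thesis"
      hence big: "psi n < (1 - e) * real n" by simp
      have "(\<Sum>m=n-K..n. x) \<le> (\<Sum>m=n-K..n. - c m)"
      proof (intro sum_mono)
        fix m assume m: "m \<in> {n-K..n}"
        have "real m \<ge> real n - real K" using m Kn by auto
        hence "real m - psi m \<ge> (real n - e * real n / 2) - (1 - e) * real n"
          using psi_mono[of m n] m big K by auto
        hence "real m - psi m \<ge> e * real n / 2" by (simp add: algebra_simps)
        moreover have "e * real n / 2 \<ge> 0" using e by simp
        ultimately have "real m - psi m \<ge> e * real n / 2" "real m - psi m \<ge> 0" by linarith+
        hence "x \<le> (real m - psi m) / (real m * (real m + 1))"
          unfolding x_def using den[of m] m n e Kn elim by (intro frac_le) (auto intro!: mult_pos_pos)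
        also have "\<dots> = - c m" by (simp add: c_def minus_divide_left)
        finally show "x \<le> - c m" .
      qed
      moreover have "card {n-K..n} = K + 1" using Kn by simp
      ultimately have "- (\<Sum>m=n-K..n. c m) \<ge> e^2 / 16" using fin by (simp add: sum_negf add.commute)
      moreover have "\<bar>\<Sum>m=n-K..n. c m\<bar> < e^2 / 16" using elim Kn by (intro block) auto
      ultimately show False by linarith
    qed
    have "\<bar>psi n / real n - 1\<bar> \<le> e" using up low n by (auto simp: abs_le_iff field_simps)
    thus ?case using e by (simp add: dist_real_def)
  qed
qed

section \<open>Permutations of large order\<close>

lemma eventually_psi_ge: "e > 0 \<Longrightarrow> eventually (\<lambda>n. psi n \<ge> (1 - e) * real n) sequentially"
  and eventually_psi_le: "e > 0 \<Longrightarrow> eventually (\<lambda>n. psi n \<le> (1 + e) * real n) sequentially"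
proof -
  assume e: "e > 0"
  have "eventually (\<lambda>n. psi n / real n > 1 - e) sequentially" "eventually (\<lambda>n. psi n / real n < 1 + e) sequentially"
    using e by (auto intro!: order_tendstoD[OF psi_asymptotics])
  hence "eventually (\<lambda>n. psi n \<ge> (1 - e) * real n \<and> psi n \<le> (1 + e) * real n) sequentially"
    using eventually_gt_at_top[of 0] by eventually_elim (auto simp: field_simps)
  thus "eventually (\<lambda>n. psi n \<ge> (1 - e) * real n) sequentially" "eventually (\<lambda>n. psi n \<le> (1 + e) * real n) sequentially"
    by (auto elim: eventually_mono)
qed

lemma sum_mult_mangoldt_eq:
  "(\<Sum>m=1..n. real m * mangoldt m) = real n * psi n - (\<Sum>m<n. psi m)"
proof (induction n)
  case (Suc n)
  thus ?case by (simp add: psi_Suc algebra_simps)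
qed auto

text \<open>Abel summation gives n * psi n minus the sum of the psi m, about n^2 - n^2 / 2; so the
  upper estimate of psi at n and the lower estimates below n are combined.\<close>

lemma eventually_sum_mult_mangoldt_le:
  assumes e: "e > 0"
  shows "eventually (\<lambda>n. (\<Sum>m=1..n. real m * mangoldt m) \<le> (1/2 + e) * real n ^ 2) sequentially"
proof -
  define d where "d = min (e / 2) 1"
  have d: "d > 0" "d \<le> 1" "d \<le> e / 2" using e by (auto simp: d_def)
  obtain M where M: "\<And>n. n \<ge> M \<Longrightarrow> psi n \<ge> (1 - d) * real n"
    using eventually_psi_ge[OF d(1)] by (auto simp: eventually_sequentially)
  have "eventually (\<lambda>n. real n / 2 + real M ^ 2 \<le> e / 4 * real n ^ 2) sequentially"
    using e by real_asymp
  with eventually_psi_le[OF d(1)] show ?thesis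
  proof eventually_elim
    case (elim n)
    \<comment> \<open>Below \<open>M\<close> only psi m >= 0 is known. Subtracting \<open>M\<close>
      makes the minorant nonpositive there, at a total cost of at most M^2.\<close>
    have "(\<Sum>m<n. psi m) \<ge> (\<Sum>m<n. (1 - d) * (real m - (if m < M then real M else 0)))"
    proof (intro sum_mono)
      fix m
      show "(1 - d) * (real m - (if m < M then real M else 0)) \<le> psi m"
      proof (cases "m < M")
        case True
        hence "(1 - d) * (real m - real M) \<le> 0" using d by (intro mult_nonneg_nonpos) auto
        thus ?thesis using True psi_nonneg[of m] by simp
      qed (use M in auto)
    qed
    also have "(\<Sum>m<n. (1 - d) * (real m - (if m < M then real M else 0))) =
      (1 - d) * ((\<Sum>m<n. real m) - (\<Sum>m<n. (if m < M then real M else 0)))"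
      by (simp add: sum_subtractf sum_distrib_left[symmetric])
    also have "(\<Sum>m<n. real m) = real n * (real n - 1) / 2"
      by (induction n) (auto simp: field_simps)
    finally have 1: "(1 - d) * (real n * (real n - 1) / 2 - (\<Sum>m<n. (if m < M then real M else 0))) \<le> (\<Sum>m<n. psi m)" .
    have "(\<Sum>m<n. (if m < M then real M else 0)) \<le> real M ^ 2"
    proof -
      have "(\<Sum>m<n. (if m < M then real M else 0)) = (\<Sum>m\<in>{m. m < n \<and> m < M}. real M)"
        by (rule sum.mono_neutral_cong_right) auto
      also have "\<dots> \<le> (\<Sum>m<M. real M)" by (rule sum_mono2) auto
      finally show ?thesis by (simp add: power2_eq_square)
    qed
    hence "(1 - d) * (real n * (real n - 1) / 2 - real M ^ 2) \<le> (\<Sum>m<n. psi m)"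
      using 1 d mult_left_mono[of "real n * (real n - 1) / 2 - real M ^ 2" "real n * (real n - 1) / 2 - (\<Sum>m<n. (if m < M then real M else 0))" "1 - d"]
      by linarith
    note A = this
    have B: "(1 - d) * (real n / 2 + real M ^ 2) \<le> 1 * (real n / 2 + real M ^ 2)"
      using d by (intro mult_right_mono) auto
    have "real n * (real n - 1) / 2 - real M ^ 2 = real n ^ 2 / 2 - (real n / 2 + real M ^ 2)"
      by (simp add: power2_eq_square field_simps)
    hence E: "(1 - d) * (real n * (real n - 1) / 2 - real M ^ 2) = (1 - d) * (real n ^ 2 / 2) - (1 - d) * (real n / 2 + real M ^ 2)"
      by (simp only: right_diff_distrib)
    have "(1 - d) * (real n ^ 2 / 2) - (real n / 2 + real M ^ 2) \<le> (1 - d) * (real n ^ 2 / 2) - (1 - d) * (real n / 2 + real M ^ 2)"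
      using B by simp
    also have "\<dots> \<le> (\<Sum>m<n. psi m)" using A unfolding E .
    finally have "(1 - d) * (real n ^ 2 / 2) - (real n / 2 + real M ^ 2) \<le> (\<Sum>m<n. psi m)" .
    moreover have "real n * psi n \<le> real n * ((1 + d) * real n)" using elim by (intro mult_left_mono) auto
    ultimately have "(\<Sum>m=1..n. real m * mangoldt m) \<le> (1/2 + 3/2 * d) * real n ^ 2 + e / 4 * real n ^ 2"
      using elim unfolding sum_mult_mangoldt_eq by (simp add: algebra_simps power2_eq_square)
    also have "\<dots> \<le> (1/2 + 3/2 * (e/2)) * real n ^ 2 + e / 4 * real n ^ 2"
      using d by (intro add_mono mult_right_mono) auto
    finally show ?case by (simp add: algebra_simps)
  qed
qed

section \<open>The largest prime powers up to x: their product and their sum\<close>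

definition max_exp :: "nat \<Rightarrow> nat \<Rightarrow> nat" where "max_exp x p = (LEAST e. x < p ^ Suc e)"

lemma max_exp:
  assumes "p > 1" "x > 0"
  shows max_exp_le: "p ^ max_exp x p \<le> x" and max_exp_less: "x < p ^ Suc (max_exp x p)"
proof -
  have ex: "x < p ^ Suc x" using power_gt_expt[of p "Suc x"] assms(1) by simp
  show "x < p ^ Suc (max_exp x p)" unfolding max_exp_def by (rule LeastI) (rule ex)
  show "p ^ max_exp x p \<le> x"
  proof (cases "max_exp x p")
    case (Suc e)
    hence "e < max_exp x p" by simp
    hence "\<not> x < p ^ Suc e" unfolding max_exp_def by (rule not_less_Least)
    thus ?thesis using Suc by simp
  qed (use assms in auto)
qed

lemma le_max_exp:
  assumes "p > 1" "x > 0" "p ^ j \<le> x" shows "j \<le> max_exp x p"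
proof -
  have "p ^ j < p ^ Suc (max_exp x p)" using assms(3) max_exp_less[OF assms(1,2)] by linarith
  thus ?thesis using assms(1) by (simp add: power_strict_increasing_iff del: power_Suc)
qed

text \<open>The product is the least common multiple of 1, ..., x. Every prime power up to x divides
  it, and summing \<open>mangoldt\<close> over all divisors of a number gives its logarithm.\<close>

lemma psi_le_ln_prod:
  assumes x: "x > 0"
  shows "psi x \<le> ln (real (\<Prod>p | prime p \<and> p \<le> x. p ^ max_exp x p))"
proof -
  define P where "P = (\<Prod>p | prime p \<and> p \<le> x. p ^ max_exp x p)"
  have fin: "finite {p. prime p \<and> p \<le> x}" by (rule finite_subset[of _ "{..x}"]) auto
  have P: "P \<noteq> 0" unfolding P_def using fin by (auto dest: prime_gt_0_nat)
  have "psi x = (\<Sum>m | m \<in> {1..x} \<and> primepow m. mangoldt m)"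
    unfolding psi_def by (rule sum.mono_neutral_right) (auto simp: mangoldt_def)
  also have "\<dots> \<le> (\<Sum>d | d dvd P. mangoldt d)"
  proof (rule sum_mono2)
    show "{m. m \<in> {1..x} \<and> primepow m} \<subseteq> {d. d dvd P}"
    proof safe
      fix m assume m: "m \<in> {1..x}" "primepow m"
      then obtain p j where pj: "prime p" "j > 0" "m = p ^ j" by (auto simp: primepow_def)
      have "p ^ 1 \<le> p ^ j" using pj prime_gt_0_nat by (intro power_increasing) (auto simp: Suc_le_eq)
      hence px: "p \<le> x" using m pj by simp
      have "j \<le> max_exp x p" using m pj x prime_gt_1_nat by (intro le_max_exp) auto
      hence "m dvd p ^ max_exp x p" using pj by (simp add: le_imp_power_dvd)
      also have "\<dots> dvd P" unfolding P_def using fin pj px by (intro dvd_prodI) auto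
      finally show "m dvd P" .
    qed
  qed (use P in \<open>auto simp: mangoldt_nonneg\<close>)
  also have "\<dots> = ln (real P)" using mangoldt_sum[OF P, where ?'a = real] by simp
  finally show ?thesis by (simp add: P_def)
qed

text \<open>Primes are separated at x^(1-d). The smaller ones are few and contribute at most x each,
  which is of lower order than x^2 / ln x. The larger ones have exponent at most 1, and p <= p ln p
  / ((1-d) ln x) reduces them to the sum of m * mangoldt m.\<close>

lemma eventually_sum_prime_powers_le:
  assumes e: "e > 0"
  shows "eventually (\<lambda>x. real (\<Sum>p | prime p \<and> p \<le> x. p ^ max_exp x p) \<le> (1/2 + e) * real x ^ 2 / ln (real x)) sequentially"
proof -
  \<comment> \<open>Small enough that dividing 1/2 by 1 - d stays below 1/2 + e. Of the remaining
    gap, \<open>r\<close> serves the estimate for the large primes and \<open>g\<close> the small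
    primes. The cap 1/4 keeps d below 1/2.\<close>
  define d where "d = min (1/4) (e / (2 + 2 * e))"
  have d: "d > 0" "d < 1/2" "d \<le> e / (2 + 2 * e)" using e by (auto simp: d_def)
  have "1/2 < (1/2 + e) * ((2 + e) / (2 + 2 * e))" using e by (simp add: field_simps add_pos_pos)
  also have "\<dots> = (1/2 + e) * (1 - e / (2 + 2 * e))" using e by (simp add: field_simps)
  also have "\<dots> \<le> (1/2 + e) * (1 - d)" using d e by (intro mult_left_mono) auto
  finally have d'': "1/2 < (1/2 + e) * (1 - d)" .
  hence d': "(1/2 + e) > 1/2 / (1 - d)" using d by (subst pos_divide_less_eq) auto
  define t where "t = (1/2 + e) * (1 - d)"
  define r where "r = (t - 1/2) / 2"
  have t: "t > 1/2" using d'' by (simp add: t_def)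
  hence r: "r > 0" "1/2 + r < t" by (simp_all add: r_def field_simps)
  have r': "(1/2 + r) / (1 - d) < 1/2 + e" using d r by (subst pos_divide_less_eq) (simp_all add: t_def)
  define g where "g = (1/2 + e) - (1/2 + r) / (1 - d)"
  have g: "g > 0" using r' by (simp add: g_def)
  have "eventually (\<lambda>x::nat. real x * real x powr (1 - d) \<le> g * real x ^ 2 / ln (real x)) sequentially"
    using g d by real_asymp
  moreover have "eventually (\<lambda>x::nat. ln (real x) > 0) sequentially" by real_asymp
  ultimately show ?thesis using eventually_gt_at_top[of 1] eventually_sum_mult_mangoldt_le[OF r(1)]
  proof eventually_elim
    case (elim x)
    define A where "A = {p. prime p \<and> p \<le> x}"
    have fin: "finite A" unfolding A_def by (rule finite_subset[of _ "{..x}"]) auto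
    let ?B = "{p\<in>A. real p \<le> real x powr (1 - d)}" and ?C = "{p\<in>A. real p > real x powr (1 - d)}"
    have "(\<Sum>p\<in>A. p ^ max_exp x p) = (\<Sum>p\<in>?B \<union> ?C. p ^ max_exp x p)" by (rule sum.cong) auto
    also have "\<dots> = (\<Sum>p\<in>?B. p ^ max_exp x p) + (\<Sum>p\<in>?C. p ^ max_exp x p)"
      using fin by (intro sum.union_disjoint) auto
    finally have "real (\<Sum>p\<in>A. p ^ max_exp x p) = real (\<Sum>p\<in>?B. p ^ max_exp x p) + real (\<Sum>p\<in>?C. p ^ max_exp x p)"
      by simp
    also have "real (\<Sum>p\<in>?B. p ^ max_exp x p) \<le> real x * real x powr (1 - d)"
    proof -
      have "(\<Sum>p\<in>?B. p ^ max_exp x p) \<le> (\<Sum>p\<in>?B. x)"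
      proof (rule sum_mono)
        fix p assume "p \<in> ?B"
        thus "p ^ max_exp x p \<le> x" using elim prime_gt_1_nat[of p] by (intro max_exp_le) (auto simp: A_def)
      qed
      also have "\<dots> = card ?B * x" by simp
      finally have "real (\<Sum>p\<in>?B. p ^ max_exp x p) \<le> real (card ?B * x)" by (rule of_nat_mono)
      hence B1: "real (\<Sum>p\<in>?B. p ^ max_exp x p) \<le> real (card ?B) * real x" by (simp only: of_nat_mult)
      have "card ?B \<le> card {1..nat \<lfloor>real x powr (1 - d)\<rfloor>}"
      proof (rule card_mono)
        show "?B \<subseteq> {1..nat \<lfloor>real x powr (1 - d)\<rfloor>}"
        proof
          fix p assume "p \<in> ?B"
          thus "p \<in> {1..nat \<lfloor>real x powr (1 - d)\<rfloor>}"
            using prime_gt_0_nat[of p] by (auto simp: A_def le_nat_floor Suc_le_eq)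
        qed
      qed auto
      hence "card ?B \<le> nat \<lfloor>real x powr (1 - d)\<rfloor>" by (simp only: card_atLeastAtMost)
      hence "real (card ?B) \<le> real (nat \<lfloor>real x powr (1 - d)\<rfloor>)" by (rule of_nat_mono)
      also have "\<dots> \<le> real x powr (1 - d)" by (rule of_nat_floor) simp
      finally have "real (card ?B) \<le> real x powr (1 - d)" .
      hence "real (card ?B) * real x \<le> real x powr (1 - d) * real x" by (rule mult_right_mono) simp
      with B1 show ?thesis by (simp only: mult.commute)
    qed
    also have "real (\<Sum>p\<in>?C. p ^ max_exp x p) \<le> (1/2 + r) * real x ^ 2 / ((1 - d) * ln (real x))"
    proof -
      have "real (\<Sum>p\<in>?C. p ^ max_exp x p) = (\<Sum>p\<in>?C. real (p ^ max_exp x p))" by simp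
      also have "\<dots> \<le> (\<Sum>p\<in>?C. real p * mangoldt p / ((1 - d) * ln (real x)))"
      proof (intro sum_mono)
        fix p assume p: "p \<in> ?C"
        hence pp: "prime p" "p \<le> x" by (auto simp: A_def)
        have lnp: "ln (real p) > (1 - d) * ln (real x)"
        proof -
          have "ln (real x powr (1 - d)) < ln (real p)" using p elim by (subst ln_less_cancel_iff) (auto simp: A_def dest: prime_gt_0_nat)
          thus ?thesis using elim by (simp add: ln_powr)
        qed
        \<comment> \<open>Here p^2 > x^(2-2d) > x, by d < 1/2.\<close>
        have "max_exp x p < 2"
        proof (rule ccontr)
          assume "\<not> ?thesis"
          hence "p ^ 2 \<le> p ^ max_exp x p" using pp prime_gt_0_nat[of p] by (intro power_increasing) auto
          also have "\<dots> \<le> x" using pp elim prime_gt_1_nat by (intro max_exp_le) auto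
          finally have "real p ^ 2 \<le> real x" by (metis of_nat_le_iff of_nat_power)
          hence "ln (real p ^ 2) \<le> ln (real x)" using elim pp prime_gt_0_nat[of p] by (subst ln_le_cancel_iff) auto
          hence "2 * ln (real p) \<le> ln (real x)" using pp prime_gt_0_nat[of p] by (simp add: ln_realpow)
          hence "2 * ((1 - d) * ln (real x)) < ln (real x)" using lnp by linarith
          hence "(1 - 2 * d) * ln (real x) < 0" by (simp add: algebra_simps)
          thus False using d elim by (simp add: mult_less_0_iff)
        qed
        hence "max_exp x p \<le> 1" by simp
        hence "p ^ max_exp x p \<le> p ^ 1" using pp prime_gt_0_nat[of p] by (intro power_increasing) auto
        hence "real (p ^ max_exp x p) \<le> real p" by simp
        also have "\<dots> \<le> real p * (ln (real p) / ((1 - d) * ln (real x)))"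
        proof -
          have "ln (real p) / ((1 - d) * ln (real x)) \<ge> 1" using lnp d elim by (subst le_divide_eq_1_pos) auto
          hence "real p * 1 \<le> real p * (ln (real p) / ((1 - d) * ln (real x)))" by (rule mult_left_mono) simp
          thus ?thesis by simp
        qed
        finally show "real (p ^ max_exp x p) \<le> real p * mangoldt p / ((1 - d) * ln (real x))" using pp by simp
      qed
      also have "\<dots> = (\<Sum>p\<in>?C. real p * mangoldt p) / ((1 - d) * ln (real x))" by (simp add: sum_divide_distrib)
      also have "\<dots> \<le> (\<Sum>m=1..x. real m * mangoldt m) / ((1 - d) * ln (real x))"
        using d elim by (intro divide_right_mono sum_mono2) (auto simp: A_def Suc_le_eq mangoldt_nonneg dest: prime_gt_0_nat)
      also have "\<dots> \<le> (1/2 + r) * real x ^ 2 / ((1 - d) * ln (real x))"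
        using d elim by (intro divide_right_mono) auto
      finally show ?thesis .
    qed
    also have "real x * real x powr (1 - d) \<le> g * real x ^ 2 / ln (real x)" using elim by simp
    also have "g * real x ^ 2 / ln (real x) + (1/2 + r) * real x ^ 2 / ((1 - d) * ln (real x)) = (1/2 + e) * real x ^ 2 / ln (real x)"
    proof -
      have "(1/2 + r) * real x ^ 2 / ((1 - d) * ln (real x)) = (1/2 + r) / (1 - d) * (real x ^ 2 / ln (real x))" by simp
      moreover have "g * real x ^ 2 / ln (real x) = g * (real x ^ 2 / ln (real x))" by simp
      ultimately show ?thesis by (simp add: g_def algebra_simps)
    qed
    finally show ?case by (simp add: A_def)
  qed
qed

text \<open>Landau's lower bound with the prime powers up to some x: their sum has to fit into k
  points, and the logarithm of their product is at least psi x, which is close to x.\<close>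

lemma eventually_landau:
  assumes e: "e > 0"
  shows "eventually (\<lambda>k. \<exists>Q. finite Q \<and> 0 \<notin> Q \<and> pairwise coprime Q \<and> (\<Sum>q\<in>Q. q) \<le> k \<and>
     exp ((1 - e) * sqrt (real k * ln (real k))) \<le> real (\<Prod>q\<in>Q. q)) sequentially"
proof -
  define d where "d = min (e / 2) (1/2)"
  have d: "d > 0" "d < 1" "2 * d \<le> e" using e by (auto simp: d_def)
  \<comment> \<open>The sum of the powers is about x^2 / (2 ln x), and ln x >= (ln k) / 2. With the
    factor 1 - d it is at most (1 + d) (1 - d)^2 k <= k.\<close>
  define x where "x = (\<lambda>k::nat. nat \<lfloor>(1 - d) * sqrt (real k * ln (real k))\<rfloor>)"
  have lim: "filterlim x at_top sequentially"
    unfolding x_def using d by real_asymp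
  have "eventually (\<lambda>x. real (\<Sum>p | prime p \<and> p \<le> x. p ^ max_exp x p) \<le> (1/2 + d/2) * real x ^ 2 / ln (real x)
     \<and> psi x \<ge> (1 - d/2) * real x \<and> x > 1) sequentially"
    using eventually_sum_prime_powers_le[of "d/2"] eventually_psi_ge[of "d/2"] eventually_gt_at_top[of 1] d
    by (intro eventually_conj) auto
  from eventually_compose_filterlim[OF this lim]
  have "eventually (\<lambda>k. real (\<Sum>p | prime p \<and> p \<le> x k. p ^ max_exp (x k) p) \<le> (1/2 + d/2) * real (x k) ^ 2 / ln (real (x k))
     \<and> psi (x k) \<ge> (1 - d/2) * real (x k) \<and> x k > 1) sequentially" .
  moreover have "eventually (\<lambda>k::nat. ln ((1 - d) * sqrt (real k * ln (real k)) - 1) \<ge> ln (real k) / 2) sequentially"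
    using d by real_asymp
  moreover have "eventually (\<lambda>k::nat. (1 - d) * sqrt (real k * ln (real k)) - 1 > 1) sequentially"
    using d by real_asymp
  moreover have "eventually (\<lambda>k::nat. (1 - d/2) * ((1 - d) * sqrt (real k * ln (real k)) - 1) \<ge> (1 - 2 * d) * sqrt (real k * ln (real k))) sequentially"
  proof -
    have "(1 - d/2) * (1 - d) > 1 - 2 * d" using d by (simp add: algebra_simps add_pos_pos)
    thus ?thesis using d by real_asymp
  qed
  ultimately show ?thesis using eventually_gt_at_top[of 1]
  proof eventually_elim
    case (elim k)
    define X where "X = x k"
    define s where "s = sqrt (real k * ln (real k))"
    have lnk: "ln (real k) > 0" using elim by simp
    have s: "s \<ge> 0" "s^2 = real k * ln (real k)" using elim by (auto simp: s_def)
    have X: "real X \<le> (1 - d) * s" "real X \<ge> (1 - d) * s - 1"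
      using d s by (auto simp: X_def x_def s_def)
    have lnX: "ln (real X) \<ge> ln (real k) / 2"
    proof -
      have "ln (real k) / 2 \<le> ln ((1 - d) * s - 1)" using elim by (simp add: s_def)
      also have "\<dots> \<le> ln (real X)" using X elim by (subst ln_le_cancel_iff) (auto simp: s_def)
      finally show ?thesis .
    qed
    define Q where "Q = (\<lambda>p. p ^ max_exp X p) ` {p. prime p \<and> p \<le> X}"
    have fin: "finite {p. prime p \<and> p \<le> X}" by (rule finite_subset[of _ "{..X}"]) auto
    have inj: "inj_on (\<lambda>p. p ^ max_exp X p) {p. prime p \<and> p \<le> X}"
    proof (rule inj_onI)
      fix p q assume pq: "p \<in> {p. prime p \<and> p \<le> X}" "q \<in> {p. prime p \<and> p \<le> X}" "p ^ max_exp X p = q ^ max_exp X q"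
      have "1 \<le> max_exp X p" using pq prime_gt_1_nat[of p] by (intro le_max_exp) auto
      hence "p dvd p ^ max_exp X p" by (intro dvd_power) auto
      hence "p dvd q" using pq prime_dvd_power by (metis mem_Collect_eq)
      thus "p = q" using pq by (simp add: primes_dvd_imp_eq)
    qed
    have "real (\<Sum>q\<in>Q. q) \<le> (1/2 + d/2) * real X ^ 2 / ln (real X)"
      using elim inj by (simp add: Q_def sum.reindex X_def)
    also have "\<dots> \<le> (1/2 + d/2) * ((1 - d) * s) ^ 2 / (ln (real k) / 2)"
      using X lnX lnk d s by (intro frac_le mult_left_mono power_mono) auto
    also have "\<dots> = (1 + d) * (1 - d)^2 * real k" using lnk by (simp add: power_mult_distrib s(2))
    also have "\<dots> \<le> 1 * real k"
    proof (intro mult_right_mono)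
      have "(1 + d) * (1 - d)^2 = (1 - d^2) * (1 - d)" by (simp add: power2_eq_square algebra_simps)
      also have "\<dots> \<le> 1 * 1" using d by (intro mult_mono) (auto simp: power_le_one_iff abs_square_le_1)
      finally show "(1 + d) * (1 - d)^2 \<le> 1" by simp
    qed auto
    finally have sum: "(\<Sum>q\<in>Q. q) \<le> k" by (simp only: of_nat_le_iff mult_1)
    have pos: "(\<Prod>q\<in>Q. q) > 0" using fin by (intro prod_pos) (auto simp: Q_def dest: prime_gt_0_nat)
    have "(1 - e) * s \<le> (1 - 2 * d) * s" using d s by (intro mult_right_mono) auto
    also have "\<dots> \<le> (1 - d/2) * ((1 - d) * s - 1)" using elim by (simp add: s_def)
    also have "\<dots> \<le> (1 - d/2) * real X" using X d by (intro mult_left_mono) auto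
    also have "\<dots> \<le> psi X" using elim by (simp add: X_def)
    also have "\<dots> \<le> ln (real (\<Prod>q\<in>Q. q))"
      using psi_le_ln_prod[of X] elim inj by (simp add: Q_def prod.reindex X_def)
    finally have "exp ((1 - e) * s) \<le> real (\<Prod>q\<in>Q. q)" using pos by (subst ln_ge_iff[symmetric]) (simp_all only: of_nat_0_less_iff)
    moreover have "pairwise coprime Q"
      unfolding pairwise_def Q_def
    proof safe
      fix p q assume pq: "prime p" "prime q" "p ^ max_exp X p \<noteq> q ^ max_exp X q"
      hence "p \<noteq> q" by auto
      hence "coprime p q" using pq by (simp add: primes_coprime)
      thus "coprime (p ^ max_exp X p) (q ^ max_exp X q)" by simp
    qed
    moreover have "0 \<notin> Q" by (auto simp: Q_def dest: prime_gt_0_nat)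
    ultimately show ?case using fin sum by (intro exI[of _ Q]) (auto simp: Q_def s_def)
  qed
qed

text \<open>One cycle for each q, placed on consecutive intervals. The left end of an interval has
  period exactly q, which forces the divisibility.\<close>

lemma cyclic_permutation_exists:
  assumes "finite Q" "0 \<notin> Q"
  shows "\<exists>c. c permutes {..<\<Sum>q\<in>Q. q} \<and> (\<forall>m. (\<forall>i<(\<Sum>q\<in>Q. q). (c ^^ m) i = i) \<longrightarrow> (\<forall>q\<in>Q. q dvd m))"
  using assms
proof (induction Q rule: finite_induct)
  case empty
  thus ?case by (intro exI[of _ id]) (auto simp: permutes_id)
next
  case (insert q Q)
  define s where "s = (\<Sum>q\<in>Q. q)"
  obtain c where c: "c permutes {..<s}" "\<And>m. (\<forall>i<s. (c ^^ m) i = i) \<Longrightarrow> (\<forall>q\<in>Q. q dvd m)"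
    using insert by (auto simp: s_def)
  have q: "q > 0" using insert by (auto intro: Nat.gr0I)
  define r where "r = (\<lambda>i. if i \<in> {s..<s+q} then s + (i - s + 1) mod q else i)"
  have r: "r permutes {s..<s+q}"
  proof (rule bij_imp_permutes)
    have "inj_on r {s..<s+q}"
    proof (rule inj_onI)
      fix i j assume ij: "i \<in> {s..<s+q}" "j \<in> {s..<s+q}" "r i = r j"
      hence "(i - s + 1) mod q = (j - s + 1) mod q" by (simp add: r_def)
      hence "(i - s) mod q = (j - s) mod q" by (simp add: mod_Suc split: if_splits)
      thus "i = j" using ij by auto
    qed
    moreover have "r ` {s..<s+q} \<subseteq> {s..<s+q}" using q by (auto simp: r_def)
    ultimately show "bij_betw r {s..<s+q} {s..<s+q}" by (simp add: bij_betw_def endo_inj_surj)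
  qed (auto simp: r_def)
  define c' where "c' = c \<circ> r"
  have perm: "c' permutes {..<s+q}"
    unfolding c'_def by (intro permutes_compose permutes_subset[OF r] permutes_subset[OF c(1)]) auto
  have lo: "(c' ^^ m) i = (c ^^ m) i" if "i < s" for i m
  proof -
    have "(c' ^^ m) i = (c ^^ m) i \<and> (c ^^ m) i < s"
    proof (induction m)
      case (Suc m)
      have "c ((c ^^ m) i) < s" using permutes_in_image[OF c(1)] Suc by simp
      thus ?case using Suc by (simp add: c'_def r_def)
    qed (use that in auto)
    thus ?thesis by simp
  qed
  have hi: "(c' ^^ m) s = s + m mod q" for m
  proof (induction m)
    case (Suc m)
    have "c' (s + m mod q) = c (s + (m mod q + 1) mod q)" using q by (simp add: c'_def r_def)
    also have "\<dots> = s + (m mod q + 1) mod q" using permutes_not_in[OF c(1)] by simp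
    also have "(m mod q + 1) mod q = Suc m mod q" by (simp add: mod_Suc_eq)
    finally show ?case using Suc by simp
  qed (use q in auto)
  have "\<forall>q'\<in>insert q Q. q' dvd m" if m: "\<forall>i<s+q. (c' ^^ m) i = i" for m
  proof -
    have "\<forall>q'\<in>Q. q' dvd m" using m by (intro c(2)) (simp add: lo[symmetric] trans_less_add1)
    moreover have "(c' ^^ m) s = s" using m q by simp
    hence "q dvd m" using hi by auto
    ultimately show ?thesis by simp
  qed
  moreover have "(\<Sum>q\<in>insert q Q. q) = s + q" using insert by (simp add: s_def)
  ultimately show ?case using perm by (intro exI[of _ c']) auto
qed

lemma prod_pairwise_coprime_dvd:
  fixes Q :: "nat set"
  assumes "finite Q" "pairwise coprime Q" "\<forall>q\<in>Q. q dvd m"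
  shows "(\<Prod>q\<in>Q. q) dvd m"
  using assms
proof (induction Q rule: finite_induct)
  case (insert q Q)
  have "coprime q (\<Prod>q\<in>Q. q)" using insert by (intro prod_coprime_right) (auto simp: pairwise_insert)
  moreover have "(\<Prod>q\<in>Q. q) dvd m" using insert by (auto simp: pairwise_insert)
  ultimately show ?case using insert by (simp add: divides_mult)
qed auto

text \<open>The points beyond the sum of \<open>Q\<close> stay fixed, so the permutation acts on
  exactly k labels. \<open>N\<close> is the product of the cycle lengths.\<close>

theorem eventually_landau_permutation:
  assumes e: "e > 0"
  shows "eventually (\<lambda>k. \<exists>c N. c permutes {..<k} \<and> (\<forall>m. (\<forall>i<k. (c ^^ m) i = i) \<longrightarrow> N dvd m) \<and>
     exp ((1 - e) * sqrt (real k * ln (real k))) \<le> real N) sequentially"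
  using eventually_landau[OF e]
proof eventually_elim
  case (elim k)
  then obtain Q where Q: "finite Q" "0 \<notin> Q" "pairwise coprime Q" "(\<Sum>q\<in>Q. q) \<le> k"
     "exp ((1 - e) * sqrt (real k * ln (real k))) \<le> real (\<Prod>q\<in>Q. q)" by blast
  obtain c where c: "c permutes {..<\<Sum>q\<in>Q. q}" "\<And>m. (\<forall>i<(\<Sum>q\<in>Q. q). (c ^^ m) i = i) \<Longrightarrow> (\<forall>q\<in>Q. q dvd m)"
    using cyclic_permutation_exists[OF Q(1,2)] by auto
  have "c permutes {..<k}" using permutes_subset[OF c(1), of "{..<k}"] Q(4) by auto
  moreover have "(\<Prod>q\<in>Q. q) dvd m" if "\<forall>i<k. (c ^^ m) i = i" for m
    using that Q by (intro prod_pairwise_coprime_dvd c(2)) auto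
  ultimately show ?case using Q(5) by blast
qed

section \<open>A cyclic order of the bit strings of fixed weight\<close>

(* b 1^i 0^j 1 y becomes 1^i 0^j 1 b y (j > 0), and b 1^i 0^j becomes 1^i 0^j b, where 1 stands for P. *)
definition cshift :: "('a \<Rightarrow> bool) \<Rightarrow> 'a list \<Rightarrow> 'a list" where
  "cshift P xs = (case xs of [] \<Rightarrow> [] | b # w \<Rightarrow>
     (case dropWhile (\<lambda>x. \<not> P x) (dropWhile P w) of [] \<Rightarrow> w @ [b]
      | c # y \<Rightarrow> takeWhile P w @ takeWhile (\<lambda>x. \<not> P x) (dropWhile P w) @ c # b # y))"

lemma takeWhile_dropWhile_runs:
  assumes "\<forall>x\<in>set u. P x" "\<forall>x\<in>set v. \<not> P x" "ys = [] \<or> P (hd ys) \<and> v \<noteq> []"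
  shows "takeWhile P (u @ v @ ys) = u" "dropWhile P (u @ v @ ys) = v @ ys"
    "takeWhile (\<lambda>x. \<not> P x) (v @ ys) = v" "dropWhile (\<lambda>x. \<not> P x) (v @ ys) = ys"
proof -
  have 1: "takeWhile P (v @ ys) = []" "dropWhile P (v @ ys) = v @ ys"
    using assms(2,3) by (cases v; cases ys; simp)+
  have 2: "takeWhile (\<lambda>x. \<not> P x) ys = []" "dropWhile (\<lambda>x. \<not> P x) ys = ys"
    using assms(3) by (cases ys; simp)+
  show "takeWhile P (u @ v @ ys) = u" "dropWhile P (u @ v @ ys) = v @ ys"
    using 1 assms(1) by (simp_all add: takeWhile_append2 dropWhile_append2)
  show "takeWhile (\<lambda>x. \<not> P x) (v @ ys) = v" "dropWhile (\<lambda>x. \<not> P x) (v @ ys) = ys"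
    using 2 assms(2) by (simp_all add: takeWhile_append2 dropWhile_append2)
qed

lemma cshift_inner:
  assumes "\<forall>x\<in>set u. P x" "\<forall>x\<in>set v. \<not> P x" "v \<noteq> []" "P c"
  shows "cshift P (b # u @ v @ c # y) = u @ v @ c # b # y"
proof -
  have "[] = c # y \<or> P (hd (c # y)) \<and> v \<noteq> []" using assms by simp
  hence "takeWhile P (u @ v @ c # y) = u" "dropWhile P (u @ v @ c # y) = v @ c # y"
    "takeWhile (\<lambda>x. \<not> P x) (v @ c # y) = v" "dropWhile (\<lambda>x. \<not> P x) (v @ c # y) = c # y"
    using takeWhile_dropWhile_runs[of u P v "c # y"] assms(1,2) by blast+
  thus ?thesis by (simp only: cshift_def list.case)
qed

lemma cshift_outer:
  assumes "\<forall>x\<in>set u. P x" "\<forall>x\<in>set v. \<not> P x"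
  shows "cshift P (b # u @ v) = u @ v @ [b]"
proof -
  have "takeWhile P (u @ v) = u" "dropWhile P (u @ v) = v" "dropWhile (\<lambda>x. \<not> P x) v = []"
    using takeWhile_dropWhile_runs[of u P v "[]"] assms unfolding append_Nil2 by blast+
  thus ?thesis by (simp only: cshift_def list.case append_assoc)
qed

text \<open>The two shapes of the word behind the first letter in the rule. In \<open>inner\<close>
  the block \<open>v\<close> cannot be empty, since \<open>c\<close> would then belong to the run
  \<open>u\<close>.\<close>

lemma runs_cases:
  obtains (outer) u v where "w = u @ v" "\<forall>x\<in>set u. P x" "\<forall>x\<in>set v. \<not> P x"
  | (inner) u v c y where "w = u @ v @ c # y" "\<forall>x\<in>set u. P x" "\<forall>x\<in>set v. \<not> P x" "v \<noteq> []" "P c"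
proof -
  define u r where "u = takeWhile P w" and "r = dropWhile P w"
  define v t where "v = takeWhile (\<lambda>x. \<not> P x) r" and "t = dropWhile (\<lambda>x. \<not> P x) r"
  have w: "w = u @ v @ t" by (simp add: u_def r_def v_def t_def)
  have u: "\<forall>x\<in>set u. P x" and v: "\<forall>x\<in>set v. \<not> P x" by (auto simp: u_def v_def dest: set_takeWhileD)
  show thesis
  proof (cases t)
    case Nil
    thus thesis using outer w u v by simp
  next
    case (Cons c y)
    have "P c" using Cons hd_dropWhile[of "\<lambda>x. \<not> P x" r] by (simp add: t_def)
    moreover have "v \<noteq> []"
    proof
      assume "v = []"
      hence "r = c # y" using Cons by (simp add: v_def t_def) (metis append_Nil takeWhile_dropWhile_id)
      hence "\<not> P c" using hd_dropWhile[of P w] by (simp add: r_def)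
      thus False using \<open>P c\<close> by simp
    qed
    ultimately show thesis using inner w u v Cons by blast
  qed
qed

lemma mset_cshift [simp]: "mset (cshift P xs) = mset xs"
proof (cases xs)
  case (Cons b w)
  show ?thesis by (cases rule: runs_cases[of w P]) (simp_all add: Cons cshift_inner cshift_outer)
qed (simp add: cshift_def)

lemma length_cshift [simp]: "length (cshift P xs) = length xs"
  by (rule mset_eq_length[OF mset_cshift])

text \<open>\<open>cshift\<close> inspects its entries only through \<open>P\<close>. Hence
  occupancy patterns evolve on their own, and relabelling tokens commutes with the shift.\<close>

lemma map_cshift: "map f (cshift (\<lambda>x. P (f x)) xs) = cshift P (map f xs)"
proof (cases xs)
  case (Cons b w)
  show ?thesis
  proof (cases rule: runs_cases[of w "\<lambda>x. P (f x)"])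
    case (outer u v)
    thus ?thesis using cshift_outer[of "map f u" P "map f v" "f b"] cshift_outer[of u "\<lambda>x. P (f x)" v b] by (simp add: Cons)
  next
    case (inner u v c y)
    thus ?thesis using cshift_inner[of "map f u" P "map f v" "f c" "f b"] cshift_inner[of u "\<lambda>x. P (f x)" v c b] by (simp add: Cons)
  qed
qed (simp add: cshift_def)

lemma cshift_snoc_outer:
  assumes "\<forall>x\<in>set u. P x" "\<forall>x\<in>set v. \<not> P x"
  shows "cshift P ((b # u @ v) @ [c]) = u @ v @ [c, b]"
proof (cases "P c")
  case True
  show ?thesis
  proof (cases "v = []")
    case True
    thus ?thesis using cshift_outer[of "u @ [c]" P "[]" b] assms \<open>P c\<close> by simp
  next
    case False
    thus ?thesis using cshift_inner[of u P v c b "[]"] assms \<open>P c\<close> by simp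
  qed
next
  case False
  thus ?thesis using cshift_outer[of u P "v @ [c]" b] assms by simp
qed

lemma cshift_snoc_inner:
  assumes "\<forall>x\<in>set u. P x" "\<forall>x\<in>set v. \<not> P x" "v \<noteq> []" "P d"
  shows "cshift P ((b # u @ v @ d # y) @ [c]) = cshift P (b # u @ v @ d # y) @ [c]"
  using cshift_inner[OF assms, of b "y @ [c]"] cshift_inner[OF assms, of b y] by simp

section \<open>Injectivity of the shift on bit strings\<close>

abbreviation bshift :: "bool list \<Rightarrow> bool list" where "bshift \<equiv> cshift (\<lambda>x. x)"

text \<open>The cool-lex successor itself: the letter after the first prefix 1^i 0^j 1 with j > 0
  moves to the front, and the last letter does if there is none. It is introduced as a left inverse
  of \<open>bshift\<close>.\<close>

definition bunshift :: "bool list \<Rightarrow> bool list" where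
  "bunshift x = (let u = takeWhile (\<lambda>x. x) x; r = dropWhile (\<lambda>x. x) x; v = takeWhile (\<lambda>x. \<not> x) r
     in case dropWhile (\<lambda>x. \<not> x) r of c # b # y \<Rightarrow> b # u @ v @ c # y | _ \<Rightarrow> last x # butlast x)"

lemma bunshift_runs:
  assumes "\<forall>x\<in>set u. x" "\<forall>x\<in>set v. \<not> x" "ys = [] \<or> hd ys \<and> v \<noteq> []"
  shows "bunshift (u @ v @ ys) = (case ys of c # b # y \<Rightarrow> b # u @ v @ c # y | _ \<Rightarrow> last (u @ v @ ys) # butlast (u @ v @ ys))"
  unfolding bunshift_def Let_def takeWhile_dropWhile_runs[where P = "\<lambda>x. x", OF assms] ..

lemma bunshift_bshift: "xs \<noteq> [] \<Longrightarrow> bunshift (bshift xs) = xs"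
proof -
  assume "xs \<noteq> []"
  then obtain b w where xs: "xs = b # w" by (cases xs) auto
  show ?thesis
  proof (cases rule: runs_cases[of w "\<lambda>x. x"])
    case (outer u v)
    have eq: "bshift xs = u @ v @ [b]" unfolding xs outer(1) by (rule cshift_outer[OF outer(2,3)])
    have *: "last (u @ v @ [b]) # butlast (u @ v @ [b]) = xs"
      unfolding append_assoc[symmetric] last_snoc butlast_snoc using outer(1) xs by simp
    \<comment> \<open>The runs of the image depend on the moved bit: it prolongs the ones, starts a
      second block of ones with nothing behind it, or prolongs the zeros. The last letter returns to
      the front in all three cases.\<close>
    consider "b" "v = []" | "b" "v \<noteq> []" | "\<not> b" by blast
    thus ?thesis
    proof cases
      case 1
      have "bunshift ((u @ [b]) @ [] @ []) = last ((u @ [b]) @ [] @ []) # butlast ((u @ [b]) @ [] @ [])"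
        using 1 outer by (subst bunshift_runs) auto
      thus ?thesis using * 1 unfolding eq by simp
    next
      case 2
      have "bunshift (u @ v @ [b]) = last (u @ v @ [b]) # butlast (u @ v @ [b])"
        using 2 outer by (subst bunshift_runs) auto
      thus ?thesis using * unfolding eq by simp
    next
      case 3
      have "bunshift (u @ (v @ [b]) @ []) = last (u @ (v @ [b]) @ []) # butlast (u @ (v @ [b]) @ [])"
        using 3 outer by (subst bunshift_runs) auto
      thus ?thesis using * unfolding eq by simp
    qed
  next
    case (inner u v c y)
    have "bshift xs = u @ v @ c # b # y" unfolding xs inner(1) by (rule cshift_inner[OF inner(2-5)])
    also have "bunshift \<dots> = b # u @ v @ c # y" using inner by (subst bunshift_runs) auto
    finally show ?thesis using xs inner(1) by simp
  qed
qed

lemma inj_bshift: "inj bshift"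
proof (rule injI)
  fix x y assume eq: "bshift x = bshift y"
  show "x = y"
  proof (cases "x = [] \<or> y = []")
    case True
    thus ?thesis using eq length_cshift[of "\<lambda>x. x" x] length_cshift[of "\<lambda>x. x" y] by auto
  next
    case False
    thus ?thesis using eq bunshift_bshift by metis
  qed
qed

text \<open>The sorted word 1^i 0^j, a base point at which all words of the same length and weight
  are shown to meet.\<close>

definition canon :: "bool list \<Rightarrow> bool list" where
  "canon x = filter (\<lambda>b. b) x @ filter (\<lambda>b. \<not> b) x"

lemma filter_bool_mset_cong:
  assumes "mset x = mset y"
  shows "filter (\<lambda>b. b) x = filter (\<lambda>b. b) y" "filter (\<lambda>b. \<not> b) x = filter (\<lambda>b. \<not> b) y"
proof -
  have 1: "filter (\<lambda>b. b) z = replicate (count (mset z) True) True"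
    and 2: "filter (\<lambda>b. \<not> b) z = replicate (count (mset z) False) False" for z
    by (induction z) auto
  show "filter (\<lambda>b. b) x = filter (\<lambda>b. b) y" "filter (\<lambda>b. \<not> b) x = filter (\<lambda>b. \<not> b) y"
    unfolding 1 2 by (simp_all add: assms)
qed

lemma canon_mset_cong: "mset x = mset y \<Longrightarrow> canon x = canon y"
  unfolding canon_def using filter_bool_mset_cong[of x y] by simp

lemma mset_funpow_cshift [simp]: "mset ((cshift P ^^ m) x) = mset x"
  by (induction m) auto

lemma runs_eq_canon:
  assumes "\<forall>x\<in>set u. x" "\<forall>x\<in>set v. \<not> x"
  shows "canon (u @ v) = u @ v"
  using assms by (simp add: canon_def filter_id_conv filter_empty_conv)

text \<open>An iterate of the form b 1^i 0^j with b = 1 would already be \<open>canon z\<close>. So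
  before that point b = 0 whenever this form occurs; exchanging b with the appended 0 changes
  nothing, and the 0 stays at the end.\<close>

lemma bshift_snoc_False_reach:
  assumes "(bshift ^^ m) z = canon z" "\<And>i. i < m \<Longrightarrow> (bshift ^^ i) z \<noteq> canon z"
  shows "(bshift ^^ m) (z @ [False]) = canon (z @ [False])"
proof -
  have "(bshift ^^ i) (z @ [False]) = (bshift ^^ i) z @ [False]" if "i \<le> m" for i
    using that
  proof (induction i)
    case (Suc i)
    define y where "y = (bshift ^^ i) z"
    have my: "mset y = mset z" by (simp add: y_def)
    have ny: "y \<noteq> canon z" using assms(2)[of i] Suc.prems by (simp add: y_def)
    have "bshift (y @ [False]) = bshift y @ [False]"
    proof (cases y)
      case Nil
      thus ?thesis using cshift_outer[of "[]" "\<lambda>x. x" "[]" False] by (simp add: cshift_def)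
    next
      case (Cons b w)
      show ?thesis
      proof (cases rule: runs_cases[of w "\<lambda>x. x"])
        case (outer u v)
        have "\<not> b"
        proof
          assume b
          hence "canon y = y" using runs_eq_canon[of "b # u" v] outer Cons by simp
          thus False using ny canon_mset_cong[OF my] by simp
        qed
        thus ?thesis using cshift_snoc_outer[of u "\<lambda>x. x" v b False] cshift_outer[of u "\<lambda>x. x" v b] outer Cons by simp
      next
        case (inner u v d r)
        thus ?thesis using cshift_snoc_inner[of u "\<lambda>x. x" v d b r False] Cons by simp
      qed
    qed
    thus ?case using Suc by (simp add: y_def)
  qed auto
  from this[of m] assms(1) show ?thesis by (simp add: canon_def)
qed

(* Induction on the length: bshift commutes with appending a last bit c except at the words b 1^i 0^j with
   b different from c. There it joins the cycle of the words ending in 1 with that of the words ending in 0. *)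
lemma bshift_reaches_canon: "\<exists>m. (bshift ^^ m) x = canon x"
proof (induction "length x" arbitrary: x)
  case 0
  thus ?case by (intro exI[of _ 0]) (simp add: canon_def)
next
  case (Suc n)
  have snoc_False: "\<exists>m. (bshift ^^ m) (z @ [False]) = canon (z @ [False])" if "length z = n" for z
  proof -
    have "\<exists>m. (bshift ^^ m) z = canon z" using Suc(1)[of z] that by simp
    then obtain m where "(bshift ^^ m) z = canon z" "\<And>i. i < m \<Longrightarrow> (bshift ^^ i) z \<noteq> canon z"
      using exists_least_iff[of "\<lambda>m. (bshift ^^ m) z = canon z"] by auto
    thus ?thesis using bshift_snoc_False_reach by blast
  qed
  obtain z c where x: "x = z @ [c]" using Suc(2) by (cases x rule: rev_exhaust) auto
  have z: "length z = n" using Suc(2) x by simp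
  show ?case
  proof (cases c)
    case False
    thus ?thesis using snoc_False[OF z] x by simp
  next
    case c: True
    show ?thesis
    proof (cases "filter (\<lambda>b. \<not> b) z")
      case Nil
      hence "filter (\<lambda>b. b) z = z" by (auto simp: filter_empty_conv filter_id_conv)
      thus ?thesis using Nil x c by (intro exI[of _ 0]) (simp add: canon_def)
    next
      case (Cons f fs)
      \<comment> \<open>The word 0 1^i 0^(j-1), the predecessor of \<open>canon z\<close>. It is the
        only word of this weight at which an appended 1 does not stay at the end.\<close>
      define pr where "pr = False # filter (\<lambda>b. b) z @ fs"
      have "\<forall>x\<in>set (f # fs). \<not> x" unfolding Cons[symmetric] by simp
      hence f: "\<not> f" and fs: "\<forall>x\<in>set fs. \<not> x" by (meson list.set_intros)+
      have runs: "\<forall>x\<in>set (filter (\<lambda>b. b) z). x" by auto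
      have fsF: "fs @ [False] = f # fs"
        using fs f by (induction fs) auto
      have Tpr: "bshift pr = canon z"
        unfolding pr_def cshift_outer[OF runs fs] using Cons fsF by (simp add: canon_def)
      \<comment> \<open>Starting from \<open>bshift z\<close> makes the number of steps from z to
        \<open>canon z\<close> positive, so that the last one can be cancelled by
        injectivity.\<close>
      obtain m0 where "(bshift ^^ m0) (bshift z) = canon (bshift z)"
        using Suc(1)[of "bshift z"] z by auto
      hence "bshift ((bshift ^^ m0) z) = bshift pr"
        using Tpr canon_mset_cong[of "bshift z" z] by (simp add: funpow_swap1)
      hence "(bshift ^^ m0) z = pr" using inj_bshift by (simp add: inj_eq)
      then obtain m where m: "(bshift ^^ m) z = pr" "\<And>i. i < m \<Longrightarrow> (bshift ^^ i) z \<noteq> pr"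
        using exists_least_iff[of "\<lambda>m. (bshift ^^ m) z = pr"] by auto
      have "(bshift ^^ i) (z @ [True]) = (bshift ^^ i) z @ [True]" if "i \<le> m" for i
        using that
      proof (induction i)
        case (Suc i)
        define y where "y = (bshift ^^ i) z"
        have my: "mset y = mset z" by (simp add: y_def)
        have ny: "y \<noteq> pr" using m(2)[of i] Suc.prems by (simp add: y_def)
        have "y \<noteq> []" using my Cons by auto
        then obtain b w where y: "y = b # w" by (cases y) auto
        have "bshift (y @ [True]) = bshift y @ [True]"
        proof (cases rule: runs_cases[of w "\<lambda>x. x"])
          case (outer u v)
          have b
          proof (rule ccontr)
            assume nb: "\<not> b"
            have "filter (\<lambda>b. b) z = u"
              using filter_bool_mset_cong(1)[OF my] outer nb y by (simp add: filter_id_conv filter_empty_conv)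
            moreover have "f # fs = False # v"
              using filter_bool_mset_cong(2)[OF my] outer nb y Cons by (simp add: filter_id_conv filter_empty_conv)
            ultimately have "y = pr" using y outer nb by (simp add: pr_def)
            thus False using ny by simp
          qed
          thus ?thesis using cshift_snoc_outer[of u "\<lambda>x. x" v b True] cshift_outer[of u "\<lambda>x. x" v b] outer y by simp
        next
          case (inner u v d r)
          thus ?thesis using cshift_snoc_inner[of u "\<lambda>x. x" v d b r True] y by simp
        qed
        thus ?case using Suc by (simp add: y_def)
      qed auto
      \<comment> \<open>At \<open>pr\<close> the appended 1 overtakes the leading 0. The word now
        ends in 0, and \<open>snoc_False\<close> finishes.\<close>
      from this[of m] m(1) have "(bshift ^^ Suc m) x = bshift (pr @ [True])" using x c by simp
      also have "\<dots> = (filter (\<lambda>b. b) z @ fs @ [True]) @ [False]"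
        unfolding pr_def cshift_snoc_outer[OF runs fs] by simp
      finally have 1: "(bshift ^^ Suc m) x = (filter (\<lambda>b. b) z @ fs @ [True]) @ [False]" .
      have mx: "mset ((filter (\<lambda>b. b) z @ fs @ [True]) @ [False]) = mset x"
        unfolding 1[symmetric] by (rule mset_funpow_cshift)
      hence "length (filter (\<lambda>b. b) z @ fs @ [True]) = n"
        using mset_eq_length[OF mx] x z by simp
      then obtain m2 where "(bshift ^^ m2) ((filter (\<lambda>b. b) z @ fs @ [True]) @ [False]) = canon x"
        using snoc_False canon_mset_cong[OF mx] by metis
      hence "(bshift ^^ m2) ((bshift ^^ Suc m) x) = canon x" unfolding 1 .
      hence "(bshift ^^ (m2 + Suc m)) x = canon x" unfolding funpow_add o_apply .
      thus ?thesis by blast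
    qed
  qed
qed

text \<open>An injective map on a finite set for which every orbit meets \<open>c\<close> is a
  single cycle, whose length is the number of elements.\<close>

lemma single_cycle_period:
  assumes fin: "finite X" and inj: "inj f" and closed: "f ` X \<subseteq> X" and c: "c \<in> X"
    and reach: "\<And>x. x \<in> X \<Longrightarrow> \<exists>m. (f ^^ m) x = c"
  shows "(f ^^ M) c = c \<longleftrightarrow> card X dvd M"
proof -
  have inX: "(f ^^ i) x \<in> X" if "x \<in> X" for i x using closed that by (induction i) auto
  obtain m where "(f ^^ m) (f c) = c" using reach[of "f c"] closed c by auto
  hence "(f ^^ Suc m) c = c" by (simp add: funpow_swap1)
  hence "\<exists>p. p > 0 \<and> (f ^^ p) c = c" by blast
  then obtain p where p: "p > 0" "(f ^^ p) c = c" "\<And>i. i < p \<Longrightarrow> i > 0 \<Longrightarrow> (f ^^ i) c \<noteq> c"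
    using exists_least_iff[of "\<lambda>p. p > 0 \<and> (f ^^ p) c = c"] by auto
  have inj_on: "inj_on (\<lambda>i. (f ^^ i) c) {..<p}"
  proof (rule linorder_inj_onI)
    fix i j assume ij: "i < j" "i \<in> {..<p}" "j \<in> {..<p}"
    show "(f ^^ i) c \<noteq> (f ^^ j) c"
    proof
      assume "(f ^^ i) c = (f ^^ j) c"
      also have "(f ^^ j) c = (f ^^ i) ((f ^^ (j - i)) c)" using ij by (simp add: funpow_add[symmetric, THEN fun_cong, unfolded o_def])
      finally have "(f ^^ (j - i)) c = c" using inj_fn[OF inj, of i] by (simp add: inj_eq)
      moreover have "j - i < p" "j - i > 0" using ij by auto
      ultimately show False using p(3) by blast
    qed
  qed auto
  have "(\<lambda>i. (f ^^ i) c) ` {..<p} = X"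
  proof (intro equalityI subsetI)
    fix x assume x: "x \<in> X"
    obtain m where m: "(f ^^ m) x = c" using reach[OF x] by blast
    \<comment> \<open>Tops m up to the multiple p * m of the period. Then \<open>(f ^^ j) c\<close>
      and x have the same m-th iterate c, so they agree.\<close>
    define j where "j = p * m - m"
    have jm: "m + j = p * m" using p(1) by (simp add: j_def)
    have "(f ^^ m) ((f ^^ j) c) = (f ^^ (p * m)) c" unfolding jm[symmetric] by (simp add: funpow_add)
    also have "\<dots> = c" using funpow_mod_eq[OF p(2), of "p * m"] by simp
    finally have "(f ^^ j) c = x" using m inj_fn[OF inj, of m] by (metis inj_eq)
    hence "(f ^^ (j mod p)) c = x" using funpow_mod_eq[OF p(2)] by simp
    thus "x \<in> (\<lambda>i. (f ^^ i) c) ` {..<p}" using p(1) by (intro image_eqI[of _ _ "j mod p"]) auto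
  qed (use inX c in auto)
  hence card: "card X = p" using card_image[OF inj_on] by simp
  have "(f ^^ M) c = c \<longleftrightarrow> (f ^^ (M mod p)) c = c" using funpow_mod_eq[OF p(2)] by simp
  also have "\<dots> \<longleftrightarrow> M mod p = 0" using p(1) p(3)[of "M mod p"] by auto
  finally show ?thesis using card by (simp add: dvd_eq_mod_eq_0)
qed

lemma card_bool_lists:
  "finite {x :: bool list. length x = n \<and> length (filter (\<lambda>b. b) x) = k}"
  "card {x :: bool list. length x = n \<and> length (filter (\<lambda>b. b) x) = k} = n choose k"
proof -
  let ?X = "{x :: bool list. length x = n \<and> length (filter (\<lambda>b. b) x) = k}"
  have bij: "bij_betw (\<lambda>x. {i. i < n \<and> x ! i}) ?X {B. B \<subseteq> {..<n} \<and> card B = k}"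
  proof (rule bij_betwI[where g = "\<lambda>B. map (\<lambda>i. i \<in> B) [0..<n]"])
    show "(\<lambda>x. {i. i < n \<and> x ! i}) \<in> ?X \<rightarrow> {B. B \<subseteq> {..<n} \<and> card B = k}"
      by (auto simp: length_filter_conv_card)
    show "(\<lambda>B. map (\<lambda>i. i \<in> B) [0..<n]) \<in> {B. B \<subseteq> {..<n} \<and> card B = k} \<rightarrow> ?X"
    proof
      fix B assume B: "B \<in> {B. B \<subseteq> {..<n} \<and> card B = k}"
      hence "{i. i < n \<and> i \<in> B} = B" by auto
      thus "map (\<lambda>i. i \<in> B) [0..<n] \<in> ?X" using B by (auto simp: length_filter_conv_card cong: conj_cong)
    qed
  qed (auto intro!: nth_equalityI)
  have "finite {B. B \<subseteq> {..<n} \<and> card B = k}" by (rule finite_subset[of _ "Pow {..<n}"]) auto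
  thus "finite ?X" using bij_betw_finite[OF bij] by simp
  show "card ?X = n choose k" using bij_betw_same_card[OF bij] n_subsets[of "{..<n}" k] by simp
qed

lemma bshift_period:
  "(bshift ^^ M) (replicate k True @ replicate l False) = replicate k True @ replicate l False \<longleftrightarrow> (k + l choose k) dvd M"
proof -
  let ?X = "{x :: bool list. length x = k + l \<and> length (filter (\<lambda>b. b) x) = k}"
  have "(bshift ^^ M) (replicate k True @ replicate l False) = replicate k True @ replicate l False \<longleftrightarrow> card ?X dvd M"
  proof (rule single_cycle_period[OF _ inj_bshift])
    show "bshift ` ?X \<subseteq> ?X"
      using filter_bool_mset_cong(1)[OF mset_cshift[of "\<lambda>x. x"]] by auto
    fix x assume "x \<in> ?X"
    hence x: "length x = k + l" "length (filter (\<lambda>b. b) x) = k" by auto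
    have 1: "filter (\<lambda>b. b) z = replicate (length (filter (\<lambda>b. b) z)) True"
      and 2: "filter (\<lambda>b. \<not> b) z = replicate (length (filter (\<lambda>b. \<not> b) z)) False" for z
      by (induction z) auto
    have "length (filter (\<lambda>b. \<not> b) x) = l" using sum_length_filter_compl[of "\<lambda>b. b" x] x by simp
    hence "canon x = replicate k True @ replicate l False" using 1[of x] 2[of x] x by (simp add: canon_def)
    thus "\<exists>m. (bshift ^^ m) x = replicate k True @ replicate l False" using bshift_reaches_canon[of x] by simp
  qed (use card_bool_lists(1) in auto)
  thus ?thesis using card_bool_lists(2) by simp
qed

section \<open>The sweeping automaton\<close>

datatype move = Tau | Sig | SigH
(* Mv p p' g m leads from phase p to phase p' and applies the cell permutation m; g is its guess whether the
   cell that m moves to the end of the ring is occupied, and that cell is chk m. *)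
datatype letter = Mv nat nat bool move | Home | CarO | CarZ
(* D: cells of the ring. OL, OH: low and high hand of the counter of the guesses "occupied"; ZL, ZH: the
   same for the guesses "empty". Ph: phase of the sweep. *)
datatype st = D nat | OL nat | OH nat | ZL nat | ZH nat | Ph nat

(* The list holds the token in each cell, the numbers are the positions of the four hands and the phase. *)
type_synonym config = "nat option list \<times> nat \<times> nat \<times> nat \<times> nat \<times> nat"

fun chk :: "move \<Rightarrow> nat" where "chk Tau = 1" | "chk Sig = 0" | "chk SigH = 0"

locale sweep_machine =
  fixes a k N :: nat and H :: "nat \<Rightarrow> nat"
  assumes a: "a \<ge> 2" and k_def: "k = a * a" and N_def: "N = 2 * k" and H: "H permutes {..<k}"
begin

lemma k_ge: "k \<ge> 4" using mult_le_mono[OF a a] by (simp add: k_def)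

lemma N_ge: "N \<ge> 8" using k_ge by (simp add: N_def)

lemma k_le_N: "k \<le> N" by (simp add: N_def)

lemma H_N: "H permutes {..<N}" by (rule permutes_subset[OF H]) (use k_le_N in auto)

lemma inv_H_less: "j < N \<Longrightarrow> inv H j < N"
  using permutes_in_image[OF permutes_inv[OF H_N], of j] by simp

text \<open>\<open>posn m j\<close> is the cell to which the content of cell j goes, and
  \<open>act m\<close> is the same move on lists. \<open>permute_list H\<close> fetches entry j from
  place H j, hence \<open>inv H\<close> here.\<close>

fun posn :: "move \<Rightarrow> nat \<Rightarrow> nat" where
  "posn Tau j = (if j = 0 then 0 else if j = 1 then N - 1 else j - 1)"
| "posn Sig j = (if j = 0 then N - 1 else j - 1)"
| "posn SigH j = inv H (if j = 0 then N - 1 else j - 1)"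

fun act :: "move \<Rightarrow> 'b list \<Rightarrow> 'b list" where
  "act Tau xs = hd xs # rotate1 (tl xs)"
| "act Sig xs = rotate1 xs"
| "act SigH xs = permute_list H (rotate1 xs)"

lemma posn_less: "j < N \<Longrightarrow> posn m j < N"
proof -
  assume "j < N"
  moreover from this have "(if j = 0 then N - 1 else j - 1) < N" using N_ge by auto
  ultimately show ?thesis using inv_H_less by (cases m) auto
qed

lemma posn_inj:
  assumes "i < N" "j < N" "posn m i = posn m j" shows "i = j"
proof -
  have rot: "i = j" if "(if i = 0 then N - 1 else i - 1) = (if j = 0 then N - 1 else j - 1)"
    using that assms(1,2) by (cases "i = 0"; cases "j = 0") simp_all
  show ?thesis
  proof (cases m)
    case SigH
    have "(if i = 0 then N - 1 else i - 1) = (if j = 0 then N - 1 else j - 1)"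
      using assms(3) SigH permutes_inj[OF permutes_inv[OF H_N]] by (simp only: posn.simps inj_eq)
    thus ?thesis by (rule rot)
  next
    case Sig
    thus ?thesis using rot assms(3) by (simp only: posn.simps)
  next
    case Tau
    thus ?thesis using assms by (cases "i = 0"; cases "j = 0"; cases "i = 1"; cases "j = 1") simp_all
  qed
qed

lemma posn_surj:
  assumes "j < N" obtains i where "i < N" "posn m i = j"
proof -
  have "inj_on (posn m) {..<N}" by (rule inj_onI) (rule posn_inj, simp_all only: lessThan_iff)
  moreover have "posn m ` {..<N} \<subseteq> {..<N}" using posn_less by blast
  ultimately have "posn m ` {..<N} = {..<N}" by (intro endo_inj_surj) auto
  hence "j \<in> posn m ` {..<N}" using assms by simp
  thus thesis using that by blast
qed

lemma length_act: "length xs = N \<Longrightarrow> length (act m xs) = N"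
  using N_ge by (cases m) auto

lemma act_nth: "length xs = N \<Longrightarrow> j < N \<Longrightarrow> act m xs ! posn m j = xs ! j"
proof -
  assume xs: "length xs = N" and j: "j < N"
  have rot: "rotate1 xs ! (if j = 0 then N - 1 else j - 1) = xs ! j"
    using xs j N_ge by (auto simp: nth_rotate1)
  show ?thesis
  proof (cases m)
    case Tau
    obtain x ys where xy: "xs = x # ys" using xs N_ge by (cases xs) auto
    hence ys: "length ys = N - 1" using xs by simp
    consider "j = 0" | "j = 1" | i where "j = Suc (Suc i)" by (metis not0_implies_Suc One_nat_def)
    thus ?thesis
    proof cases
      case 2
      have N1: "N - 1 = Suc (N - 2)" using N_ge by simp
      have "rotate1 ys ! (N - 2) = ys ! (Suc (N - 2) mod length ys)" using ys N_ge by (intro nth_rotate1) simp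
      also have "Suc (N - 2) mod length ys = 0" unfolding ys N1 by simp
      finally have "rotate1 ys ! (N - 2) = ys ! 0" .
      moreover note N1
      ultimately show ?thesis using 2 xy Tau by simp
    next
      case (3 i)
      have "rotate1 ys ! i = ys ! Suc i" using ys j 3 by (simp add: nth_rotate1)
      thus ?thesis using 3 xy Tau by simp
    qed (use xy Tau in simp)
  next
    case Sig thus ?thesis using rot by simp
  next
    case SigH
    define i where "i = (if j = 0 then N - 1 else j - 1)"
    have i: "i < N" using j N_ge by (auto simp: i_def)
    have "permute_list H (rotate1 xs) ! (inv H i) = rotate1 xs ! (H (inv H i))"
      using xs i inv_H_less[OF i] H_N by (intro permute_list_nth) auto
    also have "H (inv H i) = i" using permutes_inverses(1)[OF H_N] .
    finally show ?thesis using rot SigH by (simp add: i_def)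
  qed
qed

text \<open>A full count is low hand 0 and high hand a, worth a * a = k, and \<open>Home\<close> is
  undefined on the hands otherwise. A low hand at a blocks further guesses of its kind until
  \<open>CarO\<close> or \<open>CarZ\<close> carries.\<close>

fun tr :: "letter \<Rightarrow> st \<Rightarrow> st option" where
  "tr (Mv p p' g m) (D j) = (if j < N \<and> (g \<or> j \<noteq> chk m) then Some (D (posn m j)) else None)"
| "tr (Mv p p' g m) (OL i) = (if g then (if i < a then Some (OL (i+1)) else None) else Some (OL i))"
| "tr (Mv p p' g m) (ZL i) = (if g then Some (ZL i) else (if i < a then Some (ZL (i+1)) else None))"
| "tr (Mv p p' g m) (OH i) = Some (OH i)"
| "tr (Mv p p' g m) (ZH i) = Some (ZH i)"
| "tr (Mv p p' g m) (Ph q) = (if q = p then Some (Ph p') else None)"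
| "tr Home (D j) = Some (D j)"
| "tr Home (OL i) = (if i = 0 then Some (OL 0) else None)"
| "tr Home (ZL i) = (if i = 0 then Some (ZL 0) else None)"
| "tr Home (OH i) = (if i = a then Some (OH 0) else None)"
| "tr Home (ZH i) = (if i = a then Some (ZH 0) else None)"
| "tr Home (Ph q) = (if q = 3 \<or> q = 4 then Some (Ph 0) else None)"
| "tr CarO (OL i) = (if i = a then Some (OL 0) else None)"
| "tr CarO (OH i) = (if i < a then Some (OH (i+1)) else None)"
| "tr CarO s = Some s"
| "tr CarZ (ZL i) = (if i = a then Some (ZL 0) else None)"
| "tr CarZ (ZH i) = (if i < a then Some (ZH (i+1)) else None)"
| "tr CarZ s = Some s"

(* Tau keeps the first bit b in cell 0, so that it is put back only when a later letter applies Sig. Phase 0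
   reads the block of ones, phase 1 the block of zeros, phase 2 follows the one after it, phase 3 moves b and
   the rest, and phase 4 is the end of a sweep without a further one. Only SigH moves tokens by H. *)
definition alphabet :: "letter list" where
  "alphabet = [Mv 0 0 True Tau, Mv 0 1 False Tau, Mv 1 1 False Tau, Mv 1 2 True Tau,
     Mv 2 3 False Sig, Mv 2 3 True Sig, Mv 3 3 False Sig, Mv 3 3 True Sig,
     Mv 1 4 False SigH, Mv 1 4 True Sig, Home, CarO, CarZ]"

definition states :: "st set" where
  "states = D ` {..<N} \<union> OL ` {..a} \<union> OH ` {..a} \<union> ZL ` {..a} \<union> ZH ` {..a} \<union> Ph ` {..<5}"

text \<open>The states whose images are followed: one for each label, at its initial cell, and the
  initial position of each control component. The machine has one global configuration only as long
  as a word is defined on all of them.\<close>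

definition tokens :: "st set" where
  "tokens = D ` {..<k} \<union> {OL 0, OH 0, ZL 0, ZH 0, Ph 0}"

lemma finite_states: "finite states" by (simp add: states_def)

lemma card_states: "card states \<le> 2 * a^2 + 4 * a + 9"
proof -
  have "card states \<le> card (D ` {..<N}) + card (OL ` {..a}) + card (OH ` {..a}) + card (ZL ` {..a}) + card (ZH ` {..a}) + card (Ph ` {..<5::nat})"
    unfolding states_def by (intro order.trans[OF card_Un_le] add_mono order_refl)
  also have "\<dots> \<le> N + (a+1) + (a+1) + (a+1) + (a+1) + 5"
    by (intro add_mono order.trans[OF card_image_le]) auto
  finally show ?thesis by (simp add: power2_eq_square N_def k_def)
qed

lemma tokens_states: "tokens \<subseteq> states" unfolding tokens_def states_def using k_le_N by auto

lemma tr_states: "l \<in> set alphabet \<Longrightarrow> s \<in> states \<Longrightarrow> tr l s = Some t \<Longrightarrow> t \<in> states"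
proof -
  assume l: "l \<in> set alphabet" and s: "s \<in> states" and t: "tr l s = Some t"
  note posn_less
  thus ?thesis using l s t by (auto simp: alphabet_def states_def split: if_splits simp del: posn.simps)
qed

section \<open>Simulation of state transformations by configurations\<close>

primrec run :: "letter list \<Rightarrow> st \<Rightarrow> st option" where
  "run [] s = Some s"
| "run (l # w) s = Option.bind (tr l s) (run w)"

fun cstep :: "letter \<Rightarrow> config \<Rightarrow> config option" where
  "cstep (Mv p p' g m) (xs, ol, oh, zl, zh, ph) =
     (if ph = p \<and> (g \<or> xs ! chk m = None) \<and> (if g then ol < a else zl < a)
      then Some (act m xs, (if g then ol + 1 else ol), oh, (if g then zl else zl + 1), zh, p') else None)"
| "cstep Home (xs, ol, oh, zl, zh, ph) =
     (if (ph = 3 \<or> ph = 4) \<and> ol = 0 \<and> oh = a \<and> zl = 0 \<and> zh = a then Some (xs, 0, 0, 0, 0, 0) else None)"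
| "cstep CarO (xs, ol, oh, zl, zh, ph) = (if ol = a \<and> oh < a then Some (xs, 0, oh + 1, zl, zh, ph) else None)"
| "cstep CarZ (xs, ol, oh, zl, zh, ph) = (if zl = a \<and> zh < a then Some (xs, ol, oh, 0, zh + 1, ph) else None)"

primrec crun :: "letter list \<Rightarrow> config \<Rightarrow> config option" where
  "crun [] C = Some C"
| "crun (l # w) C = Option.bind (cstep l C) (crun w)"

text \<open>\<open>C\<close> is the picture of the transformation \<open>f\<close> on the tokens.
  Arbitrary \<open>f\<close> instead of \<open>run w\<close> lets an induction over words append
  letters to it. The last equivalence makes the list a function of \<open>f\<close> and forbids two
  labels in one cell.\<close>

fun tracks :: "(st \<Rightarrow> st option) \<Rightarrow> config \<Rightarrow> bool" where
  "tracks f (xs, ol, oh, zl, zh, ph) \<longleftrightarrow>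
     f (OL 0) = Some (OL ol) \<and> f (OH 0) = Some (OH oh) \<and> f (ZL 0) = Some (ZL zl) \<and> f (ZH 0) = Some (ZH zh) \<and> f (Ph 0) = Some (Ph ph) \<and>
     length xs = N \<and> (\<forall>i<k. \<exists>j<N. f (D i) = Some (D j)) \<and>
     (\<forall>i j. j < N \<longrightarrow> (xs ! j = Some i \<longleftrightarrow> i < k \<and> f (D i) = Some (D j)))"

lemma tracks_unique: "tracks f C \<Longrightarrow> tracks f' C' \<Longrightarrow> (\<And>s. s \<in> tokens \<Longrightarrow> f s = f' s) \<Longrightarrow> C = C'"
proof -
  assume C: "tracks f C" and C': "tracks f' C'" and eq: "\<And>s. s \<in> tokens \<Longrightarrow> f s = f' s"
  obtain xs ol oh zl zh ph where Cd: "C = (xs, ol, oh, zl, zh, ph)" by (cases C) auto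
  obtain xs' ol' oh' zl' zh' ph' where Cd': "C' = (xs', ol', oh', zl', zh', ph')" by (cases C') auto
  have eqs: "f (OL 0) = f' (OL 0)" "f (OH 0) = f' (OH 0)" "f (ZL 0) = f' (ZL 0)" "f (ZH 0) = f' (ZH 0)" "f (Ph 0) = f' (Ph 0)"
    by (rule eq, simp add: tokens_def)+
  have eqD: "f (D i) = f' (D i)" if "i < k" for i using that by (intro eq) (simp add: tokens_def)
  have "xs = xs'"
  proof (rule nth_equalityI)
    fix j assume "j < length xs"
    hence j: "j < N" using C Cd by simp
    have 1: "xs ! j = Some i \<longleftrightarrow> i < k \<and> f (D i) = Some (D j)" for i using C Cd j by simp
    have 2: "xs' ! j = Some i \<longleftrightarrow> i < k \<and> f' (D i) = Some (D j)" for i using C' Cd' j by simp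
    have "xs ! j = Some i \<longleftrightarrow> xs' ! j = Some i" for i unfolding 1 2 using eqD by auto
    thus "xs ! j = xs' ! j" by (metis option.exhaust)
  qed (use C C' Cd Cd' in simp)
  thus ?thesis using C C' eqs unfolding Cd Cd' by simp
qed

text \<open>Both directions of the simulation: a failing configuration step is witnessed by a token
  that dies, and a successful one keeps every token alive.\<close>

lemma tracks_step:
  assumes f: "tracks f C"
  shows "case cstep l C of None \<Rightarrow> \<exists>s\<in>tokens. Option.bind (f s) (tr l) = None
    | Some C' \<Rightarrow> tracks (\<lambda>s. Option.bind (f s) (tr l)) C'"
proof -
  obtain xs ol oh zl zh ph where C: "C = (xs, ol, oh, zl, zh, ph)" by (cases C) auto
  have tok: "OL 0 \<in> tokens" "OH 0 \<in> tokens" "ZL 0 \<in> tokens" "ZH 0 \<in> tokens" "Ph 0 \<in> tokens" "\<And>i. i < k \<Longrightarrow> D i \<in> tokens"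
    by (auto simp: tokens_def)
  note f' = f[unfolded C tracks.simps]
  have ctrl: "f (OL 0) = Some (OL ol)" "f (OH 0) = Some (OH oh)" "f (ZL 0) = Some (ZL zl)" "f (ZH 0) = Some (ZH zh)" "f (Ph 0) = Some (Ph ph)"
    using f' by blast+
  show ?thesis
  proof (cases l)
    case (Mv p p' g m)
    have chk: "chk m < N" using N_ge by (cases m) auto
    show ?thesis
    proof (cases "ph = p \<and> (g \<or> xs ! chk m = None) \<and> (if g then ol < a else zl < a)")
      case False
      then consider "ph \<noteq> p" | i where "\<not> g" "xs ! chk m = Some i" | "g" "\<not> ol < a" | "\<not> g" "\<not> zl < a"
        by (auto split: if_splits)
      hence "\<exists>s\<in>tokens. Option.bind (f s) (tr l) = None"
      proof cases
        case 1
        thus ?thesis using f' Mv by (intro bexI[OF _ tok(5)]) simp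
      next
        case (2 i)
        hence "i < k" "f (D i) = Some (D (chk m))" using f' chk by blast+
        thus ?thesis using 2 Mv by (intro bexI[OF _ tok(6)]) simp_all
      next
        case 3
        thus ?thesis using f' Mv by (intro bexI[OF _ tok(1)]) simp
      next
        case 4
        thus ?thesis using f' Mv by (intro bexI[OF _ tok(3)]) simp
      qed
      moreover have "cstep l C = None" using False Mv C by simp
      ultimately show ?thesis by simp
    next
      case True
      let ?h = "\<lambda>s. Option.bind (f s) (tr l)"
      have chk_free: "g \<or> j \<noteq> chk m" if "i < k" "f (D i) = Some (D j)" for i j
      proof (rule ccontr)
        assume "\<not> ?thesis"
        hence "\<not> g" "j = chk m" by auto
        hence "xs ! chk m = Some i" using f' that chk by blast
        thus False using True \<open>\<not> g\<close> by simp
      qed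
      have hD: "?h (D i) = Some (D (posn m j))" if "i < k" "f (D i) = Some (D j)" "j < N" for i j
        using that chk_free[OF that(1,2)] Mv by simp
      have "\<exists>j<N. ?h (D i) = Some (D j)" if i: "i < k" for i
      proof -
        obtain j where "j < N" "f (D i) = Some (D j)" using f' i by blast
        thus ?thesis using hD[OF i] posn_less by blast
      qed
      moreover have "act m xs ! j = Some i \<longleftrightarrow> i < k \<and> ?h (D i) = Some (D j)" if j: "j < N" for i j
      proof -
        obtain j0 where j0: "j0 < N" "posn m j0 = j" using posn_surj[OF j] by metis
        have "act m xs ! j = xs ! j0" using act_nth[of xs j0 m] f' j0 by simp
        hence "act m xs ! j = Some i \<longleftrightarrow> i < k \<and> f (D i) = Some (D j0)" using f' j0 by simp
        also have "\<dots> \<longleftrightarrow> i < k \<and> ?h (D i) = Some (D j)"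
        proof (cases "i < k")
          case i: True
          obtain j1 where j1: "j1 < N" "f (D i) = Some (D j1)" using f' i by blast
          have "?h (D i) = Some (D (posn m j1))" using hD[OF i j1(2,1)] .
          thus ?thesis using j1 j0 posn_inj[OF j1(1) j0(1), of m] by auto
        qed simp
        finally show ?thesis .
      qed
      moreover have "length (act m xs) = N" using f' by (intro length_act) simp
      ultimately have "tracks ?h (act m xs, (if g then ol + 1 else ol), oh, (if g then zl else zl + 1), zh, p')"
        using f' True Mv unfolding tracks.simps by (intro conjI allI impI) (simp_all split: if_splits)
      moreover have "cstep l C = Some (act m xs, (if g then ol + 1 else ol), oh, (if g then zl else zl + 1), zh, p')"
        using True Mv C by simp
      ultimately show ?thesis by simp
    qed
  next
    case Home
    have h: "Option.bind (f (D i)) (tr l) = f (D i)" if i: "i < k" for i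
    proof -
      obtain j where "f (D i) = Some (D j)" using f' i by blast
      thus ?thesis using Home by simp
    qed
    show ?thesis
    proof (cases "(ph = 3 \<or> ph = 4) \<and> ol = 0 \<and> oh = a \<and> zl = 0 \<and> zh = a")
      case True
      thus ?thesis using f' h Home C by (simp cong: conj_cong)
    next
      case False
      have "\<exists>s\<in>tokens. Option.bind (f s) (tr l) = None"
      proof (rule ccontr)
        assume "\<not> ?thesis"
        hence alive: "\<forall>s\<in>tokens. Option.bind (f s) (tr l) \<noteq> None" by simp
        from bspec[OF alive tok(1)] bspec[OF alive tok(2)] bspec[OF alive tok(3)] bspec[OF alive tok(4)] bspec[OF alive tok(5)]
        show False using False Home unfolding ctrl by (auto split: if_splits)
      qed
      moreover have "cstep l C = None" using False Home C by auto
      ultimately show ?thesis by simp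
    qed
  next
    case CarO
    have h: "Option.bind (f (D i)) (tr l) = f (D i)" if i: "i < k" for i
    proof -
      obtain j where "f (D i) = Some (D j)" using f' i by blast
      thus ?thesis using CarO by simp
    qed
    show ?thesis
    proof (cases "ol = a \<and> oh < a")
      case True
      thus ?thesis using f' h CarO C by (simp cong: conj_cong)
    next
      case False
      have "\<exists>s\<in>tokens. Option.bind (f s) (tr l) = None"
      proof (rule ccontr)
        assume "\<not> ?thesis"
        hence alive: "\<forall>s\<in>tokens. Option.bind (f s) (tr l) \<noteq> None" by simp
        from bspec[OF alive tok(1)] bspec[OF alive tok(2)] bspec[OF alive tok(3)] bspec[OF alive tok(4)] bspec[OF alive tok(5)]
        show False using False CarO unfolding ctrl by (auto split: if_splits)
      qed
      moreover have "cstep l C = None" using False CarO C by auto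
      ultimately show ?thesis by simp
    qed
  next
    case CarZ
    have h: "Option.bind (f (D i)) (tr l) = f (D i)" if i: "i < k" for i
    proof -
      obtain j where "f (D i) = Some (D j)" using f' i by blast
      thus ?thesis using CarZ by simp
    qed
    show ?thesis
    proof (cases "zl = a \<and> zh < a")
      case True
      thus ?thesis using f' h CarZ C by (simp cong: conj_cong)
    next
      case False
      have "\<exists>s\<in>tokens. Option.bind (f s) (tr l) = None"
      proof (rule ccontr)
        assume "\<not> ?thesis"
        hence alive: "\<forall>s\<in>tokens. Option.bind (f s) (tr l) \<noteq> None" by simp
        from bspec[OF alive tok(1)] bspec[OF alive tok(2)] bspec[OF alive tok(3)] bspec[OF alive tok(4)] bspec[OF alive tok(5)]
        show False using False CarZ unfolding ctrl by (auto split: if_splits)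
      qed
      moreover have "cstep l C = None" using False CarZ C by auto
      ultimately show ?thesis by simp
    qed
  qed
qed

lemma tracks_run:
  "tracks f C \<Longrightarrow> case crun w C of None \<Rightarrow> \<exists>s\<in>tokens. Option.bind (f s) (run w) = None
    | Some C' \<Rightarrow> tracks (\<lambda>s. Option.bind (f s) (run w)) C'"
proof (induction w arbitrary: f C)
  case Nil
  have "run [] = Some" by (rule ext) simp
  thus ?case using Nil by simp
next
  case (Cons l w)
  have b: "Option.bind (Option.bind (f s) (tr l)) (run w) = Option.bind (f s) (run (l # w))" for s
    by (cases "f s") auto
  show ?case
  proof (cases "cstep l C")
    case None
    then obtain s where "s \<in> tokens" "Option.bind (f s) (tr l) = None" using tracks_step[OF Cons.prems, of l] by auto
    hence "\<exists>s\<in>tokens. Option.bind (f s) (run (l # w)) = None" using b[of s] by (intro bexI[of _ s]) auto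
    thus ?thesis using None by simp
  next
    case (Some C')
    hence "tracks (\<lambda>s. Option.bind (f s) (tr l)) C'" using tracks_step[OF Cons.prems, of l] by simp
    from Cons.IH[OF this] show ?thesis unfolding b using Some by simp
  qed
qed

definition start :: "nat option list" where "start = map Some [0..<k] @ replicate k None"

definition start_config :: config where "start_config = (start, 0, 0, 0, 0, 0)"

lemma length_start: "length start = N" by (simp add: start_def N_def)

lemma tracks_start: "tracks Some start_config"
proof -
  have "start ! j = Some i \<longleftrightarrow> i < k \<and> i = j" if "j < N" for i j
    using that by (cases "j < k") (auto simp: start_def nth_append N_def)
  thus ?thesis using k_le_N by (auto simp: start_config_def length_start)
qed

text \<open>Carries the analysis of configurations over to competing words: a word with the same
  effect on the tokens is alive too and must reach the same configuration.\<close>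

lemma crun_determined:
  assumes "crun w start_config = Some C" "\<And>s. s \<in> tokens \<Longrightarrow> run u s = run w s"
  shows "crun u start_config = Some C"
proof -
  have w: "tracks (run w) C" using tracks_run[OF tracks_start, of w] assms(1) by (simp add: bind_eq_Some_conv)
  show ?thesis
  proof (cases "crun u start_config")
    case None
    then obtain s where s: "s \<in> tokens" "run u s = None" using tracks_run[OF tracks_start, of u] by auto
    hence "run w s = None" using assms(2) by simp
    moreover have "run w s \<noteq> None"
    proof -
      obtain xs ol oh zl zh ph where C: "C = (xs, ol, oh, zl, zh, ph)" by (cases C) auto
      show ?thesis using w s(1) unfolding C tracks.simps tokens_def by fastforce
    qed
    ultimately show ?thesis by simp
  next
    case (Some C')
    hence "tracks (run u) C'" using tracks_run[OF tracks_start, of u] by simp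
    hence "C' = C" using w assms(2) by (rule tracks_unique)
    thus ?thesis using Some by simp
  qed
qed

end

section \<open>Completed sweeps and the counting of guesses\<close>

context sweep_machine begin

abbreviation occ :: "nat option \<Rightarrow> bool" where "occ \<equiv> \<lambda>x. x \<noteq> None"

text \<open>The shape 0 1^i 0^j. With k tokens on 2k cells only 0 1^k 0^(k-1) has it, the pattern
  before the initial one, so \<open>H\<close> acts once per cycle and exactly when the tokens arrive
  in the first k cells.\<close>

definition special :: "nat option list \<Rightarrow> bool" where
  "special y \<longleftrightarrow> hd y = None \<and> dropWhile (\<lambda>x. \<not> occ x) (dropWhile occ (tl y)) = []"

definition sweep :: "nat option list \<Rightarrow> nat option list" where
  "sweep y = (if special y then permute_list H (cshift occ y) else cshift occ y)"

lemma sweep_outer: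
  assumes "\<forall>x\<in>set u. occ x" "\<forall>x\<in>set v. \<not> occ x"
  shows "special (b # u @ v) \<longleftrightarrow> b = None"
    and "sweep (b # u @ v) = (if b = None then permute_list H (u @ v @ [b]) else u @ v @ [b])"
proof -
  have "dropWhile occ (u @ v) = v" "dropWhile (\<lambda>x. \<not> occ x) v = []"
    using takeWhile_dropWhile_runs[OF assms, of "[]"] unfolding append_Nil2 by blast+
  thus special: "special (b # u @ v) \<longleftrightarrow> b = None" by (simp only: special_def list.sel simp_thms)
  show "sweep (b # u @ v) = (if b = None then permute_list H (u @ v @ [b]) else u @ v @ [b])"
    by (simp only: sweep_def special cshift_outer[OF assms])
qed

lemma sweep_inner:
  assumes "\<forall>x\<in>set u. occ x" "\<forall>x\<in>set v. \<not> occ x" "v \<noteq> []" "occ c"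
  shows "\<not> special (b # u @ v @ c # y)" and "sweep (b # u @ v @ c # y) = u @ v @ c # b # y"
proof -
  have "c # y = [] \<or> occ (hd (c # y)) \<and> v \<noteq> []" using assms by simp
  hence "dropWhile occ (u @ v @ c # y) = v @ c # y" "dropWhile (\<lambda>x. \<not> occ x) (v @ c # y) = c # y"
    using takeWhile_dropWhile_runs[OF assms(1,2), of "c # y"] by blast+
  thus special: "\<not> special (b # u @ v @ c # y)" by (simp only: special_def list.sel) simp
  show "sweep (b # u @ v @ c # y) = u @ v @ c # b # y"
    by (simp only: sweep_def special cshift_inner[OF assms] if_False)
qed

lemma mset_sweep: "length y = N \<Longrightarrow> mset (sweep y) = mset y"
  using H_N by (simp add: sweep_def)

lemma length_sweep: "length y = N \<Longrightarrow> length (sweep y) = N"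
  using mset_eq_length[OF mset_sweep] by simp

abbreviation nones :: "nat option list \<Rightarrow> nat" where "nones xs \<equiv> count (mset xs) None"

abbreviation orbit :: "nat \<Rightarrow> nat option list" where "orbit M \<equiv> (sweep ^^ M) start"

lemma orbit_props: "length (orbit M) = N" "nones (orbit M) = k"
proof -
  have "mset (orbit M) = mset start \<and> length (orbit M) = N"
    by (induction M) (simp_all add: length_start mset_sweep length_sweep)
  moreover have "nones start = k"
  proof -
    have "nones (map Some xs) = 0" for xs :: "nat list" by (induction xs) auto
    thus ?thesis by (simp only: start_def mset_append count_union) simp
  qed
  ultimately show "length (orbit M) = N" "nones (orbit M) = k" by simp_all
qed

lemma nones_le_length: "nones xs \<le> length xs"
  by (metis count_le_length count_mset)

lemma nones_all: "\<forall>x\<in>set xs. x = None \<Longrightarrow> nones xs = length xs"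
  by (induction xs) auto

lemma nones_eq_0: "nones xs = 0 \<Longrightarrow> \<forall>x\<in>set xs. occ x"
  unfolding count_eq_zero_iff set_mset_mset by metis

(* M sweeps are completed and the current one has made p guesses "occupied" and z guesses "empty". In the
   case bad, it has moved too many cells and can never be completed: Home requires p = z = k, which is
   p + z = N, and phase 3 or 4. *)
inductive inv :: "nat \<Rightarrow> nat option list \<Rightarrow> nat \<Rightarrow> nat \<Rightarrow> nat \<Rightarrow> bool" where
  ones: "orbit M = b # ms @ w \<Longrightarrow> inv M (b # w @ ms) (length ms) 0 0"
| zeros: "orbit M = b # m1 @ m0 @ w \<Longrightarrow> m0 \<noteq> [] \<Longrightarrow> \<forall>x\<in>set m0. x = None \<Longrightarrow>
    inv M (b # w @ m1 @ m0) (length m1) (length m0) 1"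
| hold: "orbit M = b # m1 @ m0 @ c # w \<Longrightarrow> m0 \<noteq> [] \<Longrightarrow> \<forall>x\<in>set m0. x = None \<Longrightarrow>
    inv M (b # w @ m1 @ m0 @ [c]) (Suc (length m1)) (length m0) 2"
| rest: "orbit M = b # m1 @ m0 @ c # w \<Longrightarrow> m0 \<noteq> [] \<Longrightarrow> \<forall>x\<in>set m0. x = None \<Longrightarrow> b # w = m2 @ r \<Longrightarrow>
    p + z = Suc (length m1 + length m0 + length m2) \<Longrightarrow> z \<le> length m0 + nones m2 \<Longrightarrow>
    inv M (r @ m1 @ m0 @ c # m2) p z 3"
| end_one: "orbit M = b # m1 @ m0 @ w \<Longrightarrow> m0 \<noteq> [] \<Longrightarrow> \<forall>x\<in>set m0. x = None \<Longrightarrow>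
    inv M (w @ m1 @ m0 @ [b]) (Suc (length m1)) (length m0) 4"
| end_zero: "orbit M = None # m1 @ m0 @ w \<Longrightarrow> m0 \<noteq> [] \<Longrightarrow> \<forall>x\<in>set m0. x = None \<Longrightarrow>
    inv M (permute_list H (w @ m1 @ m0 @ [None])) (length m1) (Suc (length m0)) 4"
| bad: "p + z \<ge> N \<Longrightarrow> ph \<in> {0, 1, 2} \<or> p + z > N \<Longrightarrow> inv M xs p z ph"

text \<open>As long as \<open>w\<close> is nonempty, its first cell is moved. Otherwise everything
  but \<open>b\<close> has been moved, and one more guess gives p + z = N while the phase is still
  0; this is \<open>bad\<close>.\<close>

lemma inv_ones_one:
  assumes "inv M xs p z 0" shows "inv M (act Tau xs) (Suc p) z 0"
  using assms
proof cases
  case (ones b ms w)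
  show ?thesis
  proof (cases w)
    case Nil
    thus ?thesis using ones orbit_props(1)[of M] by (intro bad) auto
  next
    case (Cons x w')
    thus ?thesis using inv.ones[of M b "ms @ [x]" w'] ones by simp
  qed
qed (auto intro: bad)

lemma inv_ones_zero:
  assumes "inv M xs p z 0" "xs ! 1 = None" shows "inv M (act Tau xs) p (Suc z) 1"
  using assms(1)
proof cases
  case (ones b ms w)
  show ?thesis
  proof (cases w)
    case Nil
    thus ?thesis using ones orbit_props(1)[of M] by (intro bad) auto
  next
    case (Cons x w')
    thus ?thesis using inv.zeros[of M b ms "[x]" w'] ones assms(2) by simp
  qed
qed (auto intro: bad)

lemma inv_zeros_zero:
  assumes "inv M xs p z 1" "xs ! 1 = None" shows "inv M (act Tau xs) p (Suc z) 1"
  using assms(1)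
proof cases
  case (zeros b m1 m0 w)
  show ?thesis
  proof (cases w)
    case Nil
    thus ?thesis using zeros orbit_props(1)[of M] by (intro bad) auto
  next
    case (Cons x w')
    thus ?thesis using inv.zeros[of M b m1 "m0 @ [x]" w'] zeros assms(2) by simp
  qed
qed (auto intro: bad)

lemma inv_zeros_one:
  assumes "inv M xs p z 1" shows "inv M (act Tau xs) (Suc p) z 2"
  using assms(1)
proof cases
  case (zeros b m1 m0 w)
  show ?thesis
  proof (cases w)
    case Nil
    thus ?thesis using zeros orbit_props(1)[of M] by (intro bad) auto
  next
    case (Cons x w')
    thus ?thesis using inv.hold[of M b m1 m0 x w'] zeros by simp
  qed
qed (auto intro: bad)

text \<open>The held \<open>b\<close> is the first cell to move after \<open>c\<close>, which places
  it directly behind 1^i 0^j 1, as the rule requires.\<close>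

lemma inv_hold:
  assumes "inv M xs p z 2"
  shows "inv M (act Sig xs) (Suc p) z 3" and "xs ! 0 = None \<Longrightarrow> inv M (act Sig xs) p (Suc z) 3"
proof -
  show "inv M (act Sig xs) (Suc p) z 3" using assms
  proof cases
    case (hold b m1 m0 c w)
    thus ?thesis using inv.rest[of M b m1 m0 c w "[b]" w "Suc p" z] by simp
  qed (auto intro: bad)
  show "inv M (act Sig xs) p (Suc z) 3" if "xs ! 0 = None" using assms
  proof cases
    case (hold b m1 m0 c w)
    thus ?thesis using inv.rest[of M b m1 m0 c w "[b]" w p "Suc z"] that by simp
  qed (auto intro: bad)
qed

text \<open>A guess "empty" raises \<open>z\<close> and \<open>nones m2\<close> together; a false
  guess "occupied" raises only \<open>nones m2\<close>. Hence the inequality for \<open>z\<close> in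
  the invariant.\<close>

lemma inv_rest:
  assumes "inv M xs p z 3"
  shows "inv M (act Sig xs) (Suc p) z 3" and "xs ! 0 = None \<Longrightarrow> inv M (act Sig xs) p (Suc z) 3"
proof -
  show "inv M (act Sig xs) (Suc p) z 3" using assms
  proof cases
    case (rest b m1 m0 c w m2 r)
    show ?thesis
    proof (cases r)
      case Nil
      have "length (b # w) = length m2" using rest Nil by simp
      thus ?thesis using rest orbit_props(1)[of M] by (intro bad) auto
    next
      case (Cons x r')
      thus ?thesis using inv.rest[of M b m1 m0 c w "m2 @ [x]" r' "Suc p" z] rest by simp
    qed
  qed (auto intro: bad)
  show "inv M (act Sig xs) p (Suc z) 3" if "xs ! 0 = None" using assms
  proof cases
    case (rest b m1 m0 c w m2 r)
    show ?thesis
    proof (cases r)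
      case Nil
      have "length (b # w) = length m2" using rest Nil by simp
      thus ?thesis using rest orbit_props(1)[of M] by (intro bad) auto
    next
      case (Cons x r')
      thus ?thesis using inv.rest[of M b m1 m0 c w "m2 @ [x]" r' p "Suc z"] rest that by simp
    qed
  qed (auto intro: bad)
qed

lemma inv_zeros_end:
  assumes "inv M xs p z 1"
  shows "inv M (act Sig xs) (Suc p) z 4" and "xs ! 0 = None \<Longrightarrow> inv M (act SigH xs) p (Suc z) 4"
proof -
  show "inv M (act Sig xs) (Suc p) z 4" using assms
  proof cases
    case (zeros b m1 m0 w)
    thus ?thesis using inv.end_one[of M b m1 m0 w] by simp
  qed (auto intro: bad)
  show "inv M (act SigH xs) p (Suc z) 4" if "xs ! 0 = None" using assms
  proof cases
    case (zeros b m1 m0 w)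
    thus ?thesis using inv.end_zero[of M m1 m0 w] that by simp
  qed (auto intro: bad)
qed

text \<open>p = z = k means that N cells were moved, so each exactly once. The k empty cells vouched
  for in \<open>m0\<close>, \<open>m2\<close> and the final \<open>b\<close> are all the empty
  cells. So \<open>m1\<close> and the closing one are occupied, and the guessed runs are the true
  runs of the rule.\<close>

lemma inv_home:
  assumes "inv M xs k k ph" "ph = 3 \<or> ph = 4" shows "xs = orbit (Suc M)"
  using assms(1)
proof cases
  case (rest b m1 m0 c w m2 r)
  have len: "Suc (length m1 + length m0 + length (c # w)) = N" using orbit_props(1)[of M] rest by simp
  have "b # w = m2 @ r" using rest by blast
  hence "length (b # w) = length (m2 @ r)" by (rule arg_cong)
  hence "Suc (length w) = length m2 + length r" by simp
  moreover have "Suc (length m1 + length m0 + length m2) = 2 * k" using rest by simp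
  ultimately have "length r = 0" using len N_def by (simp only: length_Cons)
  hence r: "r = []" by simp
  have O: "orbit M = b # m1 @ m0 @ c # w" and m0: "m0 \<noteq> []" "\<forall>x\<in>set m0. x = None"
    and bnd: "k \<le> length m0 + nones m2" and xs: "xs = r @ m1 @ m0 @ c # m2" and "b # w = m2 @ r"
    using rest by blast+
  hence m2: "m2 = b # w" using r by (metis append_Nil2)
  have "nones (b # m1 @ m0 @ c # w) = k" using orbit_props(2)[of M] unfolding O .
  moreover have "nones (b # m1 @ m0 @ c # w) = nones m1 + nones [c] + nones m0 + nones (b # w)" by simp
  ultimately have "nones m1 + nones [c] + length m0 + nones m2 = k"
    unfolding m2 nones_all[OF m0(2)] by linarith
  hence 0: "nones m1 = 0" "nones [c] = 0" using bnd by linarith+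
  have "sweep (orbit M) = m1 @ m0 @ c # b # w" unfolding O
    using m0 nones_eq_0[OF 0(1)] nones_eq_0[OF 0(2)] by (intro sweep_inner) auto
  thus ?thesis using xs r m2 by simp
next
  case (end_one b m1 m0 w)
  have O: "orbit M = b # m1 @ m0 @ w" and m0: "\<forall>x\<in>set m0. x = None" and xs: "xs = w @ m1 @ m0 @ [b]"
    and cnt: "k = Suc (length m1)" "k = length m0"
    using end_one by blast+
  have "Suc (length m1 + length m0 + length w) = 2 * k" using orbit_props(1)[of M] unfolding O N_def by simp
  hence "length w = 0" using cnt by arith
  hence w: "w = []" by simp
  have "nones (b # m1 @ m0) = k" using orbit_props(2)[of M] unfolding O w append_Nil2 .
  moreover have "nones (b # m1 @ m0) = nones [b] + nones m1 + nones m0" by simp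
  ultimately have 0: "nones m1 = 0" "nones [b] = 0" unfolding nones_all[OF m0] using cnt(2) by linarith+
  have "sweep (b # m1 @ m0) = m1 @ m0 @ [b]"
    using m0 nones_eq_0[OF 0(1)] nones_eq_0[OF 0(2)] by (subst sweep_outer(2)) auto
  thus ?thesis using O xs w by simp
next
  case (end_zero m1 m0 w)
  have O: "orbit M = None # m1 @ m0 @ w" and m0: "\<forall>x\<in>set m0. x = None" and xs: "xs = permute_list H (w @ m1 @ m0 @ [None])"
    and cnt: "k = length m1" "k = Suc (length m0)"
    using end_zero by blast+
  have "Suc (length m1 + length m0 + length w) = 2 * k" using orbit_props(1)[of M] unfolding O N_def by simp
  hence "length w = 0" using cnt by arith
  hence w: "w = []" by simp
  have "nones (None # m1 @ m0) = k" using orbit_props(2)[of M] unfolding O w append_Nil2 .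
  moreover have "nones (None # m1 @ m0) = Suc (nones m1 + nones m0)" by simp
  ultimately have 0: "nones m1 = 0" unfolding nones_all[OF m0] using cnt(2) by linarith
  have "sweep (None # m1 @ m0) = permute_list H (m1 @ m0 @ [None])"
    using m0 nones_eq_0[OF 0] by (subst sweep_outer(2)) auto
  thus ?thesis using O xs w by simp
next
  case bad
  thus ?thesis using assms(2) by (auto simp: N_def)
qed (use assms(2) in auto)

fun cinv :: "nat \<Rightarrow> config \<Rightarrow> bool" where
  "cinv M (xs, ol, oh, zl, zh, ph) = inv M xs (a * oh + ol) (a * zh + zl) ph"

lemma inv_start_of_sweep: "inv M (orbit M) 0 0 0"
proof -
  obtain b w where "orbit M = b # w" using orbit_props(1)[of M] N_ge by (cases "orbit M") auto
  thus ?thesis using inv.ones[of M b "[]" w] by simp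
qed

text \<open>Only \<open>Home\<close> increases the number of completed sweeps, and by one. This
  converts a number of sweeps into a lower bound on the length of a word.\<close>

lemma cinv_step:
  assumes C: "cinv M C" and l: "l \<in> set alphabet" and step: "cstep l C = Some C'"
  shows "\<exists>M'\<le>Suc M. cinv M' C'"
proof -
  obtain xs ol oh zl zh ph where Cd: "C = (xs, ol, oh, zl, zh, ph)" by (cases C) auto
  note inv = C[unfolded Cd cinv.simps]
  have stay: "\<exists>M'\<le>Suc M. cinv M' C'" if "cinv M C'" using that by (intro exI[of _ M]) simp
  have one: thesis if "cstep (Mv p p' True m) C = Some C'"
     "ph = p \<Longrightarrow> C' = (act m xs, Suc ol, oh, zl, zh, p') \<Longrightarrow> thesis" for p p' m thesis
    using that by (auto simp: Cd split: if_splits simp del: act.simps)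
  have zero: thesis if "cstep (Mv p p' False m) C = Some C'"
     "ph = p \<Longrightarrow> xs ! chk m = None \<Longrightarrow> C' = (act m xs, ol, oh, Suc zl, zh, p') \<Longrightarrow> thesis" for p p' m thesis
    using that by (auto simp: Cd split: if_splits simp del: act.simps chk.simps)
  consider "l = Mv 0 0 True Tau" | "l = Mv 0 1 False Tau" | "l = Mv 1 1 False Tau" | "l = Mv 1 2 True Tau"
    | "l = Mv 2 3 False Sig" | "l = Mv 2 3 True Sig" | "l = Mv 3 3 False Sig" | "l = Mv 3 3 True Sig"
    | "l = Mv 1 4 False SigH" | "l = Mv 1 4 True Sig" | "l = Home" | "l = CarO" | "l = CarZ"
    using l unfolding alphabet_def by auto
  thus ?thesis
  proof cases
    case 1
    show ?thesis by (rule one[OF step[unfolded 1]], rule stay) (use inv inv_ones_one in simp)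
  next
    case 2
    show ?thesis by (rule zero[OF step[unfolded 2]], rule stay) (use inv inv_ones_zero in simp)
  next
    case 3
    show ?thesis by (rule zero[OF step[unfolded 3]], rule stay) (use inv inv_zeros_zero in simp)
  next
    case 4
    show ?thesis by (rule one[OF step[unfolded 4]], rule stay) (use inv inv_zeros_one in simp)
  next
    case 5
    show ?thesis by (rule zero[OF step[unfolded 5]], rule stay) (use inv inv_hold(2) in simp)
  next
    case 6
    show ?thesis by (rule one[OF step[unfolded 6]], rule stay) (use inv inv_hold(1) in simp)
  next
    case 7
    show ?thesis by (rule zero[OF step[unfolded 7]], rule stay) (use inv inv_rest(2) in simp)
  next
    case 8
    show ?thesis by (rule one[OF step[unfolded 8]], rule stay) (use inv inv_rest(1) in simp)
  next
    case 9
    show ?thesis by (rule zero[OF step[unfolded 9]], rule stay) (use inv inv_zeros_end(2) in simp)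
  next
    case 10
    show ?thesis by (rule one[OF step[unfolded 10]], rule stay) (use inv inv_zeros_end(1) in simp)
  next
    case 11
    have h: "ph = 3 \<or> ph = 4" "ol = 0" "oh = a" "zl = 0" "zh = a" "C' = (xs, 0, 0, 0, 0, 0)"
      using step by (auto simp: 11 Cd split: if_splits)
    hence "xs = orbit (Suc M)" using inv inv_home[of M xs ph] by (simp add: k_def)
    hence "cinv (Suc M) C'" using inv_start_of_sweep[of "Suc M"] h by simp
    thus ?thesis by blast
  next
    case 12
    show ?thesis using step inv by (intro stay) (auto simp: 12 Cd add.commute split: if_splits)
  next
    case 13
    show ?thesis using step inv by (intro stay) (auto simp: 13 Cd add.commute split: if_splits)
  qed
qed

lemma cinv_run:
  "cinv M C \<Longrightarrow> set w \<subseteq> set alphabet \<Longrightarrow> crun w C = Some C' \<Longrightarrow> \<exists>M'\<le>M + length w. cinv M' C'"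
proof (induction w arbitrary: M C)
  case Nil
  thus ?case by (intro exI[of _ M]) simp
next
  case (Cons l w)
  have lw: "l \<in> set alphabet" "set w \<subseteq> set alphabet" using Cons.prems(2) by simp_all
  obtain C1 where C1: "cstep l C = Some C1" "crun w C1 = Some C'"
    using Cons.prems(3) unfolding crun.simps bind_eq_Some_conv by blast
  obtain M1 where M1: "M1 \<le> Suc M" "cinv M1 C1" using cinv_step[OF Cons.prems(1) lw(1) C1(1)] by blast
  obtain M' where M': "M' \<le> M1 + length w" "cinv M' C'" using Cons.IH[OF M1(2) lw(2) C1(2)] by blast
  have "M' \<le> M + length (l # w)" using M1(1) M'(1) by simp
  thus ?case using M'(2) by blast
qed

lemma crun_sound:
  assumes "set w \<subseteq> set alphabet" "crun w start_config = Some (xs, 0, 0, 0, 0, 0)"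
  shows "\<exists>M\<le>length w. xs = orbit M"
proof -
  have "cinv 0 start_config" using inv_start_of_sweep[of 0] by (simp add: start_config_def)
  from cinv_run[OF this assms] obtain M where "M \<le> 0 + length w" "cinv M (xs, 0, 0, 0, 0, 0)" by blast
  hence M: "M \<le> length w" "inv M xs 0 0 0" by simp_all
  \<comment> \<open>Counters 0 in phase 0 leave only \<open>ones\<close> with empty
    \<open>ms\<close>, whose list is \<open>orbit M\<close> itself.\<close>
  from M(2) have "xs = orbit M"
  proof cases
    case (ones b ms w)
    thus ?thesis by simp
  next
    case (zeros b m1 m0 w)
    have False using zeros(4) by simp
    thus ?thesis ..
  next
    case (rest b m1 m0 c w m2 r)
    have False using rest(2) by simp
    thus ?thesis ..
  next
    case bad
    have False using bad(1) N_ge by simp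
    thus ?thesis ..
  qed
  show ?thesis
  proof (intro exI conjI)
    show "M \<le> length w" by (rule M(1))
    show "xs = orbit M" by fact
  qed
qed

section \<open>Words that carry out each sweep with correct guesses\<close>

definition reach :: "config \<Rightarrow> config \<Rightarrow> bool" where
  "reach C C' \<longleftrightarrow> (\<exists>w. set w \<subseteq> set alphabet \<and> crun w C = Some C')"

lemma crun_append: "crun (u @ v) C = Option.bind (crun u C) (crun v)"
proof (induction u arbitrary: C)
  case (Cons l u)
  show ?case by (cases "cstep l C") (simp_all add: Cons)
qed simp

lemma reach_refl: "reach C C" unfolding reach_def by (intro exI[of _ "[]"]) simp

lemma reach_trans: "reach C C' \<Longrightarrow> reach C' C'' \<Longrightarrow> reach C C''"
  unfolding reach_def
proof safe
  fix u v assume "set u \<subseteq> set alphabet" "set v \<subseteq> set alphabet" "crun u C = Some C'" "crun v C' = Some C''"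
  thus "\<exists>w. set w \<subseteq> set alphabet \<and> crun w C = Some C''" by (intro exI[of _ "u @ v"]) (simp add: crun_append)
qed

lemma reach_step:
  assumes "l \<in> set alphabet" "cstep l C = Some C'" shows "reach C C'"
proof -
  have "crun [l] C = Some C'" unfolding crun.simps assms(2) by simp
  moreover have "set [l] \<subseteq> set alphabet" using assms(1) by simp
  ultimately show ?thesis unfolding reach_def by blast
qed

text \<open>Hands normalized by carrying as soon as the low hand is full, so that the value k is low
  hand 0 and high hand a, as \<open>Home\<close> demands.\<close>

definition conf :: "nat option list \<Rightarrow> nat \<Rightarrow> nat \<Rightarrow> nat \<Rightarrow> config" where
  "conf xs p z ph = (xs, p mod a, p div a, z mod a, z div a, ph)"

text \<open>p < k keeps the high hand below a, so the carry is defined whenever the low hand fills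
  up.\<close>

lemma reach_one:
  assumes l: "Mv q q' True m \<in> set alphabet" and p: "p < k"
  shows "reach (conf xs p z q) (conf (act m xs) (Suc p) z q')"
proof -
  have a0: "a > 0" using a by simp
  have pm: "p mod a < a" "p div a < a" using a0 p by (simp_all add: k_def less_mult_imp_div_less)
  have 1: "reach (conf xs p z q) (act m xs, Suc (p mod a), p div a, z mod a, z div a, q')"
    by (rule reach_step[OF l]) (use pm in \<open>simp add: conf_def\<close>)
  show ?thesis
  proof (cases "Suc (p mod a) = a")
    case False
    hence "conf (act m xs) (Suc p) z q' = (act m xs, Suc (p mod a), p div a, z mod a, z div a, q')"
      by (simp add: conf_def mod_Suc div_Suc)
    thus ?thesis using 1 by simp
  next
    case True
    have "reach (act m xs, Suc (p mod a), p div a, z mod a, z div a, q') (act m xs, 0, Suc (p div a), z mod a, z div a, q')"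
      by (rule reach_step[of CarO]) (use pm True in \<open>auto simp: alphabet_def\<close>)
    moreover have "conf (act m xs) (Suc p) z q' = (act m xs, 0, Suc (p div a), z mod a, z div a, q')"
      using True by (simp add: conf_def mod_Suc div_Suc)
    ultimately show ?thesis using reach_trans[OF 1] by simp
  qed
qed

lemma reach_zero:
  assumes l: "Mv q q' False m \<in> set alphabet" and z: "z < k" and chk: "xs ! chk m = None"
  shows "reach (conf xs p z q) (conf (act m xs) p (Suc z) q')"
proof -
  have a0: "a > 0" using a by simp
  have zm: "z mod a < a" "z div a < a" using a0 z by (simp_all add: k_def less_mult_imp_div_less)
  have 1: "reach (conf xs p z q) (act m xs, p mod a, p div a, Suc (z mod a), z div a, q')"
    by (rule reach_step[OF l]) (use zm chk in \<open>simp add: conf_def\<close>)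
  show ?thesis
  proof (cases "Suc (z mod a) = a")
    case False
    hence "conf (act m xs) p (Suc z) q' = (act m xs, p mod a, p div a, Suc (z mod a), z div a, q')"
      by (simp add: conf_def mod_Suc div_Suc)
    thus ?thesis using 1 by simp
  next
    case True
    have "reach (act m xs, p mod a, p div a, Suc (z mod a), z div a, q') (act m xs, p mod a, p div a, 0, Suc (z div a), q')"
      by (rule reach_step[of CarZ]) (use zm True in \<open>auto simp: alphabet_def\<close>)
    moreover have "conf (act m xs) p (Suc z) q' = (act m xs, p mod a, p div a, 0, Suc (z div a), q')"
      using True by (simp add: conf_def mod_Suc div_Suc)
    ultimately show ?thesis using reach_trans[OF 1] by simp
  qed
qed

lemma reach_ones:
  "\<forall>x\<in>set u. occ x \<Longrightarrow> p + length u \<le> k \<Longrightarrow> reach (conf (b # u @ w) p z 0) (conf (b # w @ u) (p + length u) z 0)"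
proof (induction u arbitrary: p w)
  case (Cons x u)
  have "reach (conf (b # (x # u) @ w) p z 0) (conf (act Tau (b # (x # u) @ w)) (Suc p) z 0)"
    using Cons.prems by (intro reach_one) (auto simp: alphabet_def)
  hence A: "reach (conf (b # (x # u) @ w) p z 0) (conf (b # u @ (w @ [x])) (Suc p) z 0)" by simp
  have B: "reach (conf (b # u @ (w @ [x])) (Suc p) z 0) (conf (b # (w @ [x]) @ u) (Suc p + length u) z 0)"
    using Cons.prems by (intro Cons.IH) auto
  show ?case using reach_trans[OF A B] by simp
qed (simp add: reach_refl)

lemma reach_zeros:
  "\<forall>x\<in>set v. x = None \<Longrightarrow> z + length v \<le> k \<Longrightarrow> reach (conf (b # v @ w) p z 1) (conf (b # w @ v) p (z + length v) 1)"
proof (induction v arbitrary: z w)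
  case (Cons x v)
  have "reach (conf (b # (x # v) @ w) p z 1) (conf (act Tau (b # (x # v) @ w)) p (Suc z) 1)"
    using Cons.prems by (intro reach_zero) (auto simp: alphabet_def)
  hence A: "reach (conf (b # (x # v) @ w) p z 1) (conf (b # v @ (w @ [x])) p (Suc z) 1)" by simp
  have B: "reach (conf (b # v @ (w @ [x])) p (Suc z) 1) (conf (b # (w @ [x]) @ v) p (Suc z + length v) 1)"
    using Cons.prems by (intro Cons.IH) auto
  show ?case using reach_trans[OF A B] by simp
qed (simp add: reach_refl)

text \<open>The source phase q is generalized because it is 2 for the first cell and 3 for all later
  ones.\<close>

lemma reach_rest:
  assumes "Mv q 3 True Sig \<in> set alphabet" "Mv q 3 False Sig \<in> set alphabet"
  shows "p + (length (x # u) - nones (x # u)) \<le> k \<Longrightarrow> z + nones (x # u) \<le> k \<Longrightarrow>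
   reach (conf ((x # u) @ w) p z q) (conf (w @ (x # u)) (p + (length (x # u) - nones (x # u))) (z + nones (x # u)) 3)"
  using assms
proof (induction u arbitrary: p z w x q)
  case Nil
  show ?case
  proof (cases x)
    case None
    thus ?thesis using reach_zero[OF Nil(4), of z "[x] @ w" p] Nil(2) by simp
  next
    case (Some i)
    thus ?thesis using reach_one[OF Nil(3), of p "[x] @ w" z] Nil(1) by simp
  qed
next
  case (Cons y u)
  have q3: "Mv 3 3 True Sig \<in> set alphabet" "Mv 3 3 False Sig \<in> set alphabet" by (auto simp: alphabet_def)
  have n: "nones (y # u) \<le> length (y # u)" by (rule nones_le_length)
  show ?case
  proof (cases x)
    case None
    have E: "length (x # y # u) - nones (x # y # u) = length (y # u) - nones (y # u)"
      "z + nones (x # y # u) = Suc z + nones (y # u)"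
      using None by simp_all
    have A: "reach (conf ((x # y # u) @ w) p z q) (conf ((y # u) @ (w @ [x])) p (Suc z) 3)"
      using reach_zero[OF Cons.prems(4), of z "(x # y # u) @ w" p] Cons.prems(2) None by simp
    have B: "reach (conf ((y # u) @ (w @ [x])) p (Suc z) 3) (conf ((w @ [x]) @ (y # u)) (p + (length (y # u) - nones (y # u))) (Suc z + nones (y # u)) 3)"
    proof (rule Cons.IH[OF _ _ q3])
      show "p + (length (y # u) - nones (y # u)) \<le> k" using Cons.prems(1) E(1) by linarith
      show "Suc z + nones (y # u) \<le> k" using Cons.prems(2) E(2) by linarith
    qed
    show ?thesis using reach_trans[OF A B] unfolding E(1) unfolding E(2) by (simp only: append_assoc append.simps)
  next
    case (Some i)
    have E: "p + (length (x # y # u) - nones (x # y # u)) = Suc p + (length (y # u) - nones (y # u))"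
      "nones (x # y # u) = nones (y # u)"
      using Some n by simp_all
    have A: "reach (conf ((x # y # u) @ w) p z q) (conf ((y # u) @ (w @ [x])) (Suc p) z 3)"
    proof -
      have "p < k" using Cons.prems(1) E(1) by linarith
      from reach_one[OF Cons.prems(3) this, of "(x # y # u) @ w" z] show ?thesis by simp
    qed
    have B: "reach (conf ((y # u) @ (w @ [x])) (Suc p) z 3) (conf ((w @ [x]) @ (y # u)) (Suc p + (length (y # u) - nones (y # u))) (z + nones (y # u)) 3)"
    proof (rule Cons.IH[OF _ _ q3])
      show "Suc p + (length (y # u) - nones (y # u)) \<le> k" using Cons.prems(1) E(1) by linarith
      show "z + nones (y # u) \<le> k" using Cons.prems(2) E(2) by linarith
    qed
    show ?thesis using reach_trans[OF A B] unfolding E(1) unfolding E(2) by (simp only: append_assoc append.simps)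
  qed
qed

lemma reach_home: "q = 3 \<or> q = 4 \<Longrightarrow> reach (conf xs k k q) (conf xs 0 0 0)"
proof (rule reach_step[of Home])
  assume q: "q = 3 \<or> q = 4"
  have "conf xs k k q = (xs, 0, a, 0, a, q)" using a by (simp add: conf_def k_def)
  thus "cstep Home (conf xs k k q) = Some (conf xs 0 0 0)" using q by (simp add: conf_def)
qed (simp add: alphabet_def)

text \<open>The run that guesses correctly throughout. It moves every cell once, and there are k
  cells of either kind, so both counters end at k.\<close>

lemma reach_sweep:
  assumes y: "length y = N" "nones y = k"
  shows "reach (conf y 0 0 0) (conf (sweep y) 0 0 0)"
proof -
  obtain b w where bw: "y = b # w" using y N_ge by (cases y) auto
  have first_zero: "reach (conf (b # v0 # v @ r) p 0 0) (conf (b # r @ v0 # v) p (length (v0 # v)) 1)"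
    if "v0 = None" "\<forall>x\<in>set v. x = None" "length (v0 # v) \<le> k" for v0 v r p
  proof -
    have "reach (conf (b # v0 # v @ r) p 0 0) (conf (act Tau (b # v0 # v @ r)) p (Suc 0) 1)"
      using that k_ge by (intro reach_zero) (auto simp: alphabet_def)
    hence A: "reach (conf (b # v0 # v @ r) p 0 0) (conf (b # v @ (r @ [v0])) p (Suc 0) 1)" by simp
    have B: "reach (conf (b # v @ (r @ [v0])) p (Suc 0) 1) (conf (b # (r @ [v0]) @ v) p (Suc 0 + length v) 1)"
      using that by (intro reach_zeros) auto
    show ?thesis using reach_trans[OF A B] by simp
  qed
  have nones_occ: "nones u = 0" if "\<forall>x\<in>set u. occ x" for u
    using that by (auto simp: count_eq_zero_iff)
  show ?thesis
  proof (cases rule: runs_cases[of w occ])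
    case (inner u v c r)
    obtain v0 v' where v: "v = v0 # v'" using inner(4) by (cases v) auto
    have nv: "nones v = length v" using inner(3) by (intro nones_all) auto
    have nu: "nones u = 0" using inner(2) by (rule nones_occ)
    have cnt: "length v + nones (b # r) = k" using y(2) nv nu inner(1,5) by (auto simp: bw)
    have len: "length u + length v + length r + 2 = N" using y(1) inner(1) by (simp add: bw)
    have nr: "nones (b # r) \<le> length (b # r)" by (rule nones_le_length)
    have ones: "Suc (length u) + (length (b # r) - nones (b # r)) = k" using cnt len nr N_def by simp
    have "reach (conf (b # u @ (v @ c # r)) 0 0 0) (conf (b # (v @ c # r) @ u) (0 + length u) 0 0)"
      using inner(2) ones by (intro reach_ones) auto
    hence A1: "reach (conf y 0 0 0) (conf (b # v0 # v' @ (c # r @ u)) (length u) 0 0)"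
      by (simp add: bw inner(1) v)
    have A2: "reach (conf (b # v0 # v' @ (c # r @ u)) (length u) 0 0) (conf (b # (c # r @ u) @ v) (length u) (length v) 1)"
      unfolding v using inner(3) v cnt by (intro first_zero) auto
    have "reach (conf (b # (c # r @ u) @ v) (length u) (length v) 1) (conf (act Tau (b # (c # r @ u) @ v)) (Suc (length u)) (length v) 2)"
      using ones by (intro reach_one) (auto simp: alphabet_def)
    hence A3: "reach (conf (b # (c # r @ u) @ v) (length u) (length v) 1) (conf ((b # r) @ (u @ v @ [c])) (Suc (length u)) (length v) 2)"
      by simp
    have "reach (conf ((b # r) @ (u @ v @ [c])) (Suc (length u)) (length v) 2)
      (conf ((u @ v @ [c]) @ (b # r)) (Suc (length u) + (length (b # r) - nones (b # r))) (length v + nones (b # r)) 3)"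
      using ones cnt by (intro reach_rest) (auto simp: alphabet_def)
    hence A4: "reach (conf ((b # r) @ (u @ v @ [c])) (Suc (length u)) (length v) 2) (conf (u @ v @ c # b # r) k k 3)"
      unfolding ones cnt by simp
    have A5: "reach (conf (u @ v @ c # b # r) k k 3) (conf (u @ v @ c # b # r) 0 0 0)" by (rule reach_home) simp
    have "reach (conf y 0 0 0) (conf (u @ v @ c # b # r) 0 0 0)"
      by (rule reach_trans[OF A1 reach_trans[OF A2 reach_trans[OF A3 reach_trans[OF A4 A5]]]])
    moreover have "sweep y = u @ v @ c # b # r" unfolding bw inner(1) by (rule sweep_inner(2)[OF inner(2-5)])
    ultimately show ?thesis by simp
  next
    case (outer u v)
    have nv: "nones v = length v" using outer(3) by (intro nones_all) auto
    have nu: "nones u = 0" using outer(2) by (rule nones_occ)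
    have cnt: "nones [b] + length v = k" using y(2) nv nu outer(1) by (auto simp: bw)
    have len: "length u + length v + 1 = N" using y(1) outer(1) by (simp add: bw)
    \<comment> \<open>The step from phase 0 to phase 1 consumes a zero behind \<open>b\<close>. One
      exists since there are k >= 4 empty cells and \<open>b\<close> is at most one of them.\<close>
    have "v \<noteq> []" using cnt k_ge by (auto split: if_splits)
    then obtain v0 v' where v: "v = v0 # v'" by (cases v) auto
    have "reach (conf (b # u @ v) 0 0 0) (conf (b # v @ u) (0 + length u) 0 0)"
      using outer(2) cnt len N_def by (intro reach_ones) (auto split: if_splits)
    hence A1: "reach (conf y 0 0 0) (conf (b # v0 # v' @ u) (length u) 0 0)" by (simp add: bw outer(1) v)
    have A2: "reach (conf (b # v0 # v' @ u) (length u) 0 0) (conf (b # u @ v) (length u) (length v) 1)"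
      unfolding v using outer(3) v cnt by (intro first_zero) (auto split: if_splits)
    note 1 = reach_trans[OF A1 A2]
    show ?thesis
    proof (cases b)
      case None
      have k: "Suc (length v) = k" "length u = k" using cnt len None N_def by simp_all
      have "reach (conf (b # u @ v) (length u) (length v) 1) (conf (act SigH (b # u @ v)) (length u) (Suc (length v)) 4)"
        using k None by (intro reach_zero) (auto simp: alphabet_def)
      moreover have "act SigH (b # u @ v) = sweep y"
        unfolding bw outer(1) sweep_outer(2)[OF outer(2,3)] using None by simp
      ultimately have 2: "reach (conf (b # u @ v) (length u) (length v) 1) (conf (sweep y) k k 4)" using k by simp
      show ?thesis by (rule reach_trans[OF 1 reach_trans[OF 2 reach_home]]) simp
    next
      case (Some i)
      have k: "length v = k" "Suc (length u) = k" using cnt len Some N_def by simp_all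
      have "reach (conf (b # u @ v) (length u) (length v) 1) (conf (act Sig (b # u @ v)) (Suc (length u)) (length v) 4)"
        using k by (intro reach_one) (auto simp: alphabet_def)
      moreover have "act Sig (b # u @ v) = sweep y"
        unfolding bw outer(1) sweep_outer(2)[OF outer(2,3)] using Some by simp
      ultimately have 2: "reach (conf (b # u @ v) (length u) (length v) 1) (conf (sweep y) k k 4)" using k by simp
      show ?thesis by (rule reach_trans[OF 1 reach_trans[OF 2 reach_home]]) simp
    qed
  qed
qed

lemma reach_orbit: "reach start_config (orbit M, 0, 0, 0, 0, 0)"
proof -
  have "reach (conf start 0 0 0) (conf (orbit M) 0 0 0)"
  proof (induction M)
    case (Suc M)
    have "reach (conf (orbit M) 0 0 0) (conf (sweep (orbit M)) 0 0 0)" by (intro reach_sweep orbit_props)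
    thus ?case using reach_trans[OF Suc] by simp
  qed (simp add: reach_refl)
  thus ?thesis by (simp add: conf_def start_config_def)
qed

text \<open>A competing word \<open>u\<close> arrives at the same configuration, and soundness makes
  it \<open>orbit M\<close> for some M <= length u. If no earlier member of the orbit equals
  \<open>orbit T\<close>, then M >= T.\<close>

lemma orbit_word:
  assumes distinct: "\<And>M. M < T \<Longrightarrow> orbit M \<noteq> orbit T"
  obtains w where "set w \<subseteq> set alphabet"
    "\<And>u. set u \<subseteq> set alphabet \<Longrightarrow> (\<And>s. s \<in> tokens \<Longrightarrow> run u s = run w s) \<Longrightarrow> T \<le> length u"
proof -
  obtain w where w: "set w \<subseteq> set alphabet" "crun w start_config = Some (orbit T, 0, 0, 0, 0, 0)"
    using reach_orbit[of T] by (auto simp: reach_def)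
  have "T \<le> length u" if u: "set u \<subseteq> set alphabet" "\<And>s. s \<in> tokens \<Longrightarrow> run u s = run w s" for u
  proof -
    have "crun u start_config = Some (orbit T, 0, 0, 0, 0, 0)" by (rule crun_determined[OF w(2) u(2)])
    then obtain M where M: "M \<le> length u" "orbit T = orbit M" using crun_sound[OF u(1)] by metis
    hence "\<not> M < T" using distinct by metis
    thus ?thesis using M(1) by simp
  qed
  thus thesis using that w(1) by blast
qed

end

(* Otherwise the simplifier rewrites the predicate that is the argument of cshift. *)
declare not_None_eq [simp del]

section \<open>Patterns and labels along the orbit\<close>

abbreviation bits :: "nat option list \<Rightarrow> bool list" where "bits \<equiv> map (\<lambda>x. x \<noteq> None)"

lemma bits_cshift: "bits (cshift (\<lambda>x. x \<noteq> None) xs) = bshift (bits xs)"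
  using map_cshift[of "\<lambda>x. x \<noteq> None" "\<lambda>x. x" xs] by simp

lemma bits_funpow_cshift: "bits ((cshift (\<lambda>x. x \<noteq> None) ^^ m) xs) = (bshift ^^ m) (bits xs)"
  by (induction m) (simp_all add: bits_cshift del: map_map)

lemma bits_eq_replicate_True: "\<forall>x\<in>set u. x \<noteq> None \<Longrightarrow> bits u = replicate (length u) True"
  by (induction u) simp_all

lemma bits_eq_replicate_False: "\<forall>x\<in>set v. x = None \<Longrightarrow> bits v = replicate (length v) False"
  by (induction v) simp_all

context sweep_machine begin

abbreviation B :: "bool list" where "B \<equiv> replicate k True @ replicate k False"
abbreviation B0 :: "bool list" where "B0 \<equiv> False # replicate k True @ replicate (k - 1) False"

lemma bits_start: "bits start = B"
proof -
  have "bits (map Some xs) = replicate (length xs) True" for xs :: "nat list" by (induction xs) auto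
  from this[of "[0..<k]"] show ?thesis by (simp add: start_def del: map_map)
qed

lemma bshift_B0: "bshift B0 = B"
proof -
  have "replicate (k - 1) False @ [False] = replicate k False"
    using k_ge by (metis Suc_diff_1 le_trans replicate_append_same replicate_Suc zero_less_numeral less_le_trans)
  thus ?thesis using cshift_outer[of "replicate k True" "\<lambda>x. x" "replicate (k - 1) False" False] by simp
qed

lemma special_iff:
  assumes xs: "length xs = N" "nones xs = k"
  shows "special xs \<longleftrightarrow> bits xs = B0"
proof
  assume sp: "special xs"
  obtain b w where bw: "xs = b # w" using xs N_ge by (cases xs) auto
  show "bits xs = B0"
  proof (cases rule: runs_cases[of w occ])
    case (outer u v)
    have b: "b = None" using sp sweep_outer(1)[OF outer(2,3), of b] unfolding bw outer(1) by blast
    have v: "\<forall>x\<in>set v. x = None" using outer(3) by simp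
    have "nones xs = Suc (nones u + nones v)" unfolding bw outer(1) b by simp
    moreover have "nones u = 0" using outer(2) unfolding count_eq_zero_iff set_mset_mset by metis
    ultimately have lv: "Suc (length v) = k" using xs(2) nones_all[OF v] by simp
    have "Suc (length u + length v) = 2 * k" using xs(1) unfolding bw outer(1) N_def by simp
    hence lu: "length u = k" using lv by simp
    have "bits u = replicate k True" using bits_eq_replicate_True[OF outer(2)] lu by simp
    moreover have "bits v = replicate (k - 1) False" using bits_eq_replicate_False[OF v] lv by simp
    ultimately show ?thesis unfolding bw outer(1) b by simp
  next
    case (inner u v c y)
    have False using sp sweep_inner(1)[OF inner(2-5)] unfolding bw inner(1) by blast
    thus ?thesis ..
  qed
next
  assume bits: "bits xs = B0"
  obtain b w where bw: "xs = b # w" using xs N_ge by (cases xs) auto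
  have b: "b = None" and w: "bits w = replicate k True @ replicate (k - 1) False" using bits bw by simp_all
  have "bits (take k w) = replicate k True" "bits (drop k w) = replicate (k - 1) False"
    unfolding take_map[symmetric] drop_map[symmetric] w by simp_all
  hence "set (bits (take k w)) \<subseteq> {True}" "set (bits (drop k w)) \<subseteq> {False}" by auto
  hence "\<forall>x\<in>set (take k w). occ x" "\<forall>x\<in>set (drop k w). \<not> occ x" by (simp_all add: image_subset_iff)
  from sweep_outer(1)[OF this, of b] show "special xs" using b by (simp add: bw)
qed

text \<open>\<open>H\<close> is applied when the tokens fill exactly the first k cells, which it
  permutes among themselves. So the patterns follow \<open>bshift\<close> whatever \<open>H\<close>
  is.\<close>

lemma bits_permute:
  assumes "bits z = B" shows "bits (permute_list H z) = B"
proof -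
  have len: "length z = N" using arg_cong[OF assms, of length] by (simp add: N_def)
  have nth: "z ! j \<noteq> None \<longleftrightarrow> j < k" if "j < N" for j
  proof -
    have "bits z ! j = (j < k)" using that unfolding assms by (simp add: nth_append N_def)
    thus ?thesis using that len by simp
  qed
  have Hk: "H j < k \<longleftrightarrow> j < k" for j using permutes_in_image[OF H, of j] by simp
  have HN: "H j < N" if "j < N" for j using that permutes_in_image[OF H_N, of j] by simp
  show ?thesis
  proof (rule nth_equalityI)
    fix j assume "j < length (bits (permute_list H z))"
    hence j: "j < N" using len by simp
    have "permute_list H z ! j = z ! H j" using j len H_N by (intro permute_list_nth) auto
    hence "bits (permute_list H z) ! j \<longleftrightarrow> z ! H j \<noteq> None" using j len by simp
    also have "\<dots> \<longleftrightarrow> j < k" using nth[OF HN[OF j]] Hk by simp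
    also have "\<dots> \<longleftrightarrow> B ! j" using j by (simp add: nth_append N_def)
    finally show "bits (permute_list H z) ! j = B ! j" by simp
  qed (simp add: len N_def)
qed

lemma bits_sweep:
  assumes xs: "length xs = N" "nones xs = k"
  shows "bits (sweep xs) = bshift (bits xs)"
proof (cases "special xs")
  case True
  have "bits (cshift occ xs) = B" using special_iff[OF xs] True bits_cshift[of xs] bshift_B0 by simp
  hence "bits (permute_list H (cshift occ xs)) = B" by (rule bits_permute)
  thus ?thesis using True special_iff[OF xs] bshift_B0 by (simp add: sweep_def)
next
  case False
  thus ?thesis using bits_cshift[of xs] by (simp add: sweep_def)
qed

lemma bits_orbit: "bits (orbit M) = (bshift ^^ M) B"
proof (induction M)
  case (Suc M)
  have "bits (orbit (Suc M)) = bits (sweep (orbit M))" by simp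
  also have "\<dots> = bshift (bits (orbit M))" by (intro bits_sweep orbit_props)
  finally show ?case using Suc by simp
qed (simp add: bits_start)

lemma bshift_funpow_B: "(bshift ^^ M) B = B \<longleftrightarrow> (N choose k) dvd M"
  using bshift_period[of M k k] by (simp add: N_def mult_2)

lemma special_orbit: "special (orbit M) \<longleftrightarrow> (N choose k) dvd Suc M"
proof -
  have "special (orbit M) \<longleftrightarrow> (bshift ^^ M) B = B0" using special_iff orbit_props bits_orbit by simp
  also have "\<dots> \<longleftrightarrow> bshift ((bshift ^^ M) B) = bshift B0" using inj_bshift by (simp only: inj_eq)
  also have "\<dots> \<longleftrightarrow> (bshift ^^ Suc M) B = B" unfolding bshift_B0 by simp
  finally show ?thesis unfolding bshift_funpow_B .
qed

lemma choose_pos: "(N choose k) > 0" using k_le_N by (simp add: zero_less_binomial)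

text \<open>During the first cycle of patterns \<open>H\<close> acts in the last sweep only. The
  arrangement of labels before it is therefore independent of \<open>H\<close>, which can be chosen
  to correct it.\<close>

lemma orbit_choose: "orbit (N choose k) = permute_list H ((cshift occ ^^ (N choose k)) start)"
proof -
  have eq: "orbit M = (cshift occ ^^ M) start" if "M < (N choose k)" for M
    using that
  proof (induction M)
    case (Suc M)
    have "\<not> (N choose k) dvd Suc M" using Suc.prems by (auto dest: dvd_imp_le)
    hence "\<not> special (orbit M)" unfolding special_orbit .
    thus ?case using Suc by (simp add: sweep_def)
  qed simp
  obtain m where m: "(N choose k) = Suc m" using choose_pos gr0_implies_Suc by blast
  have "special (orbit m)" unfolding special_orbit m by simp
  hence "orbit (Suc m) = permute_list H (cshift occ (orbit m))" by (simp add: sweep_def)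
  also have "orbit m = (cshift occ ^^ m) start" by (rule eq) (simp add: m)
  finally show ?thesis unfolding m by simp
qed

text \<open>Sweeps move tokens without regard to their labels. So the relabelling c of one cycle
  accumulates to c^q after q cycles.\<close>

lemma sweep_map_option:
  assumes "length xs = N" shows "sweep (map (map_option r) xs) = map (map_option r) (sweep xs)"
proof -
  have occ_eq: "occ (map_option r x) = occ x" for x by simp
  have c: "cshift occ (map (map_option r) xs) = map (map_option r) (cshift occ xs)"
    using map_cshift[of "map_option r" occ xs] unfolding occ_eq by simp
  have "special (map (map_option r) xs) = special xs"
    using assms N_ge by (cases xs) (simp_all add: special_def dropWhile_map o_def)
  moreover have "permute_list H (map (map_option r) (cshift occ xs)) = map (map_option r) (permute_list H (cshift occ xs))"
    using assms H_N by (intro permute_list_map) simp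
  ultimately show ?thesis using c by (simp add: sweep_def)
qed

text \<open>The orbit returns to \<open>start\<close> because some power of c is the identity. A
  return needs the pattern back, so it comes after q full cycles, and the labels back, so n dvd
  q.\<close>

lemma orbit_distinct:
  assumes c: "c permutes {..<k}" and shift: "orbit (N choose k) = map (map_option c) start"
    and ord: "\<And>m. (\<forall>i<k. (c ^^ m) i = i) \<Longrightarrow> n dvd m"
    and T: "T < (N choose k) * n" and M: "M < T"
  shows "orbit M \<noteq> orbit T"
proof
  assume eq: "orbit M = orbit T"
  let ?L = "N choose k"
  have shift': "orbit (M + ?L) = map (map_option c) (orbit M)" for M
  proof (induction M)
    case (Suc M)
    have "orbit (Suc M + ?L) = sweep (orbit (M + ?L))" by simp
    also have "\<dots> = map (map_option c) (sweep (orbit M))"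
      unfolding Suc by (intro sweep_map_option orbit_props)
    finally show ?case by simp
  qed (use shift in simp)
  have mult: "orbit (q * ?L) = map (map_option (c ^^ q)) start" for q
  proof (induction q)
    case 0
    have "map_option id = (id :: nat option \<Rightarrow> nat option)" by (rule option.map_id0)
    thus ?case by (simp add: id_def)
  next
    case (Suc q)
    have "orbit (Suc q * ?L) = orbit (q * ?L + ?L)" by (simp add: add.commute)
    also have "\<dots> = map (map_option c) (map (map_option (c ^^ q)) start)" unfolding shift' Suc ..
    finally show ?case by (simp add: o_def option.map_comp)
  qed
  have period: "?L * n \<le> p" if p: "p > 0" "orbit p = start" for p
  proof -
    have "(bshift ^^ p) B = B" using bits_orbit[of p] p(2) bits_start by simp
    hence "?L dvd p" unfolding bshift_funpow_B .
    then obtain q where q: "p = q * ?L" by (metis dvd_def mult.commute)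
    have "map (map_option (c ^^ q)) start = start" using mult[of q] p(2) unfolding q by simp
    hence "map_option (c ^^ q) x = x" if "x \<in> set start" for x
      using that by (metis map_idI map_eq_conv map_ident)
    hence "\<forall>i<k. (c ^^ q) i = i" by (fastforce simp: start_def)
    hence "n dvd q" by (rule ord)
    moreover have "q > 0" using p(1) q by (cases q) auto
    ultimately have "n \<le> q" by (rule dvd_imp_le)
    thus ?thesis using q by simp
  qed
  obtain j where j: "c ^^ j = id" "j > 0"
    using permutation_is_nilpotent[of c] c permutation_permutes[of c] by blast
  have "orbit (j * ?L) = start"
    unfolding mult j(1) option.map_id0 list.map_id0 by simp
  hence "\<exists>p>0. orbit p = start" using j(2) choose_pos by (intro exI[of _ "j * ?L"]) simp
  \<comment> \<open>For the first return p > T, a repetition \<open>orbit M = orbit T\<close>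
    followed by p - T further sweeps would reach \<open>start\<close> already after p - T + M < p
    sweeps.\<close>
  then obtain p where p: "p > 0" "orbit p = start" "\<And>i. i < p \<Longrightarrow> i > 0 \<Longrightarrow> orbit i \<noteq> start"
    using exists_least_iff[of "\<lambda>p. p > 0 \<and> orbit p = start"] by auto
  have pT: "T < p" using period[OF p(1,2)] T by simp
  have "orbit (p - T + M) = (sweep ^^ (p - T)) (orbit M)" by (simp add: funpow_add)
  also have "\<dots> = (sweep ^^ (p - T)) (orbit T)" unfolding eq ..
  also have "\<dots> = orbit (p - T + T)" unfolding funpow_add o_apply ..
  also have "p - T + T = p" using pT by simp
  also have "orbit p = start" by (rule p(2))
  finally have "orbit (p - T + M) = start" .
  moreover have "orbit (p - T + M) \<noteq> start"
    by (rule p(3)) (use pT M in simp_all)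
  ultimately show False by contradiction
qed

end

lemma rearrangement_permutes:
  assumes bits: "bits y = replicate k True @ replicate l False"
    and m: "mset y = mset (map Some [0..<k] @ replicate l None)"
  shows "(\<lambda>j. if j < k then the (y ! j) else j) permutes {..<k}"
proof -
  define ps where "ps = map the (take k y)"
  have len: "length y = k + l" using arg_cong[OF bits, of length] by simp
  have "set (bits (take k y)) \<subseteq> {True}" "set (bits (drop k y)) \<subseteq> {False}"
    unfolding take_map[symmetric] drop_map[symmetric] bits by auto
  hence t: "\<forall>x\<in>set (take k y). x \<noteq> None" and d: "\<forall>x\<in>set (drop k y). x = None" by (simp_all add: image_subset_iff)
  have "filter (\<lambda>x. x \<noteq> None) (take k y @ drop k y) = take k y"
    unfolding filter_append using t d by (simp add: filter_id_conv filter_empty_conv)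
  hence "mset (take k y) = filter_mset (\<lambda>x. x \<noteq> None) (mset y)" by (simp add: mset_filter[symmetric])
  also have "\<dots> = mset (filter (\<lambda>x. x \<noteq> None) (map Some [0..<k] @ replicate l None))" unfolding m by (simp only: mset_filter)
  also have "filter (\<lambda>x. x \<noteq> None) (map Some [0..<k] @ replicate l None) = map Some [0..<k]"
    by (simp add: filter_id_conv filter_empty_conv)
  finally have mt: "mset (take k y) = mset (map Some [0..<k])" .
  have "mset ps = image_mset the (mset (map Some [0..<k]))" unfolding ps_def mset_map mt ..
  also have "\<dots> = mset [0..<k]" unfolding mset_map[symmetric] by (simp add: o_def)
  finally have mp: "mset ps = mset [0..<k]" .
  have "distinct ps" using mset_eq_imp_distinct_iff[OF mp] by simp
  moreover have "set ps = {..<k}" using mset_eq_setD[OF mp] by (simp add: lessThan_atLeast0)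
  moreover have "length ps = k" using mset_eq_length[OF mp] by simp
  ultimately have "bij_betw ((!) ps) {..<k} {..<k}" by (intro bij_betw_nth) auto
  hence "bij_betw (\<lambda>j. if j < k then the (y ! j) else j) {..<k} {..<k}"
    by (rule bij_betw_cong[THEN iffD1, rotated]) (simp add: ps_def len)
  thus ?thesis by (rule bij_imp_permutes) simp
qed

text \<open>After one cycle of plain shifts cell j < k holds the label rho j. With H = inv rho o c
  it then holds rho (H j) = c j.\<close>

lemma sweep_machine_exists:
  assumes a: "a \<ge> 2" and c: "c permutes {..<a*a}"
  obtains H where "sweep_machine a (a*a) (2*(a*a)) H"
    "(sweep_machine.sweep H ^^ (2*(a*a) choose (a*a))) (sweep_machine.start (a*a)) = map (map_option c) (sweep_machine.start (a*a))"
proof -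
  define k where "k = a * a"
  define L where "L = (2 * k choose k)"
  define st where "st = map Some [0..<k] @ replicate k (None :: nat option)"
  define y where "y = (cshift (\<lambda>x. x \<noteq> None) ^^ L) st"
  \<comment> \<open>An auxiliary instance with trivial \<open>H\<close>: its facts on patterns are
    used to define the actual \<open>H\<close>.\<close>
  interpret id: sweep_machine a k "2 * k" id
    using a by unfold_locales (simp_all add: k_def permutes_id)
  have st: "id.start = st" by (simp add: id.start_def st_def)
  have yb: "bits y = replicate k True @ replicate k False"
  proof -
    have "bits y = (bshift ^^ L) (bits st)" unfolding y_def by (rule bits_funpow_cshift)
    also have "bits st = replicate k True @ replicate k False" using id.bits_start st by simp
    finally show ?thesis using id.bshift_funpow_B[of L] by (simp add: L_def)
  qed
  have my: "mset y = mset (map Some [0..<k] @ replicate k None)"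
    unfolding y_def mset_funpow_cshift st_def ..
  define rho where "rho = (\<lambda>j. if j < k then the (y ! j) else j)"
  have rho: "rho permutes {..<k}" unfolding rho_def by (rule rearrangement_permutes[OF yb my])
  define H where "H = inv rho \<circ> c"
  have ck: "c permutes {..<k}" using c by (simp add: k_def)
  have H: "H permutes {..<k}" unfolding H_def by (rule permutes_compose[OF ck permutes_inv[OF rho]])
  interpret sweep_machine a k "2 * k" H
    using a H by unfold_locales (simp_all add: k_def)
  have len: "length y = 2 * k" using arg_cong[OF yb, of length] by simp
  have nth: "y ! j = (if j < k then Some (rho j) else None)" if "j < 2 * k" for j
  proof -
    have "bits y ! j = (j < k)" using that unfolding yb by (simp add: nth_append)
    hence "y ! j \<noteq> None \<longleftrightarrow> j < k" using that len by simp
    thus ?thesis by (auto simp: rho_def)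
  qed
  have "permute_list H y = map (map_option c) start"
  proof (rule nth_equalityI)
    fix j assume "j < length (permute_list H y)"
    hence j: "j < 2 * k" using len by simp
    have "permute_list H y ! j = y ! H j" using j len H_N by (intro permute_list_nth) auto
    also have "\<dots> = map (map_option c) start ! j"
    proof (cases "j < k")
      case True
      have Hj: "H j < k" using permutes_in_image[OF H, of j] True by simp
      have "rho (H j) = c j" unfolding H_def o_apply by (rule permutes_inverses(1)[OF rho])
      thus ?thesis using nth[of "H j"] Hj True by (simp add: start_def nth_append)
    next
      case False
      have "H j = j" using False permutes_not_in[OF H, of j] by simp
      thus ?thesis using nth[of j] j False by (simp add: start_def nth_append)
    qed
    finally show "permute_list H y ! j = map (map_option c) start ! j" .
  qed (simp add: len length_start)
  hence "orbit L = map (map_option c) start"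
    using orbit_choose by (simp add: L_def y_def st_def start_def)
  thus thesis using that[of H] sweep_machine_axioms by (simp add: L_def k_def)
qed

section \<open>The lower bound\<close>

primrec run_word :: "(nat \<Rightarrow> 'q \<Rightarrow> 'q option) \<Rightarrow> nat list \<Rightarrow> 'q \<Rightarrow> 'q option" where
  "run_word t [] s = Some s"
| "run_word t (l # w) s = Option.bind (t l s) (run_word t w)"

text \<open>Both maxima in the definition of \<open>max_diam\<close> are taken by
  \<open>Max\<close>, so finiteness comes before any lower bound.\<close>

lemma finite_expressed:
  assumes "is_pdfa n m \<delta>" shows "finite (range (expressed n \<delta>))"
proof (rule finite_subset)
  let ?F = "{f. \<forall>q. (q \<in> {..<n} \<longrightarrow> f q \<in> insert None (Some ` {..<n})) \<and> (q \<notin> {..<n} \<longrightarrow> f q = None)}"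
  show "finite ?F" by (intro finite_set_of_finite_funs) auto
  have less: "p < n" if "delta_word \<delta> q w = Some p" "q < n" for q w p
    using that
  proof (induction w arbitrary: q)
    case (Cons l w)
    then obtain q' where "\<delta> q l = Some q'" "delta_word \<delta> q' w = Some p" by (auto split: option.splits)
    moreover from this have "q' < n" using assms unfolding is_pdfa_def by blast
    ultimately show ?case using Cons.IH by blast
  qed simp
  show "range (expressed n \<delta>) \<subseteq> ?F"
  proof (intro image_subsetI CollectI allI conjI impI)
    fix w q assume "q \<in> {..<n}"
    thus "expressed n \<delta> w q \<in> insert None (Some ` {..<n})"
      using less[of q w] by (cases "delta_word \<delta> q w") (auto simp: expressed_def)
  qed (simp add: expressed_def)
qed

lemma finite_pdfa: "finite {\<delta>. is_pdfa n m \<delta>}"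
proof (rule finite_subset)
  let ?G = "{g. \<forall>a. (a \<in> {..<m} \<longrightarrow> g a \<in> insert None (Some ` {..<n})) \<and> (a \<notin> {..<m} \<longrightarrow> g a = None)}"
  let ?F = "{\<delta>. \<forall>q. (q \<in> {..<n} \<longrightarrow> \<delta> q \<in> ?G) \<and> (q \<notin> {..<n} \<longrightarrow> \<delta> q = (\<lambda>_. None))}"
  have "finite ?G" by (intro finite_set_of_finite_funs) auto
  thus "finite ?F" by (intro finite_set_of_finite_funs) auto
  show "{\<delta>. is_pdfa n m \<delta>} \<subseteq> ?F"
  proof
    fix \<delta> assume "\<delta> \<in> {\<delta>. is_pdfa n m \<delta>}"
    hence d: "is_pdfa n m \<delta>" by simp
    have "\<delta> q \<in> ?G" for q
    proof (intro CollectI allI conjI impI)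
      fix a show "\<delta> q a \<in> insert None (Some ` {..<n})"
        using d unfolding is_pdfa_def by (cases "\<delta> q a") auto
    next
      fix a assume "a \<notin> {..<m}"
      thus "\<delta> q a = None" using d unfolding is_pdfa_def by simp
    qed
    moreover have "\<delta> q = (\<lambda>_. None)" if "q \<notin> {..<n}" for q
    proof
      fix a show "\<delta> q a = None" using d that unfolding is_pdfa_def by simp
    qed
    ultimately show "\<delta> \<in> ?F" by blast
  qed
qed

lemma depth_le_max_diam:
  assumes d: "is_pdfa n m \<delta>" and w: "w \<in> words m"
  shows "depth n m \<delta> (expressed n \<delta> w) \<le> max_diam n m"
proof -
  have "finite (expressed n \<delta> ` words m)" by (rule finite_subset[OF _ finite_expressed[OF d]]) auto
  hence "depth n m \<delta> (expressed n \<delta> w) \<le> diameter n m \<delta>"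
    unfolding diameter_def using w by (intro Max_ge) auto
  also have "\<dots> \<le> max_diam n m"
    unfolding max_diam_def using d finite_pdfa by (intro Max_ge) auto
  finally show ?thesis .
qed

text \<open>States are numbered from 0 to card Q - 1, and the remaining numbers below n get no
  transitions, so one machine serves all larger n. Words expressing the same transformation agree on
  \<open>Q\<close> because the numbering is injective.\<close>

lemma max_diam_ge:
  fixes Q :: "'q set" and t :: "nat \<Rightarrow> 'q \<Rightarrow> 'q option"
  assumes Q: "finite Q" "card Q \<le> n"
    and closed: "\<And>l s s'. l < m \<Longrightarrow> s \<in> Q \<Longrightarrow> t l s = Some s' \<Longrightarrow> s' \<in> Q"
    and w: "set w \<subseteq> {..<m}"
    and len: "\<And>u. set u \<subseteq> {..<m} \<Longrightarrow> (\<And>s. s \<in> Q \<Longrightarrow> run_word t u s = run_word t w s) \<Longrightarrow> T \<le> length u"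
  shows "T \<le> max_diam n m"
proof -
  obtain f where f: "bij_betw f Q {0..<card Q}" using ex_bij_betw_finite_nat[OF Q(1)] by blast
  define g where "g = inv_into Q f"
  have gf: "g (f s) = s" if "s \<in> Q" for s using f that by (simp add: g_def bij_betw_def)
  have fQ: "f s < card Q" if "s \<in> Q" for s using f that by (auto simp: bij_betw_def)
  have gQ: "g q \<in> Q" if "q < card Q" for q using f that by (auto simp: g_def bij_betw_def intro!: inv_into_into)
  define \<delta> where "\<delta> = (\<lambda>q l. if q < card Q \<and> l < m then map_option f (t l (g q)) else None)"
  have pdfa: "is_pdfa n m \<delta>"
    unfolding is_pdfa_def \<delta>_def using Q(2) closed gQ fQ by (auto split: if_splits) fastforce
  have word: "delta_word \<delta> (f s) u = map_option f (run_word t u s)" if "set u \<subseteq> {..<m}" "s \<in> Q" for u s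
    using that
  proof (induction u arbitrary: s)
    case (Cons l u)
    have "\<delta> (f s) l = map_option f (t l s)" using Cons.prems by (simp add: \<delta>_def fQ gf)
    thus ?case using Cons.IH closed[of l s] Cons.prems by (cases "t l s") auto
  qed simp
  have runQ: "s' \<in> Q" if "set u \<subseteq> {..<m}" "s \<in> Q" "run_word t u s = Some s'" for u s s'
    using that closed by (induction u arbitrary: s) (auto simp: bind_eq_Some_conv)
  have ww: "w \<in> words m" using w by (auto simp: words_def)
  have "\<exists>l. \<exists>u \<in> words m. length u = l \<and> expressed n \<delta> u = expressed n \<delta> w" using ww by blast
  hence "\<exists>u \<in> words m. length u = depth n m \<delta> (expressed n \<delta> w) \<and> expressed n \<delta> u = expressed n \<delta> w"
    unfolding depth_def by (rule LeastI_ex)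
  then obtain u where u: "u \<in> words m" "length u = depth n m \<delta> (expressed n \<delta> w)" "expressed n \<delta> u = expressed n \<delta> w"
    by blast
  have us: "set u \<subseteq> {..<m}" using u(1) by (auto simp: words_def)
  have "run_word t u s = run_word t w s" if s: "s \<in> Q" for s
  proof -
    have "f s < n" using fQ[OF s] Q(2) by simp
    hence "delta_word \<delta> (f s) u = delta_word \<delta> (f s) w" using fun_cong[OF u(3), of "f s"] by (simp add: expressed_def)
    hence eq: "map_option f (run_word t u s) = map_option f (run_word t w s)" using word[OF us s] word[OF w s] by simp
    show ?thesis
    proof (rule option.inj_map_strong[OF _ eq])
      fix x y assume "x \<in> set_option (run_word t u s)" "y \<in> set_option (run_word t w s)" and xy: "f x = f y"
      hence run: "run_word t u s = Some x" "run_word t w s = Some y" by (simp_all add: elem_set)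
      have "x \<in> Q" "y \<in> Q" by (rule runQ[OF us s run(1)], rule runQ[OF w s run(2)])
      have "x = g (f x)" by (rule gf[OF \<open>x \<in> Q\<close>, symmetric])
      also have "\<dots> = y" unfolding xy by (rule gf[OF \<open>y \<in> Q\<close>])
      finally show "x = y" .
    qed
  qed
  with us have "T \<le> length u" by (rule len)
  thus ?thesis using u(2) depth_le_max_diam[OF pdfa ww] by linarith
qed

text \<open>The nowhere defined transformation is not expressed by the empty word. Positivity lets
  \<open>max_diam\<close> be recovered from its logarithm for every n in the theorem, also the small
  ones.\<close>

lemma max_diam_pos:
  assumes "n \<ge> 1" "m \<ge> 1" shows "max_diam n m \<ge> 1"
proof (rule max_diam_ge[where Q = "{0::nat}" and t = "\<lambda>_ _. None" and w = "[0]"])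
  fix u :: "nat list" assume "\<And>s. s \<in> {0::nat} \<Longrightarrow> run_word (\<lambda>_ _. None) u s = run_word (\<lambda>_ _. None) [0] s"
  from this[of 0] show "1 \<le> length u" by (cases u) auto
qed (use assms in auto)

lemma max_diam_ge_machine:
  assumes a: "a \<ge> 2" and n: "2 * a^2 + 4 * a + 9 \<le> n" and c: "c permutes {..<a*a}"
    and ord: "\<And>m. (\<forall>i<a*a. (c ^^ m) i = i) \<Longrightarrow> p dvd m" and p: "p > 0"
  shows "(2*(a*a) choose (a*a)) * p - 1 \<le> max_diam n 13"
proof -
  obtain H where M: "sweep_machine a (a*a) (2*(a*a)) H"
    "(sweep_machine.sweep H ^^ (2*(a*a) choose (a*a))) (sweep_machine.start (a*a)) = map (map_option c) (sweep_machine.start (a*a))"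
    using sweep_machine_exists[OF a c] .
  interpret sweep_machine a "a*a" "2*(a*a)" H by (rule M(1))
  \<comment> \<open>The members of the orbit with index below (2k choose k) * p are pairwise
    distinct, where k = a * a; this is the last such index.\<close>
  let ?T = "(2*(a*a) choose (a*a)) * p - 1"
  have pos: "(2*(a*a) choose (a*a)) * p > 0" by (rule mult_pos_pos[OF choose_pos p])
  obtain w where w: "set w \<subseteq> set alphabet"
    "\<And>u. set u \<subseteq> set alphabet \<Longrightarrow> (\<And>s. s \<in> tokens \<Longrightarrow> run u s = run w s) \<Longrightarrow> ?T \<le> length u"
  proof (rule orbit_word[of ?T])
    fix M assume "M < ?T"
    thus "orbit M \<noteq> orbit ?T" using pos by (intro orbit_distinct[OF c M(2) ord]) auto
  qed blast
  define t where "t = (\<lambda>l. tr (alphabet ! l))"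
  have len: "length alphabet = 13" by (simp add: alphabet_def)
  have run: "run_word t u s = run (map ((!) alphabet) u) s" for u s
  proof (induction u arbitrary: s)
    case (Cons l u)
    have "t l s = tr (alphabet ! l) s" by (simp add: t_def)
    thus ?case by (cases "tr (alphabet ! l) s") (simp_all add: Cons)
  qed simp
  have "w \<in> lists (set alphabet)" using w(1) by auto
  also have "set alphabet = (!) alphabet ` {..<13}" by (auto simp: set_conv_nth len image_def)
  finally have "w \<in> map ((!) alphabet) ` lists {..<13}" unfolding lists_image .
  then obtain v where v: "set v \<subseteq> {..<13}" "w = map ((!) alphabet) v" by auto
  have nth_in: "set (map ((!) alphabet) u) \<subseteq> set alphabet" if "set u \<subseteq> {..<13}" for u
    using that len by (auto intro!: nth_mem)
  show ?thesis
  proof (rule max_diam_ge[where Q = states and t = t and w = v])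
    show "card states \<le> n" using card_states n by simp
    show "s' \<in> states" if "l < 13" "s \<in> states" "t l s = Some s'" for l s s'
      using that tr_states[of "alphabet ! l" s s'] len by (simp add: t_def)
    fix u :: "nat list" assume u: "set u \<subseteq> {..<13}" "\<And>s. s \<in> states \<Longrightarrow> run_word t u s = run_word t v s"
    have "?T \<le> length (map ((!) alphabet) u)"
    proof (rule w(2))
      show "set (map ((!) alphabet) u) \<subseteq> set alphabet" by (rule nth_in[OF u(1)])
      fix s assume "s \<in> tokens"
      hence "s \<in> states" using tokens_states by blast
      thus "run (map ((!) alphabet) u) s = run w s" using u(2) by (simp add: run v(2))
    qed
    thus "?T \<le> length u" by simp
  qed (use finite_states v(1) in auto)
qed

text \<open>The first term comes from the order of the permutation with the number of labels rounded
  down to a square, 12 sqrt(n/2) ln 2 is the loss from 4^k against 2^n, and ln (2n) covers the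
  central binomial coefficient. The losses are of lower order than the main term.\<close>

lemma asymptotic_comparison:
  assumes e: "0 < e" "e < 1/2"
  shows "eventually (\<lambda>n::nat. (1 - e) * ((sqrt (real n / 2) - 3) * sqrt (2 * ln (sqrt (real n / 2) - 3))) - 12 * sqrt (real n / 2) * ln 2 - ln (2 * real n)
      \<ge> (1 - 2 * e) * sqrt (real n / 2 * ln (real n))) sequentially"
proof -
  define X where "X = (\<lambda>n::nat. sqrt (real n / 2 * ln (real n)))"
  define Y where "Y = (\<lambda>n::nat. (sqrt (real n / 2) - 3) * sqrt (2 * ln (sqrt (real n / 2) - 3)))"
  define W where "W = (\<lambda>n::nat. 12 * sqrt (real n / 2) * ln 2 + ln (2 * real n))"
  have "(\<lambda>n. Y n / X n) \<longlonglongrightarrow> 1" unfolding X_def Y_def by real_asymp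
  moreover have "(\<lambda>n. W n / X n) \<longlonglongrightarrow> 0" unfolding X_def W_def by real_asymp
  ultimately have "(\<lambda>n. (1 - e) * (Y n / X n) - W n / X n) \<longlonglongrightarrow> (1 - e) * 1 - 0" by (intro tendsto_intros)
  hence "eventually (\<lambda>n. (1 - e) * (Y n / X n) - W n / X n > 1 - 2 * e) sequentially"
    using e by (intro order_tendstoD) auto
  moreover have "eventually (\<lambda>n. X n > 0) sequentially" unfolding X_def by real_asymp
  ultimately show ?thesis
  proof eventually_elim
    case (elim n)
    have "(1 - 2 * e) * X n \<le> ((1 - e) * (Y n / X n) - W n / X n) * X n" using elim by (intro mult_right_mono) auto
    also have "\<dots> = (1 - e) * Y n - W n" using elim by (simp add: field_simps)
    finally show ?case by (simp add: X_def Y_def W_def)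
  qed
qed

lemma eventually_max_diam_ge:
  assumes e: "0 < e" "e < 1/2"
  shows "eventually (\<lambda>n. ln (real (max_diam n 13)) - real n * ln 2 \<ge> (1 - 2 * e) * sqrt (real n / 2 * ln (real n))) sequentially"
proof -
  \<comment> \<open>Subtracting 2 makes room for the control states: with s = sqrt (n/2) and a <= s
    - 2, 2 a^2 + 4 a + 9 <= 2 s^2 - 4 s + 9 <= n.\<close>
  define a where "a = (\<lambda>n::nat. nat \<lfloor>sqrt (real n / 2)\<rfloor> - 2)"
  have "filterlim (\<lambda>n. real (nat \<lfloor>sqrt (real n / 2)\<rfloor>) - 2) at_top sequentially" by real_asymp
  hence lim: "filterlim a at_top sequentially"
    unfolding a_def filterlim_at_top
  proof (intro allI)
    fix Z :: nat
    assume "\<forall>Z. \<forall>\<^sub>F n in sequentially. Z \<le> real (nat \<lfloor>sqrt (real n / 2)\<rfloor>) - 2"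
    hence "\<forall>\<^sub>F n in sequentially. real Z \<le> real (nat \<lfloor>sqrt (real n / 2)\<rfloor>) - 2" by blast
    thus "\<forall>\<^sub>F n in sequentially. Z \<le> nat \<lfloor>sqrt (real n / 2)\<rfloor> - 2" by eventually_elim linarith
  qed
  have lim2: "filterlim (\<lambda>n. a n * a n) at_top sequentially"
    by (rule filterlim_at_top_mono[OF lim]) (simp add: always_eventually)
  from eventually_compose_filterlim[OF eventually_landau_permutation[OF e(1)] lim2]
  have "eventually (\<lambda>n. \<exists>c p. c permutes {..<a n * a n} \<and> (\<forall>m. (\<forall>i<a n * a n. (c ^^ m) i = i) \<longrightarrow> p dvd m) \<and>
     exp ((1 - e) * sqrt (real (a n * a n) * ln (real (a n * a n)))) \<le> real p) sequentially" .
  moreover have "eventually (\<lambda>n::nat. sqrt (real n / 2) > 5) sequentially" by real_asymp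
  moreover note asymptotic_comparison[OF e]
  ultimately show ?thesis
  proof eventually_elim
    case (elim n)
    define s where "s = sqrt (real n / 2)"
    define b where "b = a n"
    define k where "k = b * b"
    have s: "s > 5" "s^2 = real n / 2" using elim by (simp_all add: s_def)
    have fl: "real (nat \<lfloor>s\<rfloor>) \<le> s" "real (nat \<lfloor>s\<rfloor>) > s - 1" "nat \<lfloor>s\<rfloor> \<ge> 5"
      using s(1) by linarith+
    have rb: "real b = real (nat \<lfloor>s\<rfloor>) - 2" using fl(3) by (simp add: b_def a_def s_def of_nat_diff)
    have b: "real b \<le> s - 2" "real b \<ge> s - 3" "b \<ge> 2" using fl rb by linarith+
    obtain c p where c: "c permutes {..<k}" "\<And>m. (\<forall>i<k. (c ^^ m) i = i) \<Longrightarrow> p dvd m"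
      and p: "exp ((1 - e) * sqrt (real k * ln (real k))) \<le> real p"
      using elim(1) unfolding k_def b_def by blast
    have p0: "p > 0"
    proof (rule ccontr)
      assume "\<not> p > 0"
      hence "exp ((1 - e) * sqrt (real k * ln (real k))) \<le> 0" using p by simp
      thus False by (simp add: not_le)
    qed
    have k_le: "real k \<le> (s - 2)^2" "real k \<ge> (s - 3)^2"
      using b s(1) by (auto simp: k_def power2_eq_square intro!: mult_mono)
    have "(s - 2)^2 \<le> s^2" using s(1) by (intro power_mono) auto
    hence kn: "real k \<le> real n / 2" using k_le(1) s(2) by simp
    have k4: "k \<ge> 4" using mult_le_mono[OF b(3) b(3)] by (simp add: k_def)
    have "2 * real b ^ 2 + 4 * real b + 9 \<le> real n"
    proof -
      have "real b ^ 2 \<le> (s - 2)^2" using b by (intro power_mono) auto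
      hence "2 * real b ^ 2 + 4 * real b + 9 \<le> 2 * (s - 2)^2 + 4 * (s - 2) + 9"
        using b(1) by (intro add_mono mult_left_mono) auto
      also have "\<dots> = 2 * s^2 - 4 * s + 9" by (simp add: power2_eq_square algebra_simps)
      also have "\<dots> \<le> real n" using s by simp
      finally show ?thesis .
    qed
    hence "real (2 * b^2 + 4 * b + 9) \<le> real n" by simp
    hence size: "2 * b^2 + 4 * b + 9 \<le> n" by (simp only: of_nat_le_iff)
    define T where "T = (2 * k choose k) * p"
    have T: "T - 1 \<le> max_diam n 13"
      unfolding T_def k_def by (rule max_diam_ge_machine[OF b(3) size c[unfolded k_def] p0])
    have "4 ^ k / (2 * real k) \<le> real (2 * k choose k)" using k4 by (intro central_binomial_lower_bound) simp
    hence "4 ^ k / (2 * real k) * exp ((1 - e) * sqrt (real k * ln (real k))) \<le> real T"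
      unfolding T_def of_nat_mult using p by (intro mult_mono) auto
    moreover have "T \<ge> 2"
    proof -
      have "2 * k choose k \<ge> 2" using binomial_maximum[of "2 * k" 1] k4 by simp
      thus ?thesis using p0 mult_le_mono[of 2 "2 * k choose k" 1 p] by (simp add: T_def)
    qed
    \<comment> \<open>T >= 2 turns the subtracted 1 into a factor 2. Together with the 2 k from the
      central binomial coefficient it makes 4 k.\<close>
    hence "real T / 2 \<le> real (max_diam n 13)" using T by linarith
    ultimately have "4 ^ k / (4 * real k) * exp ((1 - e) * sqrt (real k * ln (real k))) \<le> real (max_diam n 13)"
      by simp
    moreover have "4 ^ k / (4 * real k) * exp ((1 - e) * sqrt (real k * ln (real k))) > 0" using k4 by simp
    ultimately have "ln (4 ^ k / (4 * real k) * exp ((1 - e) * sqrt (real k * ln (real k)))) \<le> ln (real (max_diam n 13))"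
      by (subst ln_le_cancel_iff) auto
    moreover have "ln (4 ^ k / (4 * real k) * exp ((1 - e) * sqrt (real k * ln (real k)))) =
       real k * ln 4 - ln (4 * real k) + (1 - e) * sqrt (real k * ln (real k))"
      using k4 by (simp add: ln_mult ln_div ln_realpow)
    ultimately have main: "real k * ln 4 - ln (4 * real k) + (1 - e) * sqrt (real k * ln (real k)) \<le> ln (real (max_diam n 13))"
      by simp
    \<comment> \<open>The square k is at least (s - 3)^2, so 2 k >= n - 12 s and the loss against
      2^n is exp (O(sqrt n)).\<close>
    have "real n * ln 2 - 12 * s * ln 2 \<le> real k * ln 4"
    proof -
      have "(real n - 12 * s) * ln 2 \<le> (2 * real k) * ln 2"
      proof (rule mult_right_mono)
        have "(s - 3)^2 = s^2 - 6 * s + 9" by (simp add: power2_eq_square algebra_simps)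
        thus "real n - 12 * s \<le> 2 * real k" using k_le(2) s(2) by linarith
      qed simp
      moreover have "ln 4 = 2 * ln (2::real)" using ln_realpow[of 2 2] by simp
      ultimately show ?thesis by (simp add: left_diff_distrib)
    qed
    moreover have "ln (4 * real k) \<le> ln (2 * real n)" using kn k4 by (subst ln_le_cancel_iff) auto
    moreover have "(1 - e) * ((s - 3) * sqrt (2 * ln (s - 3))) \<le> (1 - e) * sqrt (real k * ln (real k))"
    proof (rule mult_left_mono)
      have "(s - 3) * sqrt (2 * ln (s - 3)) = sqrt ((s - 3)^2 * ln ((s - 3)^2))"
        using s(1) by (simp add: real_sqrt_mult ln_realpow)
      also have "\<dots> \<le> sqrt (real k * ln (real k))"
      proof -
        have g1: "(s - 3)^2 \<ge> 1" using s(1) by (intro one_le_power) auto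
        have "ln ((s - 3)^2) \<le> ln (real k)" using k_le(2) g1 by (subst ln_le_cancel_iff) auto
        thus ?thesis using k_le(2) g1 by (intro real_sqrt_le_mono mult_mono) auto
      qed
      finally show "(s - 3) * sqrt (2 * ln (s - 3)) \<le> sqrt (real k * ln (real k))" .
    qed (use e in auto)
    moreover have "(1 - e) * ((s - 3) * sqrt (2 * ln (s - 3))) - 12 * s * ln 2 - ln (2 * real n) \<ge> (1 - 2 * e) * sqrt (real n / 2 * ln (real n))"
      using elim(3) by (simp add: s_def)
    ultimately show ?case using main by linarith
  qed
qed

theorem theorem4:
  shows "\<exists>(m::nat) (\<epsilon>::nat \<Rightarrow> real). m > 0 \<and> \<epsilon> \<longlonglongrightarrow> 0 \<and>
    (\<forall>n\<ge>2. real (max_diam n m) \<ge>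
        2 ^ n * exp ((1 + \<epsilon> n) * sqrt (real n / 2 * ln (real n))))"
proof -
  define X where "X = (\<lambda>n::nat. sqrt (real n / 2 * ln (real n)))"
  define d where "d = (\<lambda>n. ln (real (max_diam n 13)) - real n * ln 2)"
  \<comment> \<open>d n / X n - 1 is the exact exponent and the cap at 0 only weakens the bound. So
    the inequality holds for all n >= 2 by construction, and convergence to 0 is a one-sided
    asymptotic statement.\<close>
  define \<epsilon> where "\<epsilon> = (\<lambda>n. min 0 (d n / X n - 1))"
  have X: "X n > 0" if "n \<ge> 2" for n using that by (simp add: X_def)
  have "\<epsilon> \<longlonglongrightarrow> 0"
  proof (rule tendstoI)
    fix r :: real assume r: "r > 0"
    define e where "e = min (r / 4) (1 / 4)"
    have e: "0 < e" "e < 1/2" "2 * e < r" using r by (auto simp: e_def)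
    show "\<forall>\<^sub>F n in sequentially. dist (\<epsilon> n) 0 < r"
      using eventually_max_diam_ge[OF e(1,2)] eventually_ge_at_top[of 2]
    proof eventually_elim
      case (elim n)
      have "(1 - 2 * e) \<le> d n / X n" using elim X[of n] by (subst pos_le_divide_eq) (simp_all add: d_def X_def)
      thus ?case using e by (auto simp: \<epsilon>_def dist_real_def min_def)
    qed
  qed
  moreover have "real (max_diam n 13) \<ge> 2 ^ n * exp ((1 + \<epsilon> n) * X n)" if n: "n \<ge> 2" for n
  proof -
    have pos: "real (max_diam n 13) > 0" using max_diam_pos[of n 13] n by simp
    have "(1 + \<epsilon> n) * X n \<le> (d n / X n) * X n" using X[OF n] by (intro mult_right_mono) (auto simp: \<epsilon>_def)
    also have "\<dots> = d n" using X[OF n] by simp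
    finally have "exp ((1 + \<epsilon> n) * X n) \<le> exp (d n)" by simp
    also have "exp (d n) = real (max_diam n 13) / 2 ^ n"
      using pos by (simp add: d_def exp_diff exp_of_nat_mult)
    finally show ?thesis by (simp add: field_simps)
  qed
  ultimately show ?thesis unfolding X_def by (intro exI[of _ 13] exI[of _ \<epsilon>]) auto
qed

end
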